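(* Let $p=2$ and $\theta,l>0$, and for an integer $n\ge2$ let $$\Theta_{l,\theta}=\{(x,t)\in\mathbf{R}^{n}\times\mathbf{R}: 0<-t<\theta|x|^l<\theta\}.$$ (a) If $n=2$, then $(0,0)$ is regular for the heat equation with respect to $\Theta_{l,\theta}$ for all $l,\theta>0$, but for $r>0$ it is irregular for the heat equation with respect to the punctured cylinder $(B(0,r)\setminus\{0\})\times(-1,0)$, where $B(0,r)=\{x\in\mathbf{R}^2:|x|<r\}$. (b) If $n\ge3$, then $(0,0)$ is regular for the heat equation with respect to $\Theta_{l,\theta}$ if and only if $l\ge2$.
   Context: Regularity for the heat equation is the following notion with $p=2$. Let $n\ge1$ be an integer, $1<p<\infty$, and let $\Theta\subset\mathbf{R}^{n+1}$ be a nonempty bounded open set, with points written $(x,t)$, $x\in\mathbf{R}^n$, $t\in\mathbf{R}$. $\nabla$ and $\operatorname{div}$ are taken with respect to $x$ only, and $\partial\Theta$ is the full topological boundary. The $p$-parabolic equation is $\partial_t u-\Delta_p u=0$, where $\Delta_p u=\operatorname{div}(|\nabla u|^{p-2}\nabla u)$ (the heat equation if $p=2$). Solutions: $u:\Theta\to[-\infty,\infty]$ is a (weak) solution if for every open cylinder $U_{t_1,t_2}=U\times(t_1,t_2)\Subset\Theta$ we have $u\in C([t_1,t_2];L^2(U))\cap L^p(t_1,t_2;W^{1,p}(U))$ and $$\int_{t_1}^{t_2}\int_U|\nabla u|^{p-2}\nabla u\cdot\nabla\varphi\,dx\,dt-\int_{t_1}^{t_2}\int_U u\,\frac{\partial\varphi}{\partial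 t}\,dx\,dt=0\quad\text{for all }\varphi\in C_0^\infty(U_{t_1,t_2}).$$ A $p$-parabolic function is a continuous solution. Superparabolic functions: $u:\Theta\to(-\infty,\infty]$ is $p$-superparabolic if (i) $u$ is lower semicontinuous; (ii) $u$ is finite in a dense subset of $\Theta$; (iii) for every space-time box $Q_{t_1,t_2}=Q\times(t_1,t_2)\Subset\Theta$, $Q=(a_1,b_1)\times\dots\times(a_n,b_n)$, and every $h$ that is $p$-parabolic in $Q_{t_1,t_2}$, continuous on $\overline{Q_{t_1,t_2}}$ and satisfies $h\le u$ on the parabolic boundary $(\overline{Q}\times\{t_1\})\cup(\partial Q\times(t_1,t_2])$, we have $h\le u$ in $Q_{t_1,t_2}$. Perron solution: for bounded $f:\partial\Theta\to\mathbf{R}$, let $\mathcal{U}_f$ be the set of $p$-superparabolic $u$ on $\Theta$ with $\liminf_{\Theta\ni\eta\to\xi}u(\eta)\ge f(\xi)$ for all $\xi\in\partial\Theta$, and $\overline{H}_\Theta f(\xi)=\inf_{u\in\mathcal{U}_f}u(\xi)$ for $\xi\in\Theta$. Regularity: $\xi_0\in\partial\Theta$ is regular with respect to $\Theta$ if $\lim_{\Theta\ni\xi\to\xi_0}\overline{H}_\Theta f(\xi)=f(\xi_0)$ for all $f\in C(\partial\Theta)$; otherwise it is irregular. *)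

theory Defs
  imports "HOL-Analysis.Analysis"
begin

text \<open>Space-time is the product type \<^typ>\<open>'a \<times> real\<close>, where \<open>'a\<close> plays the role of
  \<open>R^n\<close>. All notions are stated for a general exponent \<open>p\<close>; the heat equation is \<open>p = 2\<close>.\<close>

definition compactly_inside :: "'b::topological_space set \<Rightarrow> 'b set \<Rightarrow> bool" where
  "compactly_inside A B \<longleftrightarrow> compact (closure A) \<and> closure A \<subseteq> B"

fun Ck_function :: "nat \<Rightarrow> ('b::euclidean_space \<Rightarrow> real) \<Rightarrow> bool" where
  "Ck_function 0 f \<longleftrightarrow> continuous_on UNIV f"
| "Ck_function (Suc k) f \<longleftrightarrow>
     (\<forall>x. f differentiable (at x)) \<and>
     (\<forall>v. Ck_function k (\<lambda>x. frechet_derivative f (at x) v))"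

definition test_function :: "'b::euclidean_space set \<Rightarrow> ('b \<Rightarrow> real) \<Rightarrow> bool" where
  "test_function \<Omega> \<phi> \<longleftrightarrow>
     (\<forall>k. Ck_function k \<phi>) \<and> compactly_inside {x. \<phi> x \<noteq> 0} \<Omega>"

definition in_Lp :: "real \<Rightarrow> 'b::euclidean_space set \<Rightarrow> ('b \<Rightarrow> 'c::euclidean_space) \<Rightarrow> bool" where
  "in_Lp p A f \<longleftrightarrow>
     f \<in> borel_measurable (lebesgue_on A) \<and>
     integrable (lebesgue_on A) (\<lambda>x. norm (f x) powr p)"

definition Lp_norm :: "real \<Rightarrow> 'b::euclidean_space set \<Rightarrow> ('b \<Rightarrow> 'c::euclidean_space) \<Rightarrow> real" where
  "Lp_norm p A f = (\<integral>x. norm (f x) powr p \<partial>lebesgue_on A) powr (1 / p)"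

definition weak_gradient_on ::
  "'a::euclidean_space set \<Rightarrow> ('a \<Rightarrow> real) \<Rightarrow> ('a \<Rightarrow> 'a) \<Rightarrow> bool" where
  "weak_gradient_on U w g \<longleftrightarrow>
     (\<forall>\<phi>. test_function U \<phi> \<longrightarrow>
       (\<forall>b\<in>Basis. (\<integral>x. w x * frechet_derivative \<phi> (at x) b \<partial>lebesgue_on U)
                  = - (\<integral>x. (g x \<bullet> b) * \<phi> x \<partial>lebesgue_on U)))"

text \<open>\<open>w\<close> belongs to \<open>W^{1,p}(U)\<close>, and \<open>g\<close> is its weak gradient.\<close>
definition in_W1p ::
  "real \<Rightarrow> 'a::euclidean_space set \<Rightarrow> ('a \<Rightarrow> real) \<Rightarrow> ('a \<Rightarrow> 'a) \<Rightarrow> bool" where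
  "in_W1p p U w g \<longleftrightarrow> in_Lp p U w \<and> in_Lp p U g \<and> weak_gradient_on U w g"

text \<open>\<open>v\<close> belongs to \<open>L^p(t1,t2;W^{1,p}(U))\<close>, and \<open>G\<close> is its (jointly measurable) weak
  gradient in the space variable.\<close>
definition in_Lp_W1p ::
  "real \<Rightarrow> 'a::euclidean_space set \<Rightarrow> real \<Rightarrow> real \<Rightarrow> ('a \<times> real \<Rightarrow> real) \<Rightarrow> ('a \<times> real \<Rightarrow> 'a) \<Rightarrow> bool" where
  "in_Lp_W1p p U t1 t2 v G \<longleftrightarrow>
     in_Lp p (U \<times> {t1<..<t2}) v \<and> in_Lp p (U \<times> {t1<..<t2}) G \<and>
     (AE t in lebesgue_on {t1<..<t2}. in_W1p p U (\<lambda>x. v (x, t)) (\<lambda>x. G (x, t)))"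

text \<open>\<open>v\<close> belongs to \<open>C([t1,t2];L^2(U))\<close>.\<close>
definition in_C_L2 ::
  "'a::euclidean_space set \<Rightarrow> real \<Rightarrow> real \<Rightarrow> ('a \<times> real \<Rightarrow> real) \<Rightarrow> bool" where
  "in_C_L2 U t1 t2 v \<longleftrightarrow>
     (\<forall>t\<in>{t1..t2}. in_Lp 2 U (\<lambda>x. v (x, t))) \<and>
     (\<forall>t\<in>{t1..t2}.
        ((\<lambda>s. Lp_norm 2 U (\<lambda>x. v (x, s) - v (x, t))) \<longlongrightarrow> 0) (at t within {t1..t2}))"

definition space_gradient ::
  "('a::euclidean_space \<times> real \<Rightarrow> real) \<Rightarrow> 'a \<times> real \<Rightarrow> 'a" where
  "space_gradient \<phi> z = (\<Sum>b\<in>Basis. frechet_derivative \<phi> (at z) (b, 0) *\<^sub>R b)"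

definition time_derivative ::
  "('a::euclidean_space \<times> real \<Rightarrow> real) \<Rightarrow> 'a \<times> real \<Rightarrow> real" where
  "time_derivative \<phi> z = frechet_derivative \<phi> (at z) (0, 1)"

text \<open>The Bochner spaces consist of almost-everywhere equivalence classes, so on each cylinder
  \<open>u\<close> is only required to agree almost everywhere with a real-valued function \<open>v\<close> in the two
  spaces. Where \<open>G = 0\<close> the flux \<open>|G|^{p-2} G\<close> is \<open>0\<close> for every \<open>p\<close>, so that the convention
  \<open>0 powr a = 0\<close> is harmless.\<close>
definition weak_solution ::
  "real \<Rightarrow> ('a::euclidean_space \<times> real) set \<Rightarrow> ('a \<times> real \<Rightarrow> ereal) \<Rightarrow> bool" where
  "weak_solution p \<Theta> u \<longleftrightarrow>
     (\<forall>U t1 t2. open U \<and> t1 < t2 \<and> compactly_inside (U \<times> {t1<..<t2}) \<Theta> \<longrightarrow>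
       (\<exists>v G.
          (AE z in lebesgue_on (U \<times> {t1<..<t2}). u z = ereal (v z)) \<and>
          in_C_L2 U t1 t2 v \<and>
          in_Lp_W1p p U t1 t2 v G \<and>
          (\<forall>\<phi>. test_function (U \<times> {t1<..<t2}) \<phi> \<longrightarrow>
             (\<integral>z. (norm (G z) powr (p - 2)) *\<^sub>R G z \<bullet> space_gradient \<phi> z
                 \<partial>lebesgue_on (U \<times> {t1<..<t2}))
             - (\<integral>z. v z * time_derivative \<phi> z \<partial>lebesgue_on (U \<times> {t1<..<t2})) = 0)))"

text \<open>Continuous functions are understood to be real-valued.\<close>
definition p_parabolic ::
  "real \<Rightarrow> ('a::euclidean_space \<times> real) set \<Rightarrow> ('a \<times> real \<Rightarrow> real) \<Rightarrow> bool" where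
  "p_parabolic p \<Theta> h \<longleftrightarrow> continuous_on \<Theta> h \<and> weak_solution p \<Theta> (\<lambda>z. ereal (h z))"

definition parabolic_boundary :: "'a::euclidean_space set \<Rightarrow> real \<Rightarrow> real \<Rightarrow> ('a \<times> real) set" where
  "parabolic_boundary Q t1 t2 = closure Q \<times> {t1} \<union> frontier Q \<times> {t1<..t2}"

definition lower_semicontinuous_on :: "'b::topological_space set \<Rightarrow> ('b \<Rightarrow> ereal) \<Rightarrow> bool" where
  "lower_semicontinuous_on S u \<longleftrightarrow> (\<forall>z\<in>S. u z \<le> Liminf (at z within S) u)"

text \<open>Values of \<open>u\<close> outside \<open>\<Theta>\<close> play no role here or below.\<close>
definition p_superparabolic ::
  "real \<Rightarrow> ('a::euclidean_space \<times> real) set \<Rightarrow> ('a \<times> real \<Rightarrow> ereal) \<Rightarrow> bool" where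
  "p_superparabolic p \<Theta> u \<longleftrightarrow>
     (\<forall>z\<in>\<Theta>. u z \<noteq> -\<infinity>) \<and>
     lower_semicontinuous_on \<Theta> u \<and>
     \<Theta> \<subseteq> closure {z\<in>\<Theta>. u z \<noteq> \<infinity>} \<and>
     (\<forall>a b t1 t2 h.
        t1 < t2 \<and> compactly_inside (box a b \<times> {t1<..<t2}) \<Theta> \<and>
        p_parabolic p (box a b \<times> {t1<..<t2}) h \<and>
        continuous_on (closure (box a b \<times> {t1<..<t2})) h \<and>
        (\<forall>z\<in>parabolic_boundary (box a b) t1 t2. ereal (h z) \<le> u z) \<longrightarrow>
        (\<forall>z\<in>box a b \<times> {t1<..<t2}. ereal (h z) \<le> u z))"

definition upper_class ::
  "real \<Rightarrow> ('a::euclidean_space \<times> real) set \<Rightarrow> ('a \<times> real \<Rightarrow> real) \<Rightarrow> ('a \<times> real \<Rightarrow> ereal) set" where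
  "upper_class p \<Theta> f =
     {u. p_superparabolic p \<Theta> u \<and>
         (\<forall>\<xi>\<in>frontier \<Theta>. Liminf (at \<xi> within \<Theta>) u \<ge> ereal (f \<xi>))}"

definition upper_Perron ::
  "real \<Rightarrow> ('a::euclidean_space \<times> real) set \<Rightarrow> ('a \<times> real \<Rightarrow> real) \<Rightarrow> 'a \<times> real \<Rightarrow> ereal" where
  "upper_Perron p \<Theta> f \<xi> = (INF u\<in>upper_class p \<Theta> f. u \<xi>)"

definition regular_point ::
  "real \<Rightarrow> ('a::euclidean_space \<times> real) set \<Rightarrow> 'a \<times> real \<Rightarrow> bool" where
  "regular_point p \<Theta> \<xi>\<^sub>0 \<longleftrightarrow>
     \<xi>\<^sub>0 \<in> frontier \<Theta> \<and>
     (\<forall>f. continuous_on (frontier \<Theta>) f \<longrightarrow>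
        (upper_Perron p \<Theta> f \<longlongrightarrow> ereal (f \<xi>\<^sub>0)) (at \<xi>\<^sub>0 within \<Theta>))"

definition irregular_point ::
  "real \<Rightarrow> ('a::euclidean_space \<times> real) set \<Rightarrow> 'a \<times> real \<Rightarrow> bool" where
  "irregular_point p \<Theta> \<xi>\<^sub>0 \<longleftrightarrow> \<xi>\<^sub>0 \<in> frontier \<Theta> \<and> \<not> regular_point p \<Theta> \<xi>\<^sub>0"

definition power_domain :: "real \<Rightarrow> real \<Rightarrow> ('a::euclidean_space \<times> real) set" where
  "power_domain l \<theta> =
     {(x, t). 0 < - t \<and> - t < \<theta> * norm x powr l \<and> \<theta> * norm x powr l < \<theta>}"

end

theory Submission
  imports Defs
begin

text \<open>
  Everything rests on two comparison principles. A superparabolic function cannot be touched from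
  below by a strict classical subsolution: at a touching point the second-order Taylor polynomial of
  the subsolution can be tilted to a caloric quadratic polynomial that lies strictly below on the
  parabolic boundary of a small box. Conversely a strict classical supersolution is superparabolic:
  a weak solution is a distributional solution, its mollifications are classical solutions, and at a
  maximum of their difference with the supersolution the derivatives contradict the heat equation.
  Hence an explicit strict supersolution that is positive and vanishes only at the origin proves
  regularity, while a supersolution whose lower limit at the origin is too small proves
  irregularity; the boundary part at time \<open>0\<close>, including the origin itself, is harmless because
  \<open>\<epsilon>/(-t)\<close> is a supersolution.

  With \<open>r = |x|\<close> the barriers are \<open>exp (\<beta> (ln r - exp (n\<^sup>2 |t|/r\<^sup>2)))\<close> if \<open>l \<ge> 2\<close>, and
  \<open>c S powr (-\<alpha>) - L S powr (-\<alpha>-1)\<close> with \<open>S = \<Lambda> - ln (r\<^sup>2 + |t|)\<close> and \<open>L = \<Lambda>/2 - ln r\<close> if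
  \<open>n = 2\<close>: as a function of \<open>x\<close> the latter is essentially the harmonic function \<open>ln r\<close> plus a
  constant, and it increases in time. The punctured cylinder is treated with \<open>\<epsilon> ln (r\<^sub>0/r)\<close>, and for
  \<open>n \<ge> 3\<close>, \<open>l < 2\<close> the potential \<open>r powr (2-n) |t| powr (\<beta>+\<gamma>)\<close> with \<open>\<gamma> = (n-2)/2\<close> and
  \<open>\<beta> = (2/l-1) \<gamma>\<close> is constant on the wall of the hole and tends to \<open>0\<close> along parabolas; two
  correction terms turn it into a supersolution.
\<close>

section \<open>Smooth functions and a smooth bump\<close>

text \<open>No Dirichlet problem is solved anywhere. This shapes both comparisons, since
  superparabolicity quantifies over weak solutions about which nothing explicit is known: from below
  one explicit family of solutions has to suffice, from above mollification stands in for interior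
  regularity. Strictness lets a single touching point give a contradiction; the slack of a barrier
  or the term \<epsilon>/(-t) provides it. Every barrier has the form F(|x|^2, t), whose spatial
  Hessian is a multiple of the identity plus a rank-one form, so jets need no matrices. Why l = 2
  and n = 2 are the thresholds: at time t < 0 the domain leaves out a ball of radius
  (|t|/\<theta>)^(1/l), to be compared with the diffusion length |t|^(1/2). For l \<ge> 2 it is at
  least of comparable size near time 0. For l < 2 its relative radius is a positive power of |t|.
  Its relative capacity is then again a positive power if n \<ge> 3, summable over dyadic times, but
  of order 1/ln(1/|t|) if n = 2, whose sum diverges. Hence the planar barrier decays like a power of
  a logarithm.\<close>

abbreviation dderiv :: "('b::euclidean_space \<Rightarrow> real) \<Rightarrow> 'b \<Rightarrow> 'b \<Rightarrow> real" where
  "dderiv f v x \<equiv> frechet_derivative f (at x) v"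

lemma dderiv_eq: "(f has_derivative f') (at x) \<Longrightarrow> dderiv f v x = f' v"
  by (metis frechet_derivative_at)

lemma Ck_function_lower: "Ck_function (Suc k) f \<Longrightarrow> Ck_function k f"
proof (induction k arbitrary: f)
  case 0
  then show ?case
    by (auto intro!: continuous_at_imp_continuous_on differentiable_imp_continuous_within)
next
  case (Suc k)
  then show ?case by (metis Ck_function.simps(2))
qed

text \<open>Any formula for the derivative may replace \<open>frechet_derivative\<close>, so
  smoothness of a family closed under differentiation follows by one induction on k.\<close>

lemma Ck_function_SucI:
  assumes "\<And>x. (f has_derivative f' x) (at x)" and "\<And>v. Ck_function k (\<lambda>x. f' x v)"
  shows "Ck_function (Suc k) f"
proof -
  have "dderiv f v = (\<lambda>x. f' x v)" for v
    by (intro ext dderiv_eq assms)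
  with assms show ?thesis by (auto simp: differentiable_def)
qed

lemma Ck_function_has_derivative:
  "Ck_function (Suc k) f \<Longrightarrow> (f has_derivative frechet_derivative f (at x)) (at x)"
  by (simp add: frechet_derivative_works)

lemma Ck_function_dderiv: "Ck_function (Suc k) f \<Longrightarrow> Ck_function k (dderiv f v)"
  by simp

lemma Ck_function_const: "Ck_function k (\<lambda>x. c)"
proof (induction k arbitrary: c)
  case (Suc k)
  show ?case by (rule Ck_function_SucI[OF has_derivative_const Suc])
qed simp

lemma Ck_function_add:
  "Ck_function k f \<Longrightarrow> Ck_function k g \<Longrightarrow> Ck_function k (\<lambda>x. f x + g x)"
proof (induction k arbitrary: f g)
  case 0
  then show ?case by (auto intro: continuous_on_add)
next
  case (Suc k)
  note D = Suc.prems[THEN Ck_function_has_derivative]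
  show ?case
    by (rule Ck_function_SucI[OF has_derivative_add[OF D]])
      (intro Suc.IH Ck_function_dderiv Suc.prems)
qed

lemma Ck_function_mult:
  "Ck_function k f \<Longrightarrow> Ck_function k g \<Longrightarrow> Ck_function k (\<lambda>x. f x * g x)"
proof (induction k arbitrary: f g)
  case 0
  then show ?case by (auto intro: continuous_on_mult)
next
  case (Suc k)
  note D = Suc.prems[THEN Ck_function_has_derivative]
  show ?case
    by (rule Ck_function_SucI[OF has_derivative_mult[OF D]])
      (intro Ck_function_add Suc.IH Ck_function_dderiv Suc.prems Suc.prems[THEN Ck_function_lower])
qed

lemma Ck_function_inner: "Ck_function k (\<lambda>x. x \<bullet> b)"
proof (cases k)
  case (Suc m)
  have "((\<lambda>x. x \<bullet> b) has_derivative (\<lambda>v. v \<bullet> b)) (at x)" for x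
    by (auto intro!: derivative_eq_intros)
  from Ck_function_SucI[OF this Ck_function_const] Suc show ?thesis by blast
qed (auto intro!: continuous_intros)

lemma has_derivative_shift:
  assumes "Ck_function (Suc k) f"
  shows "((\<lambda>x. f (x - z)) has_derivative frechet_derivative f (at (x - z))) (at x)"
  using assms
  by (intro has_derivative_compose[of "\<lambda>x. x - z" "\<lambda>v. v" x UNIV f, simplified])
    (auto intro!: derivative_eq_intros simp: frechet_derivative_works)

lemmas dderiv_shift = dderiv_eq[OF has_derivative_shift]

lemma Ck_function_shift: "Ck_function k f \<Longrightarrow> Ck_function k (\<lambda>x. f (x - z))"
proof (induction k arbitrary: f)
  case 0
  then show ?case by (auto intro!: continuous_on_compose2[of UNIV f] continuous_intros)
next
  case (Suc k)
  show ?case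
    by (rule Ck_function_SucI[OF has_derivative_shift[OF Suc.prems]])
      (intro Suc.IH[of "dderiv f v" for v] Ck_function_dderiv Suc.prems)
qed

lemma has_derivative_slice:
  assumes "Ck_function (Suc k) f"
  shows "((\<lambda>x. f (x, t)) has_derivative (\<lambda>v. frechet_derivative f (at (x, t)) (v, 0))) (at x)"
  using assms
  by (intro has_derivative_compose[of "\<lambda>x. (x, t)" "\<lambda>v. (v, 0)" x UNIV f, simplified])
    (auto intro!: derivative_eq_intros simp: frechet_derivative_works)

lemmas dderiv_slice = dderiv_eq[OF has_derivative_slice]

lemma Ck_function_slice: "Ck_function k f \<Longrightarrow> Ck_function k (\<lambda>x. f (x, t))"
proof (induction k arbitrary: f)
  case 0
  then show ?case by (auto intro!: continuous_on_compose2[of UNIV f] continuous_intros)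
next
  case (Suc k)
  show ?case
    by (rule Ck_function_SucI[OF has_derivative_slice[OF Suc.prems]])
      (intro Suc.IH[of "dderiv f (v, 0)" for v] Ck_function_dderiv Suc.prems)
qed

section \<open>A smooth bump built from exp(-1/x)\<close>

definition flat :: "real poly \<Rightarrow> real \<Rightarrow> real" where
  "flat P x = (if x > 0 then poly P (1 / x) * exp (- (1 / x)) else 0)"

lemma poly_exp_tendsto_0: "((\<lambda>y. poly P y * exp (- y)) \<longlongrightarrow> (0::real)) at_top"
proof -
  have "((\<lambda>y. \<Sum>i\<le>degree P. coeff P i * (y ^ i / exp y)) \<longlongrightarrow> (\<Sum>i\<le>degree P. coeff P i * (0::real))) at_top"
    by (intro tendsto_intros tendsto_power_div_exp_0)
  then show ?thesis
    by (simp add: poly_altdef sum_distrib_right exp_minus divide_inverse mult.assoc)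
qed

lemma flat_tendsto_0: "((\<lambda>x. flat P x) \<longlongrightarrow> 0) (at 0)"
proof -
  have "((\<lambda>x. poly P (1 / x) * exp (- (1 / x))) \<longlongrightarrow> 0) (at_right (0::real))"
    using filterlim_compose[OF poly_exp_tendsto_0 filterlim_inverse_at_top_right]
    by (simp add: inverse_eq_divide)
  then have "((\<lambda>x. flat P x) \<longlongrightarrow> 0) (at_right 0)"
    by (rule Lim_transform_eventually) (auto simp: eventually_at_filter flat_def)
  moreover have "((\<lambda>x. flat P x) \<longlongrightarrow> 0) (at_left 0)"
    by (rule Lim_transform_eventually[OF tendsto_const]) (auto simp: eventually_at_filter flat_def)
  ultimately show ?thesis by (intro filterlim_split_at)
qed

text \<open>In y = 1/x the operator d/dx is -y^2 d/dy, which sends P(y) exp(-y) to y^2 (P - P')(y)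
  exp(-y). The family \<open>flat P\<close> is thus closed under differentiation, which is the
  reason for carrying a polynomial along.\<close>

lemma flat_has_derivative:
  "(flat P has_field_derivative flat ([:0, 0, 1:] * (P - pderiv P)) x) (at x)"
proof (cases x "0::real" rule: linorder_cases)
  case less
  have "((\<lambda>_. 0::real) has_field_derivative 0) (at x)" by simp
  then have "(flat P has_field_derivative 0) (at x)"
    by (rule has_field_derivative_transform_within_open[where S="{..<0}"])
      (use less in \<open>auto simp: flat_def\<close>)
  with less show ?thesis by (simp add: flat_def)
next
  case greater
  have inv: "((\<lambda>x. 1 / x) has_field_derivative - (1 / x\<^sup>2)) (at x)"
    using greater by (auto intro!: derivative_eq_intros simp: power2_eq_square)
  have "((\<lambda>x. poly P (1 / x) * exp (- (1 / x))) has_field_derivative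
     flat ([:0, 0, 1:] * (P - pderiv P)) x) (at x)"
    by (rule DERIV_cong[OF DERIV_mult[OF DERIV_chain2[OF poly_DERIV inv]
          DERIV_chain2[OF DERIV_exp DERIV_minus[OF inv]]]])
      (use greater in \<open>simp add: flat_def algebra_simps power2_eq_square\<close>)
  then show ?thesis
    by (rule has_field_derivative_transform_within_open[where S="{0<..}"])
      (use greater in \<open>auto simp: flat_def\<close>)
next
  case equal
  \<comment> \<open>Division by h > 0 only multiplies the polynomial by its variable, so the
    difference quotient is again flat and tends to 0; for h \<le> 0 both sides vanish.\<close>
  have "(\<lambda>h. (flat P (0 + h) - flat P 0) / h) = flat ([:0, 1:] * P)"
    by (auto simp: flat_def fun_eq_iff)
  then have "(flat P has_field_derivative 0) (at 0)"
    using flat_tendsto_0[of "[:0, 1:] * P"] by (simp only: DERIV_def)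
  with equal show ?thesis by (simp add: flat_def)
qed

lemma Ck_function_flat: "Ck_function k (\<lambda>x::'b::euclidean_space. flat P (e - x \<bullet> x))"
proof (induction k arbitrary: P)
  case 0
  have "continuous_on UNIV (flat P)"
    using flat_has_derivative by (meson DERIV_isCont continuous_at_imp_continuous_on)
  then show ?case
    by (auto intro!: continuous_on_compose2[of UNIV "flat P"] continuous_intros)
next
  case (Suc k)
  have *: "((\<lambda>x. flat P (e - x \<bullet> x)) has_derivative
      (\<lambda>v. flat ([:0, 0, 1:] * (P - pderiv P)) (e - x \<bullet> x) * (- 2 * (x \<bullet> v)))) (at x)" for x :: 'b
  proof -
    have "((\<lambda>x. e - x \<bullet> x) has_derivative (\<lambda>v. - 2 * (x \<bullet> v))) (at x)"
      by (rule derivative_eq_intros refl)+ (simp add: inner_commute)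
    from has_derivative_compose[OF this flat_has_derivative[unfolded has_field_derivative_def]]
    show ?thesis .
  qed
  have "Ck_function k (\<lambda>x. flat ([:0, 0, 1:] * (P - pderiv P)) (e - x \<bullet> x) * (- 2 * (x \<bullet> v)))" for v :: 'b
    by (intro Ck_function_mult Suc.IH Ck_function_const Ck_function_inner)
  with * show ?case by (rule Ck_function_SucI)
qed

text \<open>A function of x \<bullet> x instead of the norm, hence smooth at 0 too. It is left
  unnormalised; the mass is divided out where needed.\<close>

definition bump :: "real \<Rightarrow> 'b::euclidean_space \<Rightarrow> real" where
  "bump e x = flat 1 (e\<^sup>2 - x \<bullet> x)"

lemma Ck_function_bump: "Ck_function k (bump e)"
  unfolding bump_def[abs_def] by (rule Ck_function_flat)

lemma bump_nonneg: "bump e x \<ge> 0"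
  by (simp add: bump_def flat_def)

lemma bump_pos_iff: "e > 0 \<Longrightarrow> bump e x > 0 \<longleftrightarrow> norm x < e"
  using power_mono_iff[of e "norm x" 2] by (auto simp: bump_def flat_def dot_square_norm simp flip: not_le)

lemma bump_eq_0_iff: "e > 0 \<Longrightarrow> bump e x = 0 \<longleftrightarrow> norm x \<ge> e"
  using bump_pos_iff[of e x] bump_nonneg[of e x] by linarith

section \<open>Integration by parts; caloric quadratic polynomials\<close>

lemma dderiv_eq_0_outside:
  assumes "x \<notin> closure {x. f x \<noteq> 0}"
  shows "dderiv f v x = 0"
proof -
  have "((\<lambda>x. 0) has_derivative (\<lambda>v. 0)) (at x)" by simp
  then have "(f has_derivative (\<lambda>v. 0)) (at x)"
    by (rule has_derivative_transform_within_open[where s = "- closure {x. f x \<noteq> 0}"])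
      (use assms closure_subset[of "{x. f x \<noteq> 0}"] in auto)
  then show ?thesis by (simp add: dderiv_eq)
qed

lemma continuous_supported:
  fixes f :: "'b::euclidean_space \<Rightarrow> real"
  assumes "continuous_on UNIV f" and "{x. f x \<noteq> 0} \<subseteq> cbox a b"
  shows "integrable lborel f" and "(\<integral>x. f x \<partial>lborel) = integral (cbox a b) f"
proof -
  have *: "(\<lambda>x. indicator (cbox a b) x * f x) = f"
    using assms(2) by (auto simp: indicator_def fun_eq_iff)
  have "set_integrable lborel (cbox a b) f"
    unfolding set_integrable_def
    by (rule borel_integrable_compact) (auto intro: continuous_on_subset[OF assms(1)])
  from this set_borel_integral_eq_integral(2)[OF this]
  show "integrable lborel f" and "(\<integral>x. f x \<partial>lborel) = integral (cbox a b) f"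
    by (simp_all add: set_integrable_def set_lebesgue_integral_def *)
qed

lemma bounded_subset_cboxE:
  fixes S :: "'b::euclidean_space set"
  assumes "bounded S"
  obtains a b where "S \<subseteq> cbox a b"
  using bounded_subset_cbox_symmetric[OF assms] by blast

lemma lborel_integral_shift:
  fixes f :: "'b::euclidean_space \<Rightarrow> real"
  assumes "f \<in> borel_measurable borel"
  shows "(\<integral>x. f (x + c) \<partial>lborel) = (\<integral>x. f x \<partial>lborel)"
proof -
  have "(\<integral>x. f x \<partial>lborel) = (\<integral>x. f x \<partial>distr lborel borel ((+) c))"
    by (simp add: lborel_distr_plus)
  also have "\<dots> = (\<integral>x. f (c + x) \<partial>lborel)"
    using assms by (intro integral_distr) auto
  finally show ?thesis by (simp add: add.commute)
qed

text \<open>Translation invariance: the integral of f(x + r v) does not depend on r, and its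
  derivative at r = 0 is the integral in question.\<close>

lemma integral_dderiv_eq_0:
  fixes f :: "'b::euclidean_space \<Rightarrow> real"
  assumes f: "Ck_function 1 f" and "bounded {x. f x \<noteq> 0}"
  shows "(\<integral>x. dderiv f v x \<partial>lborel) = 0"
proof -
  have D: "(f has_derivative frechet_derivative f (at x)) (at x)" for x
    using f by (simp add: frechet_derivative_works)
  have cD: "continuous_on UNIV (dderiv f v)" and cf: "continuous_on UNIV f"
    using f Ck_function_lower[of 0 f] by auto
  obtain R where R: "\<And>x. f x \<noteq> 0 \<Longrightarrow> norm x \<le> R"
    using assms(2) by (auto simp: bounded_iff)
  \<comment> \<open>One box holds the supports of all translates with |r| \<le> 1, so the domain of
    integration stays fixed and the Leibniz rule applies.\<close>
  obtain a b where ab: "cball (0::'b) (R + norm v) \<subseteq> cbox a b"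
    using bounded_subset_cboxE[OF bounded_cball] by blast
  have supp: "{x. f (x + r *\<^sub>R v) \<noteq> 0} \<subseteq> cbox a b" if "\<bar>r\<bar> \<le> 1" for r
  proof -
    have "norm x \<le> R + norm v" if "f (x + r *\<^sub>R v) \<noteq> 0" for x
    proof -
      have "norm x \<le> norm (x + r *\<^sub>R v) + norm (r *\<^sub>R v)"
        using norm_triangle_ineq4[of "x + r *\<^sub>R v" "r *\<^sub>R v"] by simp
      also have "norm (r *\<^sub>R v) \<le> norm v"
        using \<open>\<bar>r\<bar> \<le> 1\<close> by (simp add: mult_left_le_one_le)
      finally show ?thesis using R[OF that] by simp
    qed
    then show ?thesis using ab by auto
  qed
  define g where "g r = integral (cbox a b) (\<lambda>x. f (x + r *\<^sub>R v))" for r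
  have cont: "continuous_on S (\<lambda>x. f (x + r *\<^sub>R v))" for r S
    by (intro continuous_on_compose2[OF cf] continuous_intros) auto
  have gconst: "g r = (\<integral>x. f x \<partial>lborel)" if "\<bar>r\<bar> \<le> 1" for r
    using continuous_supported(2)[OF cont supp[OF that]]
      lborel_integral_shift[OF borel_measurable_continuous_onI[OF cf]] by (simp add: g_def)
  have const: "g r = g 0" if "r \<in> {-1<..<1}" for r
    using that gconst[of r] gconst[of 0] by (simp add: abs_le_iff)
  have "(g has_field_derivative integral (cbox a b) (\<lambda>x. dderiv f v (x + 0 *\<^sub>R v))) (at 0 within UNIV)"
    unfolding g_def
  proof (rule leibniz_rule_field_derivative)
    fix r x
    have "((\<lambda>r. f (x + r *\<^sub>R v)) has_derivative
       (\<lambda>s. frechet_derivative f (at (x + r *\<^sub>R v)) (s *\<^sub>R v))) (at r within UNIV)"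
      by (rule has_derivative_compose[OF _ D]) (auto intro!: derivative_eq_intros)
    moreover have "frechet_derivative f (at (x + r *\<^sub>R v)) (s *\<^sub>R v) = dderiv f v (x + r *\<^sub>R v) * s" for s
      using linear_scale[OF has_derivative_linear[OF D]] by (simp add: mult.commute)
    ultimately show "((\<lambda>r. f (x + r *\<^sub>R v)) has_field_derivative dderiv f v (x + r *\<^sub>R v)) (at r within UNIV)"
      by (simp add: has_field_derivative_def)
  next
    show "continuous_on (UNIV \<times> cbox a b) (\<lambda>(r, x). dderiv f v (x + r *\<^sub>R v))"
      unfolding split_beta
      by (intro continuous_on_compose2[OF cD] continuous_intros) auto
  qed (auto intro!: integrable_continuous cont)
  then have "(g has_field_derivative integral (cbox a b) (dderiv f v)) (at 0)" by simp
  moreover have "(g has_field_derivative 0) (at 0)"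
    by (rule has_field_derivative_transform_within_open[where f = "\<lambda>_. g 0" and S = "{-1<..<1}"])
      (auto intro: const[symmetric])
  ultimately have "integral (cbox a b) (dderiv f v) = 0" by (rule DERIV_unique)
  moreover have "{x. dderiv f v x \<noteq> 0} \<subseteq> cbox a b"
  proof -
    have "closure {x. f x \<noteq> 0} \<subseteq> cbox a b"
      using supp[of 0] by (intro closure_minimal) auto
    then show ?thesis using dderiv_eq_0_outside[of _ f v] by blast
  qed
  ultimately show ?thesis using continuous_supported(2)[OF cD] by simp
qed

lemma test_function_Ck: "test_function U \<phi> \<Longrightarrow> Ck_function k \<phi>"
  by (simp add: test_function_def)

lemma test_function_bounded: "test_function U \<phi> \<Longrightarrow> bounded {x. \<phi> x \<noteq> 0}"
  unfolding test_function_def compactly_inside_def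
  using bounded_subset[OF compact_imp_bounded closure_subset] by blast

lemma test_function_dderiv:
  assumes "test_function U \<phi>" shows "test_function U (dderiv \<phi> v)"
proof -
  have "{x. dderiv \<phi> v x \<noteq> 0} \<subseteq> closure {x. \<phi> x \<noteq> 0}"
    using dderiv_eq_0_outside[of _ \<phi> v] by blast
  then have "closure {x. dderiv \<phi> v x \<noteq> 0} \<subseteq> closure {x. \<phi> x \<noteq> 0}"
    by (rule closure_minimal) simp
  moreover have "Ck_function k (dderiv \<phi> v)" for k
    using test_function_Ck[OF assms, of "Suc k"] by simp
  ultimately show ?thesis
    using assms compact_Int_closed[of "closure {x. \<phi> x \<noteq> 0}" "closure {x. dderiv \<phi> v x \<noteq> 0}"]
    by (auto simp: test_function_def compactly_inside_def Int_absorb1)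
qed

lemma test_function_zero: "test_function U \<phi> \<Longrightarrow> x \<notin> U \<Longrightarrow> \<phi> x = 0"
  unfolding test_function_def compactly_inside_def
  using subsetD[OF closure_subset, of x "{x. \<phi> x \<noteq> 0}"] by auto

lemma integral_lebesgue_on_eq_lborel:
  fixes f :: "'b::euclidean_space \<Rightarrow> real"
  assumes "S \<in> sets lebesgue" "f \<in> borel_measurable borel" "\<And>x. x \<notin> S \<Longrightarrow> f x = 0"
  shows "(\<integral>x. f x \<partial>lebesgue_on S) = (\<integral>x. f x \<partial>lborel)"
proof -
  have "(\<lambda>x. indicator S x *\<^sub>R f x) = f"
    using assms(3) by (auto simp: indicator_def fun_eq_iff)
  then have "(\<integral>x. f x \<partial>lebesgue_on S) = (\<integral>x. f x \<partial>lebesgue)"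
    using assms(1) by (simp add: integral_restrict_space)
  with assms(2) show ?thesis by (simp add: integral_completion)
qed

text \<open>This is \<open>integral_dderiv_eq_0\<close> for the product of f and \<phi>, which has
  bounded support although f is arbitrary. No boundary term arises, so S needs no regular
  boundary.\<close>

lemma integration_by_parts:
  fixes f :: "'b::euclidean_space \<Rightarrow> real"
  assumes f: "Ck_function 1 f" and \<phi>: "test_function S \<phi>" and S: "S \<in> sets lebesgue"
  shows "(\<integral>x. f x * dderiv \<phi> v x \<partial>lebesgue_on S) = - (\<integral>x. dderiv f v x * \<phi> x \<partial>lebesgue_on S)"
proof -
  note C = test_function_Ck[OF \<phi>]
  have 1: "bounded {x. f x * dderiv \<phi> v x \<noteq> 0}" "bounded {x. dderiv f v x * \<phi> x \<noteq> 0}"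
    and 2: "bounded {x. f x * \<phi> x \<noteq> 0}"
    using test_function_bounded[OF \<phi>] test_function_bounded[OF test_function_dderiv[OF \<phi>, of v]]
    by (auto elim: bounded_subset)
  have cont: "continuous_on UNIV f" "continuous_on UNIV \<phi>"
    "continuous_on UNIV (dderiv f v)" "continuous_on UNIV (dderiv \<phi> v)"
    using f C[of 0] C[of 1] Ck_function_lower[of 0 f] by auto
  obtain a b where "{x. f x * dderiv \<phi> v x \<noteq> 0} \<subseteq> cbox a b"
    using bounded_subset_cboxE[OF 1(1)] .
  note i1 = continuous_supported(1)[OF continuous_on_mult[OF cont(1,4)] this]
  obtain a b where "{x. dderiv f v x * \<phi> x \<noteq> 0} \<subseteq> cbox a b"
    using bounded_subset_cboxE[OF 1(2)] .
  note i2 = continuous_supported(1)[OF continuous_on_mult[OF cont(3,2)] this]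
  have "dderiv (\<lambda>x. f x * \<phi> x) v = (\<lambda>x. f x * dderiv \<phi> v x + dderiv f v x * \<phi> x)"
    using f C[of 1]
    by (intro ext dderiv_eq has_derivative_mult) (auto simp: frechet_derivative_works)
  then have "(\<integral>x. f x * dderiv \<phi> v x + dderiv f v x * \<phi> x \<partial>lborel) = 0"
    using integral_dderiv_eq_0[OF Ck_function_mult[OF f C[of 1]] 2, of v] by simp
  then have "(\<integral>x. f x * dderiv \<phi> v x \<partial>lborel) = - (\<integral>x. dderiv f v x * \<phi> x \<partial>lborel)"
    using i1 i2 by simp
  moreover have "f x * dderiv \<phi> v x = 0" "dderiv f v x * \<phi> x = 0" if "x \<notin> S" for x
    using test_function_zero[OF \<phi> that] test_function_zero[OF test_function_dderiv[OF \<phi>] that] by auto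
  ultimately show ?thesis
    using integral_lebesgue_on_eq_lborel[OF S
        borel_measurable_continuous_onI[OF continuous_on_mult[OF cont(1,4)]]]
      integral_lebesgue_on_eq_lborel[OF S
        borel_measurable_continuous_onI[OF continuous_on_mult[OF cont(3,2)]]] by simp
qed

lemma in_Lp_continuous:
  fixes f :: "'b::euclidean_space \<Rightarrow> 'c::euclidean_space"
  assumes "S \<in> sets borel" "bounded S" "continuous_on UNIV f"
  shows "in_Lp 2 S f"
proof -
  have S: "S \<in> lmeasurable" using assms by (simp add: bounded_set_imp_lmeasurable)
  have f: "f \<in> borel_measurable (lebesgue_on S)"
    using borel_measurable_continuous_onI[OF assms(3)]
    by (intro measurable_restrict_space1 measurable_completion) simp
  obtain B where B: "\<And>x. x \<in> closure S \<Longrightarrow> norm (f x) \<le> B"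
    using compact_imp_bounded[OF compact_continuous_image[OF continuous_on_subset[OF assms(3)]
      compact_closure[THEN iffD2, OF assms(2)]]] by (auto simp: bounded_iff)
  interpret finite_measure "lebesgue_on S" by (rule finite_measure_lebesgue_on[OF S])
  have "integrable (lebesgue_on S) (\<lambda>x. norm (f x) powr 2)"
  proof (rule integrable_const_bound[where B = "B\<^sup>2"])
    show "AE x in lebesgue_on S. norm (norm (f x) powr 2) \<le> B\<^sup>2"
      using B closure_subset[of S] by (intro AE_I2) (auto intro!: power_mono)
    have "(\<lambda>x. norm (f x) powr 2) = (\<lambda>x. (norm (f x))\<^sup>2)" by simp
    then show "(\<lambda>x. norm (f x) powr 2) \<in> borel_measurable (lebesgue_on S)"
      using borel_measurable_power[OF measurable_compose[OF f borel_measurable_norm], of 2] by simp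
  qed
  with f show ?thesis by (simp add: in_Lp_def)
qed

section \<open>Caloric quadratic polynomials as weak solutions\<close>

definition quad :: "'a::euclidean_space \<times> real \<Rightarrow> real \<Rightarrow> 'a \<Rightarrow> real \<Rightarrow> real \<Rightarrow> 'a \<Rightarrow> real \<Rightarrow> 'a \<times> real \<Rightarrow> real" where
  "quad z0 m a c d e b z = m + a \<bullet> (fst z - fst z0) + c * (norm (fst z - fst z0))\<^sup>2
     + d * (e \<bullet> (fst z - fst z0))\<^sup>2 + b * (snd z - snd z0)"

definition quad_grad :: "'a::euclidean_space \<Rightarrow> 'a \<Rightarrow> real \<Rightarrow> real \<Rightarrow> 'a \<Rightarrow> 'a \<Rightarrow> 'a" where
  "quad_grad x0 a c d e x = a + (2 * c) *\<^sub>R (x - x0) + (2 * d * (e \<bullet> (x - x0))) *\<^sub>R e"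

lemma quad_has_derivative:
  "(quad z0 m a c d e b has_derivative
     (\<lambda>v. quad_grad (fst z0) a c d e (fst z) \<bullet> fst v + b * snd v)) (at z)"
  unfolding quad_def[abs_def] quad_grad_def power2_norm_eq_inner
  apply (rule derivative_eq_intros refl)+
  apply (simp add: fun_eq_iff inner_add_left inner_add_right)
  apply (simp add: algebra_simps)
  apply (simp add: inner_commute)
  done
lemma quad_grad_has_derivative:
  "((\<lambda>z. quad_grad x0 a c d e (fst z) \<bullet> w) has_derivative
     (\<lambda>v. 2 * c * (fst v \<bullet> w) + 2 * d * (e \<bullet> fst v) * (e \<bullet> w))) (at z)"
  unfolding quad_grad_def
  apply (rule derivative_eq_intros refl)+ 
  apply (simp add: fun_eq_iff inner_add_left inner_add_right)
  done

lemma quad_Ck: "Ck_function 1 (quad z0 m a c d e b)"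
  unfolding One_nat_def
  by (rule Ck_function_SucI[OF quad_has_derivative])
    (auto simp: quad_grad_def intro!: continuous_intros)

lemma quad_grad_Ck: "Ck_function 1 (\<lambda>z. quad_grad x0 a c d e (fst z) \<bullet> w)"
  unfolding One_nat_def
  by (rule Ck_function_SucI[OF quad_grad_has_derivative]) (auto intro!: continuous_intros)

lemma inner_space_gradient: "w \<bullet> space_gradient \<phi> z = (\<Sum>b\<in>Basis. (w \<bullet> b) * dderiv \<phi> (b, 0) z)"
  by (simp add: space_gradient_def inner_sum_right mult.commute)

lemma sum_Basis_inner_square: "(\<Sum>b\<in>Basis. (e \<bullet> b) * (e \<bullet> b)) = (e::'a::euclidean_space) \<bullet> e"
  by (rule euclidean_inner[symmetric])

lemma continuous_on_quad: "continuous_on S (quad z0 m a c d e b)"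
  unfolding quad_def[abs_def] by (intro continuous_intros)

lemma continuous_on_quad_grad: "continuous_on S (quad_grad x0 a c d e)"
  unfolding quad_grad_def[abs_def] by (intro continuous_intros)

lemma integrable_continuous_test:
  assumes "continuous_on UNIV f" "test_function S \<phi>" "S \<in> sets lebesgue"
  shows "integrable (lebesgue_on S) (\<lambda>x. f x * \<phi> x)"
proof -
  have c: "continuous_on UNIV (\<lambda>x. f x * \<phi> x)"
    using assms(1) test_function_Ck[OF assms(2), of 0] by (auto intro: continuous_on_mult)
  have "bounded {x. f x * \<phi> x \<noteq> 0}"
    using test_function_bounded[OF assms(2)] by (auto elim: bounded_subset)
  then obtain a b where "{x. f x * \<phi> x \<noteq> 0} \<subseteq> cbox a b"
    by (rule bounded_subset_cboxE)
  from continuous_supported(1)[OF c this]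
  have "integrable lebesgue (\<lambda>x. f x * \<phi> x)" by (simp add: integrable_completion c borel_measurable_continuous_onI)
  moreover have "(\<lambda>x. indicator S x *\<^sub>R (f x * \<phi> x)) = (\<lambda>x. f x * \<phi> x)"
    using test_function_zero[OF assms(2)] by (auto simp: indicator_def fun_eq_iff)
  ultimately show ?thesis using assms(3) by (simp add: integrable_restrict_space)
qed

text \<open>Both sides equal -b times the integral of \<phi>: on the left one integrates by parts
  and the Laplacian of \<open>quad\<close> is the constant b, on the right its time derivative is
  b.\<close>

lemma quad_weak_equation:
  fixes S :: "('a::euclidean_space \<times> real) set"
  assumes S: "S \<in> sets lebesgue" and \<phi>: "test_function S \<phi>"
    and b: "b = 2 * c * real DIM('a) + 2 * d * (e \<bullet> e)"
  shows "(\<integral>z. quad_grad (fst z0) a c d e (fst z) \<bullet> space_gradient \<phi> z \<partial>lebesgue_on S)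
       = (\<integral>z. quad z0 m a c d e b z * time_derivative \<phi> z \<partial>lebesgue_on S)"
proof -
  let ?G = "\<lambda>z. quad_grad (fst z0) a c d e (fst z)"
  have cG: "continuous_on UNIV (\<lambda>z. ?G z \<bullet> w)" for w
    by (intro continuous_intros continuous_on_compose2[OF continuous_on_quad_grad]) auto
  have d2: "dderiv (\<lambda>z. ?G z \<bullet> i) (i, 0) z = 2 * c + 2 * d * ((e \<bullet> i) * (e \<bullet> i))"
    if "i \<in> Basis" for i :: 'a and z
    using that by (simp add: dderiv_eq[OF quad_grad_has_derivative])
  have "(\<integral>z. ?G z \<bullet> space_gradient \<phi> z \<partial>lebesgue_on S)
      = (\<Sum>i\<in>Basis. \<integral>z. (?G z \<bullet> i) * dderiv \<phi> (i, 0) z \<partial>lebesgue_on S)"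
    unfolding inner_space_gradient
    by (intro Bochner_Integration.integral_sum integrable_continuous_test cG test_function_dderiv \<phi> S)
  also have "\<dots> = (\<Sum>i\<in>Basis. - ((2 * c + 2 * d * ((e \<bullet> i) * (e \<bullet> i))) * (\<integral>z. \<phi> z \<partial>lebesgue_on S)))"
    by (intro sum.cong refl) (simp add: integration_by_parts[OF quad_grad_Ck \<phi> S] d2)
  also have "\<dots> = - (b * (\<integral>z. \<phi> z \<partial>lebesgue_on S))"
    by (simp add: b sum_negf sum.distrib sum_Basis_inner_square
        flip: sum_distrib_left sum_distrib_right)
  also have "\<dots> = (\<integral>z. quad z0 m a c d e b z * dderiv \<phi> (0, 1) z \<partial>lebesgue_on S)"
    by (simp add: integration_by_parts[OF quad_Ck \<phi> S] dderiv_eq[OF quad_has_derivative])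
  finally show ?thesis by (simp add: time_derivative_def)
qed

text \<open>For p = 2 the flux is the gradient itself. At x = 0 the factor is
  \<open>0 powr 0 = 0\<close> instead of 1, but it multiplies the zero vector.\<close>

lemma powr_0_scaleR: "(norm x powr (2 - 2)) *\<^sub>R x = (x :: 'a::real_normed_vector)"
  by auto

lemma quad_weak_gradient:
  fixes U :: "'a::euclidean_space set"
  assumes "U \<in> sets lebesgue"
  shows "weak_gradient_on U (\<lambda>x. quad z0 m a c d e b (x, s)) (quad_grad (fst z0) a c d e)"
  unfolding weak_gradient_on_def
proof (intro allI impI ballI)
  fix \<phi> and i :: 'a
  assume \<phi>: "test_function U \<phi>"
  let ?f = "\<lambda>x. quad z0 m a c d e b (x, s)"
  have Ck: "Ck_function 1 ?f" using Ck_function_slice[OF quad_Ck] .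
  have "dderiv ?f i x = quad_grad (fst z0) a c d e x \<bullet> i" for x
    using dderiv_slice[OF quad_Ck[unfolded One_nat_def]] by (simp add: dderiv_eq[OF quad_has_derivative])
  with integration_by_parts[OF Ck \<phi> assms, of i]
  show "(\<integral>x. ?f x * dderiv \<phi> i x \<partial>lebesgue_on U) = - (\<integral>x. (quad_grad (fst z0) a c d e x \<bullet> i) * \<phi> x \<partial>lebesgue_on U)"
    by simp
qed

lemma bounded_Times_left:
  assumes "bounded (A \<times> B)" "B \<noteq> {}" shows "bounded A"
  using bounded_fst[OF assms(1)] assms(2) by simp

text \<open>Two time slices of \<open>quad\<close> differ by the constant b(r - s), so the L^2 norm
  of the difference is |b(r - s)| times the root of the measure of U.\<close>

lemma quad_in_C_L2:
  fixes U :: "'a::euclidean_space set"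
  assumes "open U" "bounded U"
  shows "in_C_L2 U t1 t2 (quad z0 m a c d e b)"
  unfolding in_C_L2_def
proof (intro conjI ballI)
  fix s
  show "in_Lp 2 U (\<lambda>x. quad z0 m a c d e b (x, s))"
    using assms by (intro in_Lp_continuous continuous_on_compose2[OF continuous_on_quad, of UNIV] continuous_intros) auto
  define M where "M = measure (lebesgue_on U) (space (lebesgue_on U)) powr (1 / 2)"
  have "Lp_norm 2 U (\<lambda>x. quad z0 m a c d e b (x, r) - quad z0 m a c d e b (x, s)) = \<bar>b * (r - s)\<bar> * M" for r
  proof -
    have "quad z0 m a c d e b (x, r) - quad z0 m a c d e b (x, s) = b * (r - s)" for x
      by (simp add: quad_def algebra_simps)
    then have "Lp_norm 2 U (\<lambda>x. quad z0 m a c d e b (x, r) - quad z0 m a c d e b (x, s))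
       = (\<bar>b * (r - s)\<bar> powr 2 * measure (lebesgue_on U) (space (lebesgue_on U))) powr (1 / 2)"
      by (simp add: Lp_norm_def mult.commute)
    also have "\<dots> = \<bar>b * (r - s)\<bar> * M"
      by (subst powr_mult) (simp_all add: M_def powr_powr)
    finally show ?thesis .
  qed
  moreover have "((\<lambda>r. \<bar>b * (r - s)\<bar> * M) \<longlongrightarrow> \<bar>b * (s - s)\<bar> * M) (at s within {t1..t2})"
    by (intro tendsto_intros)
  ultimately show "((\<lambda>r. Lp_norm 2 U (\<lambda>x. quad z0 m a c d e b (x, r) - quad z0 m a c d e b (x, s))) \<longlongrightarrow> 0) (at s within {t1..t2})"
    by simp
qed

text \<open>These are the only explicit solutions needed. The same polynomials serve as second-order
  jets, so a jet with the right time slope is itself a competitor in the definition of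
  superparabolicity.\<close>

lemma quad_p_parabolic:
  fixes \<Omega> :: "('a::euclidean_space \<times> real) set"
  assumes b: "b = 2 * c * real DIM('a) + 2 * d * (e \<bullet> e)"
  shows "p_parabolic 2 \<Omega> (quad z0 m a c d e b)"
  unfolding p_parabolic_def weak_solution_def
proof (intro conjI allI impI continuous_on_quad, elim conjE)
  fix U :: "'a set" and t1 t2 :: real
  assume U: "open U" and t: "t1 < t2" and "compactly_inside (U \<times> {t1<..<t2}) \<Omega>"
  then have bdd: "bounded (U \<times> {t1<..<t2})"
    unfolding compactly_inside_def using bounded_subset[OF compact_imp_bounded closure_subset] by blast
  then have bU: "bounded U" using t by (auto dest: bounded_Times_left)
  have oS: "open (U \<times> {t1<..<t2})" using U by (intro open_Times) auto
  let ?G = "\<lambda>z. quad_grad (fst z0) a c d e (fst z)"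
  have cG: "continuous_on UNIV ?G"
    by (intro continuous_on_compose2[OF continuous_on_quad_grad, of UNIV] continuous_intros) auto
  show "\<exists>v G. (AE z in lebesgue_on (U \<times> {t1<..<t2}). ereal (quad z0 m a c d e b z) = ereal (v z)) \<and>
          in_C_L2 U t1 t2 v \<and> in_Lp_W1p 2 U t1 t2 v G \<and>
          (\<forall>\<phi>. test_function (U \<times> {t1<..<t2}) \<phi> \<longrightarrow>
             (\<integral>z. (norm (G z) powr (2 - 2)) *\<^sub>R G z \<bullet> space_gradient \<phi> z
                 \<partial>lebesgue_on (U \<times> {t1<..<t2}))
             - (\<integral>z. v z * time_derivative \<phi> z \<partial>lebesgue_on (U \<times> {t1<..<t2})) = 0)"
  proof (intro exI[of _ "quad z0 m a c d e b"] exI[of _ ?G] conjI allI impI)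
    show "in_C_L2 U t1 t2 (quad z0 m a c d e b)" using quad_in_C_L2 U bU .
    have "in_W1p 2 U (\<lambda>x. quad z0 m a c d e b (x, t)) (quad_grad (fst z0) a c d e)" for t
      using quad_in_C_L2[OF U bU, of t t] U bU
      by (auto simp: in_W1p_def in_C_L2_def intro!: quad_weak_gradient in_Lp_continuous continuous_on_quad_grad)
    then show "in_Lp_W1p 2 U t1 t2 (quad z0 m a c d e b) ?G"
      using oS bdd cG by (auto simp: in_Lp_W1p_def intro!: in_Lp_continuous continuous_on_quad)
  next
    fix \<phi> assume "test_function (U \<times> {t1<..<t2}) \<phi>"
    from quad_weak_equation[OF _ this b, of z0 a m] oS
    show "(\<integral>z. (norm (?G z) powr (2 - 2)) *\<^sub>R ?G z \<bullet> space_gradient \<phi> z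
                 \<partial>lebesgue_on (U \<times> {t1<..<t2}))
             - (\<integral>z. quad z0 m a c d e b z * time_derivative \<phi> z \<partial>lebesgue_on (U \<times> {t1<..<t2})) = 0"
      unfolding powr_0_scaleR by simp
  qed simp
qed

section \<open>Second-order parabolic jets and comparison from below\<close>

text \<open>A quadratic part of the form \<open>c |y|\<^sup>2 + d (e \<bullet> y)\<^sup>2\<close> is all that is needed for radial functions; its
  Laplacian is \<open>2 n c + 2 d |e|\<^sup>2\<close>.\<close>

definition parabolic_jet ::
  "('a::euclidean_space \<times> real \<Rightarrow> real) \<Rightarrow> 'a \<times> real \<Rightarrow> 'a \<Rightarrow> real \<Rightarrow> real \<Rightarrow> 'a \<Rightarrow> real \<Rightarrow> bool" where
  "parabolic_jet w z0 a c d e b \<longleftrightarrow>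
     (\<forall>\<eta>>0. \<forall>\<^sub>F z in nhds z0. \<bar>w z - quad z0 (w z0) a c d e b z\<bar>
        \<le> \<eta> * ((norm (fst z - fst z0))\<^sup>2 + \<bar>snd z - snd z0\<bar>))"

definition strict_supersolution_at :: "('a::euclidean_space \<times> real \<Rightarrow> real) \<Rightarrow> 'a \<times> real \<Rightarrow> bool" where
  "strict_supersolution_at w z0 \<longleftrightarrow>
     (\<exists>a c d e b. parabolic_jet w z0 a c d e b \<and> b > 2 * c * real DIM('a) + 2 * d * (e \<bullet> e))"

lemma quad_affine:
  "quad z0 (k * m + r) (k *\<^sub>R a) (k * c) (k * d) e (k * b) z = k * quad z0 m a c d e b z + r"
  by (simp add: quad_def algebra_simps)

lemma parabolic_jet_affine:
  assumes "parabolic_jet w z0 a c d e b"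
  shows "parabolic_jet (\<lambda>z. k * w z + r) z0 (k *\<^sub>R a) (k * c) (k * d) e (k * b)"
  unfolding parabolic_jet_def
proof (intro allI impI)
  fix \<eta> :: real assume "\<eta> > 0"
  then have "\<eta> / (\<bar>k\<bar> + 1) > 0" by simp
  with assms have "\<forall>\<^sub>F z in nhds z0. \<bar>w z - quad z0 (w z0) a c d e b z\<bar>
      \<le> \<eta> / (\<bar>k\<bar> + 1) * ((norm (fst z - fst z0))\<^sup>2 + \<bar>snd z - snd z0\<bar>)"
    unfolding parabolic_jet_def by blast
  then show "\<forall>\<^sub>F z in nhds z0. \<bar>k * w z + r - quad z0 (k * w z0 + r) (k *\<^sub>R a) (k * c) (k * d) e (k * b) z\<bar>
      \<le> \<eta> * ((norm (fst z - fst z0))\<^sup>2 + \<bar>snd z - snd z0\<bar>)"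
  proof eventually_elim
    case (elim z)
    let ?S = "(norm (fst z - fst z0))\<^sup>2 + \<bar>snd z - snd z0\<bar>"
    have "\<bar>k\<bar> * \<bar>w z - quad z0 (w z0) a c d e b z\<bar> \<le> \<bar>k\<bar> * (\<eta> / (\<bar>k\<bar> + 1) * ?S)"
      using elim by (rule mult_left_mono) simp
    also have "\<dots> = (\<bar>k\<bar> / (\<bar>k\<bar> + 1)) * (\<eta> * ?S)" by simp
    also have "\<dots> \<le> 1 * (\<eta> * ?S)"
      using \<open>\<eta> > 0\<close> by (intro mult_right_mono) auto
    finally show ?case
      unfolding quad_affine by (simp add: abs_mult flip: right_diff_distrib)
  qed
qed

lemma strict_supersolution_at_affine:
  assumes "strict_supersolution_at w z0" "k > 0"
  shows "strict_supersolution_at (\<lambda>z. k * w z + r) z0"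
proof -
  obtain a c d e b where j: "parabolic_jet w z0 a c d e b" and b: "b > 2 * c * real DIM('a) + 2 * d * (e \<bullet> e)"
    using assms(1) by (auto simp: strict_supersolution_at_def)
  have "k * b > k * (2 * c * real DIM('a) + 2 * d * (e \<bullet> e))" using b assms(2) by simp
  with parabolic_jet_affine[OF j, of k r] show ?thesis
    unfolding strict_supersolution_at_def by (fastforce simp: algebra_simps)
qed

lemma strict_supersolution_at_cong:
  assumes "strict_supersolution_at w z0" and eq: "\<forall>\<^sub>F z in nhds z0. w z = w' z"
  shows "strict_supersolution_at w' z0"
proof -
  have "w z0 = w' z0" using eq by (rule eventually_nhds_x_imp_x)
  have "parabolic_jet w' z0 a c d e b" if j: "parabolic_jet w z0 a c d e b" for a c d e b
    unfolding parabolic_jet_def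
  proof (intro allI impI)
    fix \<eta> :: real assume "\<eta> > 0"
    with j have "\<forall>\<^sub>F z in nhds z0. \<bar>w z - quad z0 (w z0) a c d e b z\<bar>
        \<le> \<eta> * ((norm (fst z - fst z0))\<^sup>2 + \<bar>snd z - snd z0\<bar>)"
      by (simp add: parabolic_jet_def)
    with eq show "\<forall>\<^sub>F z in nhds z0. \<bar>w' z - quad z0 (w' z0) a c d e b z\<bar>
        \<le> \<eta> * ((norm (fst z - fst z0))\<^sup>2 + \<bar>snd z - snd z0\<bar>)"
      by eventually_elim (simp add: \<open>w z0 = w' z0\<close>)
  qed
  then show ?thesis using assms(1) unfolding strict_supersolution_at_def by blast
qed

lemma parabolic_jet_continuous:
  assumes "parabolic_jet w z0 a c d e b"
  shows "isCont w z0"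
proof -
  have q: "isCont (quad z0 (w z0) a c d e b) z0"
    by (rule continuous_on_interior[OF continuous_on_quad[of UNIV]]) simp
  have "((\<lambda>z. w z - quad z0 (w z0) a c d e b z) \<longlongrightarrow> 0) (at z0)"
  proof (rule Lim_null_comparison)
    have "\<forall>\<^sub>F z in nhds z0. norm (w z - quad z0 (w z0) a c d e b z)
        \<le> 1 * ((norm (fst z - fst z0))\<^sup>2 + \<bar>snd z - snd z0\<bar>)"
      using assms unfolding parabolic_jet_def real_norm_def by (elim allE[of _ 1]) simp
    then show "\<forall>\<^sub>F z in at z0. norm (w z - quad z0 (w z0) a c d e b z)
        \<le> 1 * ((norm (fst z - fst z0))\<^sup>2 + \<bar>snd z - snd z0\<bar>)"
      by (rule filter_leD[OF at_within_le_nhds])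
    have "isCont (\<lambda>z. 1 * ((norm (fst z - fst z0))\<^sup>2 + \<bar>snd z - snd z0\<bar>)) z0"
      by (intro continuous_intros)
    then show "((\<lambda>z. 1 * ((norm (fst z - fst z0))\<^sup>2 + \<bar>snd z - snd z0\<bar>)) \<longlongrightarrow> 0) (at z0)"
      by (simp add: isCont_def)
  qed
  from tendsto_add[OF this q[unfolded isCont_def]]
  have "(w \<longlongrightarrow> quad z0 (w z0) a c d e b z0) (at z0)" by simp
  then show ?thesis by (simp add: isCont_def quad_def)
qed

text \<open>The surplus g of the Laplacian over the time slope pays for three things: the change
  from the jet to a solution \<open>h\<close>, the error of the jet, and the lift by \<kappa> that
  puts \<open>h\<close> above u at z0.\<close>

lemma no_touching_from_below:
  fixes \<Omega> :: "('a::euclidean_space \<times> real) set"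
  assumes u: "p_superparabolic 2 \<Omega> u" and "open \<Omega>" "z0 \<in> \<Omega>"
    and jet: "parabolic_jet v z0 a c d e b" and b: "b < 2 * c * real DIM('a) + 2 * d * (e \<bullet> e)"
    and le: "\<And>z. z \<in> \<Omega> \<Longrightarrow> ereal (v z) \<le> u z" and eq: "u z0 = ereal (v z0)"
  shows False
proof -
  let ?n = "real DIM('a)"
  obtain x0 t0 where z0: "z0 = (x0, t0)" by (cases z0)
  define g where "g = 2 * c * ?n + 2 * d * (e \<bullet> e) - b"
  \<comment> \<open>Lowering c by \<delta> takes 2 n \<delta> = g/2 off the Laplacian; the time
    slope receives the other half of g, so the two agree. The error \<eta> is small enough to leave
    \<delta>/2 of the spatial gap and g/4 of the gap in past times.\<close>
  define \<delta> where "\<delta> = g / (4 * ?n)"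
  define \<eta> where "\<eta> = min \<delta> (g / 2) / 2"
  have g: "g > 0" using b by (simp add: g_def)
  then have \<delta>: "\<delta> > 0" by (simp add: \<delta>_def)
  with g have \<eta>: "\<eta> > 0" "\<eta> \<le> \<delta> / 2" "\<eta> \<le> g / 4" by (auto simp: \<eta>_def)
  have "\<forall>\<^sub>F z in nhds z0. \<bar>v z - quad z0 (v z0) a c d e b z\<bar>
      \<le> \<eta> * ((norm (fst z - fst z0))\<^sup>2 + \<bar>snd z - snd z0\<bar>)"
    using jet \<eta>(1) by (auto simp: parabolic_jet_def)
  moreover have "\<forall>\<^sub>F z in nhds z0. z \<in> \<Omega>"
    using \<open>open \<Omega>\<close> \<open>z0 \<in> \<Omega>\<close> by (rule eventually_nhds_in_open)
  ultimately have "\<forall>\<^sub>F z in nhds z0. z \<in> \<Omega> \<and> \<bar>v z - quad z0 (v z0) a c d e b z\<bar>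
      \<le> \<eta> * ((norm (fst z - fst z0))\<^sup>2 + \<bar>snd z - snd z0\<bar>)"
    by (rule eventually_conj[rotated])
  then obtain r where r: "r > 0" and near: "\<And>z. dist z z0 < r \<Longrightarrow> z \<in> \<Omega> \<and>
      \<bar>v z - quad z0 (v z0) a c d e b z\<bar> \<le> \<eta> * ((norm (fst z - fst z0))\<^sup>2 + \<bar>snd z - snd z0\<bar>)"
    unfolding eventually_nhds_metric by blast
  define \<rho> where "\<rho> = r / (2 * ?n)"
  define \<tau> where "\<tau> = r / 4"
  \<comment> \<open>The box has to extend beyond t0 to contain z0, and there \<open>h\<close> may
    overtake v. \<tau>' keeps the loss g \<tau>' within \<delta> \<rho>^2/4, half of the lateral
    gap; \<kappa> fits into the other half and into the gap g \<tau>/4 at the bottom.\<close>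
  define \<tau>' where "\<tau>' = min (r / 4) (\<delta> * \<rho>\<^sup>2 / (4 * g))"
  define \<kappa> where "\<kappa> = min (g * \<tau> / 4) (\<delta> * \<rho>\<^sup>2 / 4)"
  have n: "?n > 0" by simp
  have pos: "\<rho> > 0" "\<tau> > 0" "\<tau>' > 0" "\<kappa> > 0" "\<tau>' \<le> r / 4" "g * \<tau>' \<le> \<delta> * \<rho>\<^sup>2 / 4"
    using r g \<delta> by (auto simp: \<rho>_def \<tau>_def \<tau>'_def \<kappa>_def min_def field_simps)
  define A where "A = x0 - \<rho> *\<^sub>R One"
  define B where "B = x0 + \<rho> *\<^sub>R One"
  have AB: "A \<bullet> i = x0 \<bullet> i - \<rho>" "B \<bullet> i = x0 \<bullet> i + \<rho>" if "i \<in> Basis" for i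
    using that by (auto simp: A_def B_def inner_simps)
  have x0: "x0 \<in> box A B" using pos AB by (auto simp: mem_box)
  have cl: "closure (box A B \<times> {t0 - \<tau><..<t0 + \<tau>'}) = cbox A B \<times> {t0 - \<tau>..t0 + \<tau>'}"
  proof -
    have "box A B \<noteq> {}" using x0 by blast
    from closure_box[OF this] show ?thesis using pos by (simp add: closure_Times)
  qed
  have inside: "dist z z0 < r" if "z \<in> cbox A B \<times> {t0 - \<tau>..t0 + \<tau>'}" for z
  proof -
    obtain x t where xt: "z = (x, t)" by (cases z)
    with that have z: "z = (x, t)" "x \<in> cbox A B" "t \<in> {t0 - \<tau>..t0 + \<tau>'}" by auto
    have "norm (x - x0) \<le> (\<Sum>i\<in>Basis. \<bar>(x - x0) \<bullet> i\<bar>)" by (rule norm_le_l1)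
    also have "\<dots> \<le> (\<Sum>i\<in>(Basis::'a set). \<rho>)"
      using z(2) AB by (intro sum_mono) (auto simp: mem_box inner_simps abs_le_iff)
    also have "\<dots> = r / 2" by (simp add: \<rho>_def)
    finally have "norm (x - x0) \<le> r / 2" .
    moreover have "\<bar>t - t0\<bar> \<le> r / 4" using z(3) pos(5) unfolding abs_le_iff \<tau>_def atLeastAtMost_iff by linarith
    moreover have "dist z z0 \<le> norm (x - x0) + \<bar>t - t0\<bar>"
      using norm_Pair_le[of "x - x0" "t - t0"] by (simp add: z(1) z0 dist_norm)
    ultimately show ?thesis using r by linarith
  qed
  \<comment> \<open>Lowering \<open>c\<close> by \<open>\<delta>\<close> and raising the time slope makes \<open>h\<close> caloric and puts it below \<open>v\<close> on the parabolic boundary.\<close>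
  define h where "h = quad z0 (v z0 + \<kappa>) a (c - \<delta>) d e (b + g / 2)"
  have caloric: "b + g / 2 = 2 * (c - \<delta>) * ?n + 2 * d * (e \<bullet> e)"
    using n by (simp add: g_def \<delta>_def field_simps)
  have gap: "v z - h z \<ge> \<delta> / 2 * (norm (x - x0))\<^sup>2 + (if t \<le> t0 then g / 4 * (t0 - t) else - g * (t - t0)) - \<kappa>"
    if "z \<in> cbox A B \<times> {t0 - \<tau>..t0 + \<tau>'}" "z = (x, t)" for z x t
  proof -
    let ?N = "(norm (x - x0))\<^sup>2"
    have "v z - quad z0 (v z0) a c d e b z \<ge> - \<eta> * (?N + \<bar>t - t0\<bar>)"
      using near[OF inside[OF that(1)]] by (simp add: that(2) z0 abs_le_iff)
    then have "v z - h z \<ge> \<delta> * ?N - g / 2 * (t - t0) - \<eta> * ?N - \<eta> * \<bar>t - t0\<bar> - \<kappa>"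
      by (simp add: h_def quad_def that(2) z0 algebra_simps)
    moreover have "\<eta> * ?N \<le> \<delta> / 2 * ?N" "\<eta> * \<bar>t - t0\<bar> \<le> g / 4 * \<bar>t - t0\<bar>"
      using \<eta> by (rule_tac mult_right_mono, simp, simp)+
    moreover have "g / 2 * (t - t0) = g * (t - t0) / 2" "g / 4 * (t0 - t) = - (g * (t - t0)) / 4"
      "- g * (t - t0) = - (g * (t - t0))" "\<delta> / 2 * ?N = \<delta> * ?N / 2"
      by (auto simp: field_simps)
    moreover have "t \<le> t0 \<longrightarrow> g / 4 * \<bar>t - t0\<bar> = - (g * (t - t0)) / 4"
      "\<not> t \<le> t0 \<longrightarrow> g / 4 * \<bar>t - t0\<bar> = g * (t - t0) / 4"
      by (auto simp: field_simps)
    moreover have "\<not> t \<le> t0 \<longrightarrow> g * (t - t0) \<ge> 0" using g by simp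
    ultimately show ?thesis by argo
  qed
  have "ereal (h z) \<le> u z" if z: "z \<in> parabolic_boundary (box A B) (t0 - \<tau>) (t0 + \<tau>')" for z
  proof -
    obtain x t where xt: "z = (x, t)" by (cases z)
    have frontier: "norm (x - x0) \<ge> \<rho>" if "x \<in> frontier (box A B)" for x
    proof -
      have "x \<in> cbox A B" "x \<notin> box A B" using that x0 unfolding frontier_box by (auto split: if_splits)
      then obtain i where i: "i \<in> Basis" "x \<bullet> i = A \<bullet> i \<or> x \<bullet> i = B \<bullet> i"
        unfolding mem_box by (meson order_antisym not_le)
      then have "\<bar>(x - x0) \<bullet> i\<bar> = \<rho>" using AB pos by (auto simp: inner_simps)
      then show ?thesis using Basis_le_norm[OF i(1), of "x - x0"] by simp
    qed
    have "box A B \<noteq> {}" using x0 by blast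
    then have "closure (box A B) = cbox A B" "frontier (box A B) \<subseteq> cbox A B"
      by (auto simp: closure_box frontier_box)
    then have mem: "z \<in> cbox A B \<times> {t0 - \<tau>..t0 + \<tau>'}"
      using z pos by (auto simp: parabolic_boundary_def xt)
    have "v z - h z \<ge> 0"
    proof (cases "t = t0 - \<tau>")
      case True
      then have "\<kappa> \<le> g / 4 * (t0 - t)" by (simp add: \<kappa>_def)
      moreover have "\<delta> / 2 * (norm (x - x0))\<^sup>2 \<ge> 0" using \<delta> by simp
      ultimately show ?thesis using gap[OF mem xt] True pos by simp
    next
      case False
      then have "x \<in> frontier (box A B)" "t \<le> t0 + \<tau>'" using z by (auto simp: parabolic_boundary_def xt)
      then have "\<rho>\<^sup>2 \<le> (norm (x - x0))\<^sup>2" using frontier pos by (intro power_mono) auto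
      then have "\<delta> / 2 * \<rho>\<^sup>2 \<le> \<delta> / 2 * (norm (x - x0))\<^sup>2" using \<delta> by simp
      moreover have "(if t \<le> t0 then g / 4 * (t0 - t) else - g * (t - t0)) \<ge> - (\<delta> * \<rho>\<^sup>2 / 4)"
      proof (cases "t \<le> t0")
        case True
        then have "g / 4 * (t0 - t) \<ge> 0" "\<delta> * \<rho>\<^sup>2 \<ge> 0" using g \<delta> by auto
        then show ?thesis using True by simp
      next
        case False
        have "g * (t - t0) \<le> g * \<tau>'" using \<open>t \<le> t0 + \<tau>'\<close> g by (intro mult_left_mono) auto
        then show ?thesis using pos False by simp
      qed
      moreover have "\<kappa> \<le> \<delta> * \<rho>\<^sup>2 / 4" by (simp add: \<kappa>_def)
      ultimately show ?thesis using gap[OF mem xt] by linarith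
    qed
    then have "ereal (h z) \<le> ereal (v z)" by simp
    also have "\<dots> \<le> u z" using near[OF inside[OF mem]] by (intro le) simp
    finally show ?thesis .
  qed
  moreover have "compactly_inside (box A B \<times> {t0 - \<tau><..<t0 + \<tau>'}) \<Omega>"
    unfolding compactly_inside_def cl using inside near by (auto intro: compact_Times)
  moreover have "p_parabolic 2 (box A B \<times> {t0 - \<tau><..<t0 + \<tau>'}) h"
    unfolding h_def by (rule quad_p_parabolic[OF caloric])
  moreover have "continuous_on (closure (box A B \<times> {t0 - \<tau><..<t0 + \<tau>'})) h"
    unfolding h_def by (rule continuous_on_quad)
  moreover have "t0 - \<tau> < t0 + \<tau>'" using pos by simp
  ultimately have "\<forall>z\<in>box A B \<times> {t0 - \<tau><..<t0 + \<tau>'}. ereal (h z) \<le> u z"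
    using u unfolding p_superparabolic_def by blast
  moreover have "z0 \<in> box A B \<times> {t0 - \<tau><..<t0 + \<tau>'}" using x0 pos by (simp add: z0)
  ultimately have "ereal (h z0) \<le> u z0" by blast
  then show False using eq pos by (simp add: h_def quad_def)
qed

text \<open>If u - v stayed above its infimum m, every point of the closure would have a
  neighbourhood on which u - v \<ge> q for some q > m, and finitely many of these would contradict
  the choice of m. At boundary points this works because m < 0, while u - v is eventually above
  every negative number.\<close>

lemma lsc_attains_min:
  fixes \<Omega> :: "'b::euclidean_space set"
  assumes lsc: "lower_semicontinuous_on \<Omega> u" and fin: "\<And>z. z \<in> \<Omega> \<Longrightarrow> u z \<noteq> -\<infinity>"
    and "bounded \<Omega>" and v: "\<And>z. z \<in> \<Omega> \<Longrightarrow> isCont v z"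
    and bdry: "\<And>\<xi> \<kappa>. \<xi> \<in> frontier \<Omega> \<Longrightarrow> \<kappa> > 0 \<Longrightarrow> \<forall>\<^sub>F z in at \<xi> within \<Omega>. ereal (v z - \<kappa>) \<le> u z"
    and "open \<Omega>" and z1: "z1 \<in> \<Omega>" "u z1 < ereal (v z1)"
  obtains z0 k where "z0 \<in> \<Omega>" "u z0 = ereal (v z0 + k)" "\<And>z. z \<in> \<Omega> \<Longrightarrow> ereal (v z + k) \<le> u z"
proof -
  define D where "D z = u z - ereal (v z)" for z
  have Dless: "ereal q < D z \<longleftrightarrow> ereal (v z + q) < u z" for q z
    unfolding D_def by (cases "u z") auto
  have Dle: "ereal q \<le> D z \<longleftrightarrow> ereal (v z + q) \<le> u z" for q z
    unfolding D_def by (cases "u z") auto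
  define m where "m = (INF z\<in>\<Omega>. D z)"
  have "m \<le> D z1" unfolding m_def by (rule INF_lower[OF z1(1)])
  moreover have "D z1 < 0" using z1(2) unfolding D_def by (cases "u z1") auto
  ultimately have m0: "m < 0" by simp
  have "\<exists>z0\<in>\<Omega>. D z0 \<le> m"
  proof (rule ccontr)
    assume "\<not> ?thesis"
    then have gt: "\<And>z. z \<in> \<Omega> \<Longrightarrow> m < D z" by auto
    have "\<exists>N q. open N \<and> \<xi> \<in> N \<and> m < ereal q \<and> (\<forall>z\<in>N \<inter> \<Omega>. ereal q \<le> D z)" if "\<xi> \<in> closure \<Omega>" for \<xi>
    proof (cases "\<xi> \<in> \<Omega>")
      case True
      obtain p where p: "m < ereal p" "ereal p < D \<xi>" using ereal_dense2[OF gt[OF True]] by auto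
      obtain q where q: "m < ereal q" "q < p" using ereal_dense2[OF p(1)] by auto
      have "ereal (v \<xi> + p) < Liminf (at \<xi> within \<Omega>) u"
        using p(2) lsc True unfolding Dless lower_semicontinuous_on_def by (blast intro: less_le_trans)
      then have 1: "\<forall>\<^sub>F z in at \<xi> within \<Omega>. ereal (v \<xi> + p) < u z" by (rule less_LiminfD)
      have "\<forall>\<^sub>F z in at \<xi> within \<Omega>. v z < v \<xi> + (p - q)"
        using v[OF True] q by (intro order_tendstoD) (auto simp: isCont_def intro: tendsto_within_subset)
      with 1 have "\<forall>\<^sub>F z in at \<xi> within \<Omega>. ereal q \<le> D z"
      proof eventually_elim
        case (elim z)
        then show ?case unfolding Dle
          by (cases "u z") auto
      qed
      then obtain N where "open N" "\<xi> \<in> N" "\<forall>z\<in>N. z \<noteq> \<xi> \<longrightarrow> z \<in> \<Omega> \<longrightarrow> ereal q \<le> D z"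
        unfolding eventually_at_topological by blast
      moreover have "ereal q \<le> D \<xi>" using p q by (metis ereal_less(2) ereal_less_eq(3) less_imp_le order_trans)
      ultimately show ?thesis using q(1) by (metis IntE)
    next
      case False
      then have \<xi>: "\<xi> \<in> frontier \<Omega>" using that by (simp add: frontier_def interior_open[OF \<open>open \<Omega>\<close>])
      obtain q where q: "m < ereal q" "ereal q < 0" using ereal_dense2[OF m0] by auto
      have "\<forall>\<^sub>F z in at \<xi> within \<Omega>. ereal q \<le> D z"
        using bdry[OF \<xi>, of "- q"] q unfolding Dle by simp
      then obtain N where "open N" "\<xi> \<in> N" "\<forall>z\<in>N. z \<noteq> \<xi> \<longrightarrow> z \<in> \<Omega> \<longrightarrow> ereal q \<le> D z"
        unfolding eventually_at_topological by blast
      then show ?thesis using q(1) False by (metis IntE)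
    qed
    then obtain N q where Nq: "\<And>\<xi>. \<xi> \<in> closure \<Omega> \<Longrightarrow>
        open (N \<xi>) \<and> \<xi> \<in> N \<xi> \<and> m < ereal (q \<xi>) \<and> (\<forall>z\<in>N \<xi> \<inter> \<Omega>. ereal (q \<xi>) \<le> D z)"
      by metis
    have "compact (closure \<Omega>)" using \<open>bounded \<Omega>\<close> by simp
    then obtain C where C: "C \<subseteq> closure \<Omega>" "finite C" "closure \<Omega> \<subseteq> (\<Union>\<xi>\<in>C. N \<xi>)"
      by (rule compactE_image[of _ "closure \<Omega>" N]) (use Nq in auto)
    have "C \<noteq> {}" using C(3) z1(1) closure_subset by blast
    have "ereal (Min (q ` C)) \<le> D z" if "z \<in> \<Omega>" for z
    proof -
      obtain \<xi> where \<xi>: "\<xi> \<in> C" "z \<in> N \<xi>" using C(3) \<open>z \<in> \<Omega>\<close> closure_subset by blast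
      then have "ereal (q \<xi>) \<le> D z" using Nq C(1) \<open>z \<in> \<Omega>\<close> by blast
      moreover have "Min (q ` C) \<le> q \<xi>" using \<xi>(1) C(2) by simp
      ultimately show ?thesis by (metis ereal_less_eq(3) order_trans)
    qed
    then have "ereal (Min (q ` C)) \<le> m" unfolding m_def by (rule INF_greatest)
    moreover have "Min (q ` C) \<in> q ` C" using C(2) \<open>C \<noteq> {}\<close> by (intro Min_in) auto
    then obtain \<xi> where "\<xi> \<in> C" "Min (q ` C) = q \<xi>" by (elim imageE)
    ultimately show False using Nq C(1) by (metis in_mono not_le)
  qed
  then obtain z0 where z0: "z0 \<in> \<Omega>" "D z0 \<le> m" by blast
  have Dz0: "D z0 = m" using z0 by (intro antisym) (auto simp: m_def intro: INF_lower)
  then have "D z0 \<noteq> \<infinity>" "D z0 \<noteq> -\<infinity>" using m0 fin[OF z0(1)] by (auto simp: D_def) (cases "u z0"; simp)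
  then obtain k where k: "D z0 = ereal k" by (cases "D z0") auto
  have "u z0 = ereal (v z0 + k)" using k unfolding D_def by (cases "u z0") auto
  moreover have "ereal (v z + k) \<le> u z" if "z \<in> \<Omega>" for z
    using k Dz0 that unfolding Dle[symmetric] m_def by (metis INF_lower)
  ultimately show thesis using that z0(1) by blast
qed

text \<open>The subsolution enters as -w, so that one notion serves both comparison principles. If
  it exceeded u somewhere, adding the minimum of u + w would make it touch u from below.\<close>

lemma superparabolic_ge_subsolution:
  fixes \<Omega> :: "('a::euclidean_space \<times> real) set"
  assumes u: "p_superparabolic 2 \<Omega> u" and "open \<Omega>" "bounded \<Omega>"
    and w: "\<And>z. z \<in> \<Omega> \<Longrightarrow> strict_supersolution_at w z"
    and bdry: "\<And>\<xi> \<kappa>. \<xi> \<in> frontier \<Omega> \<Longrightarrow> \<kappa> > 0 \<Longrightarrow> \<forall>\<^sub>F z in at \<xi> within \<Omega>. ereal (- w z - \<kappa>) \<le> u z"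
    and "z \<in> \<Omega>"
  shows "ereal (- w z) \<le> u z"
proof (rule ccontr)
  assume "\<not> ?thesis"
  then have lt: "u z < ereal (- w z)" by simp
  have lsc: "lower_semicontinuous_on \<Omega> u" and fin: "\<And>z. z \<in> \<Omega> \<Longrightarrow> u z \<noteq> -\<infinity>"
    using u by (auto simp: p_superparabolic_def)
  have cont: "isCont (\<lambda>z. - w z) z" if "z \<in> \<Omega>" for z
    using w[OF that] parabolic_jet_continuous unfolding strict_supersolution_at_def
    by (intro continuous_minus) blast
  obtain z0 k where z0: "z0 \<in> \<Omega>" "u z0 = ereal (- w z0 + k)" "\<And>z. z \<in> \<Omega> \<Longrightarrow> ereal (- w z + k) \<le> u z"
    using lsc_attains_min[OF lsc fin \<open>bounded \<Omega>\<close> cont bdry \<open>open \<Omega>\<close> \<open>z \<in> \<Omega>\<close> lt] by blast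
  obtain a c d e b where j: "parabolic_jet w z0 a c d e b" and b: "b > 2 * c * real DIM('a) + 2 * d * (e \<bullet> e)"
    using w[OF z0(1)] by (auto simp: strict_supersolution_at_def)
  have "parabolic_jet (\<lambda>z. - w z + k) z0 (- a) (- c) (- d) e (- b)"
    using parabolic_jet_affine[OF j, of "-1" k] by simp
  from no_touching_from_below[OF u \<open>open \<Omega>\<close> z0(1) this _ z0(3) z0(2)] b show False by simp
qed

section \<open>Weak solutions are distributional solutions\<close>

lemma AE_lborel_slices:
  fixes P :: "'a::euclidean_space \<times> 'b::euclidean_space \<Rightarrow> bool"
  assumes "AE z in lborel. P z"
  shows "AE t in lborel. AE x in lborel. P (x, t)"
proof -
  obtain N where N: "N \<in> null_sets (lborel :: ('a \<times> 'b) measure)" "{z. \<not> P z} \<subseteq> N"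
    using assms by (auto elim!: AE_E simp: null_sets_def)
  have "- N \<in> sets (lborel \<Otimes>\<^sub>M lborel)"
    using N(1) unfolding lborel_prod by (auto simp: null_sets_def)
  then have sets: "{z \<in> space (lborel \<Otimes>\<^sub>M lborel). (fst z, snd z) \<notin> N} \<in> sets (lborel \<Otimes>\<^sub>M lborel)"
    by (simp add: space_pair_measure Compl_eq)
  have "AE z in lborel \<Otimes>\<^sub>M lborel. z \<notin> N"
    using N(1) by (simp add: lborel_prod AE_not_in)
  then have "AE x in lborel. AE t in lborel. (x, t) \<notin> N"
    by (rule lborel_pair.AE_pair)
  then have "AE t in lborel. AE x in lborel. (x, t) \<notin> N"
    using lborel_pair.AE_commute[of "\<lambda>x t. (x, t) \<notin> N", OF sets] by simp
  then show ?thesis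
  proof eventually_elim
    case (elim t)
    then show ?case by eventually_elim (use N(2) in blast)
  qed
qed

text \<open>F is only Lebesgue measurable, so a slice may fail to be measurable for exceptional t.
  Fubini is applied to a Borel representative, and g collects the slice integrals of that
  representative.\<close>

lemma lebesgue_integral_slices:
  fixes F :: "'a::euclidean_space \<times> real \<Rightarrow> real"
  assumes F: "integrable (lebesgue_on (U \<times> T)) F" and U: "open U" and T: "open T"
  obtains g where "g \<in> borel_measurable lborel" "(\<integral>z. F z \<partial>lebesgue_on (U \<times> T)) = (\<integral>t. g t \<partial>lborel)"
    "AE t in lborel. g t = (if t \<in> T then \<integral>x. F (x, t) \<partial>lebesgue_on U else 0)"
proof -
  have S: "U \<times> T \<in> sets lebesgue" using open_Times[OF U T] by simp
  define H where "H z = indicator (U \<times> T) z * F z" for z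
  have H: "integrable lebesgue H" and eq: "(\<integral>z. F z \<partial>lebesgue_on (U \<times> T)) = (\<integral>z. H z \<partial>lebesgue)"
    using F S by (simp_all add: integrable_restrict_space integral_restrict_space H_def[abs_def])
  obtain H' where H': "H' \<in> borel_measurable lborel" "AE z in lborel. H z = H' z"
    using completion_ex_borel_measurable_real[OF borel_measurable_integrable[OF H]] by auto
  have "(\<integral>\<^sup>+ z. ennreal (norm (H z)) \<partial>lborel) = (\<integral>\<^sup>+ z. ennreal (norm (H' z)) \<partial>lborel)"
    using H' by (intro nn_integral_cong_AE) auto
  then have intH': "integrable lborel H'"
    using H H'(1) by (auto simp: integrable_iff_bounded nn_integral_completion cong: nn_integral_cong_AE)
  have "(\<integral>z. H z \<partial>lebesgue) = (\<integral>z. H' z \<partial>lebesgue)"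
    using H' H by (intro integral_cong_AE) (auto intro: AE_completion measurable_completion)
  also have "\<dots> = (\<integral>z. H' z \<partial>lborel)" using H' by (simp add: integral_completion)
  also have "\<dots> = (\<integral>t. (\<integral>x. H' (x, t) \<partial>lborel) \<partial>lborel)"
    using lborel_pair.integral_snd[of "\<lambda>x t. H' (x, t)"] intH' by (simp add: lborel_prod)
  finally have 1: "(\<integral>z. F z \<partial>lebesgue_on (U \<times> T)) = (\<integral>t. (\<integral>x. H' (x, t) \<partial>lborel) \<partial>lborel)"
    using eq by simp
  have "integrable (lborel \<Otimes>\<^sub>M lborel) (case_prod (\<lambda>x t. H' (x, t)))"
    using intH' by (simp add: lborel_prod)
  from lborel_pair.integrable_snd[OF this]
  have 2: "(\<lambda>t. \<integral>x. H' (x, t) \<partial>lborel) \<in> borel_measurable lborel" by (rule borel_measurable_integrable)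
  have "AE t in lborel. (\<integral>x. H' (x, t) \<partial>lborel) = (if t \<in> T then \<integral>x. F (x, t) \<partial>lebesgue_on U else 0)"
    using AE_lborel_slices[OF H'(2)]
  proof eventually_elim
    case (elim t)
    have "(\<lambda>x. H' (x, t)) = H' \<circ> (\<lambda>x. (x, t))" by auto
    moreover have "(\<lambda>x::'a. (x, t)) \<in> borel_measurable borel"
      by (intro borel_measurable_continuous_onI continuous_intros)
    moreover have "H' \<in> borel_measurable borel" using H'(1) by simp
    ultimately have m: "(\<lambda>x. H' (x, t)) \<in> borel_measurable borel"
      using measurable_comp[of "\<lambda>x::'a. (x, t)" borel borel H' borel] by simp
    then have m': "(\<lambda>x. H' (x, t)) \<in> borel_measurable lebesgue" by (simp add: measurable_completion)
    have ae: "AE x in lebesgue. H' (x, t) = H (x, t)"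
      using elim by (intro AE_completion) (auto elim: eventually_mono)
    have "(\<integral>x. H' (x, t) \<partial>lborel) = (\<integral>x. H' (x, t) \<partial>lebesgue)" using m by (simp add: integral_completion)
    also have "\<dots> = (\<integral>x. H (x, t) \<partial>lebesgue)"
      using m' ae borel_measurable_AE[OF m' ae] by (intro integral_cong_AE)
    also have "\<dots> = (if t \<in> T then \<integral>x. F (x, t) \<partial>lebesgue_on U else 0)"
    proof (cases "t \<in> T")
      case True
      then have "(\<lambda>x. H (x, t)) = (\<lambda>x. indicator U x *\<^sub>R F (x, t))"
        by (auto simp: H_def indicator_def)
      then show ?thesis using True U by (simp add: integral_restrict_space)
    qed (simp add: H_def)
    finally show ?case .
  qed
  with 1 2 show thesis using that by blast
qed

text \<open>Turns the condition on almost every time slice in \<open>in_Lp_W1p\<close> into an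
  identity on the whole cylinder.\<close>

lemma lebesgue_integral_eq_slices:
  fixes F F' :: "'a::euclidean_space \<times> real \<Rightarrow> real"
  assumes F: "integrable (lebesgue_on (U \<times> T)) F" "integrable (lebesgue_on (U \<times> T)) F'"
    and "open U" "open T"
    and "AE t in lebesgue_on T. (\<integral>x. F (x, t) \<partial>lebesgue_on U) = (\<integral>x. F' (x, t) \<partial>lebesgue_on U)"
  shows "(\<integral>z. F z \<partial>lebesgue_on (U \<times> T)) = (\<integral>z. F' z \<partial>lebesgue_on (U \<times> T))"
proof -
  obtain g where g: "g \<in> borel_measurable lborel" "(\<integral>z. F z \<partial>lebesgue_on (U \<times> T)) = (\<integral>t. g t \<partial>lborel)"
    "AE t in lborel. g t = (if t \<in> T then \<integral>x. F (x, t) \<partial>lebesgue_on U else 0)"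
    by (rule lebesgue_integral_slices[OF F(1) assms(3,4)])
  obtain g' where g': "g' \<in> borel_measurable lborel" "(\<integral>z. F' z \<partial>lebesgue_on (U \<times> T)) = (\<integral>t. g' t \<partial>lborel)"
    "AE t in lborel. g' t = (if t \<in> T then \<integral>x. F' (x, t) \<partial>lebesgue_on U else 0)"
    by (rule lebesgue_integral_slices[OF F(2) assms(3,4)])
  have "AE t in lebesgue. t \<in> T \<longrightarrow> (\<integral>x. F (x, t) \<partial>lebesgue_on U) = (\<integral>x. F' (x, t) \<partial>lebesgue_on U)"
    using assms(5) \<open>open T\<close> by (simp add: AE_restrict_space_iff)
  then have "AE t in lborel. t \<in> T \<longrightarrow> (\<integral>x. F (x, t) \<partial>lebesgue_on U) = (\<integral>x. F' (x, t) \<partial>lebesgue_on U)"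
    by (simp add: AE_completion_iff)
  with g(3) g'(3) have "AE t in lborel. g t = g' t" by eventually_elim simp
  with g(1) g'(1) have "(\<integral>t. g t \<partial>lborel) = (\<integral>t. g' t \<partial>lborel)" by (intro integral_cong_AE)
  then show ?thesis using g(2) g'(2) by simp
qed

lemma test_function_slice:
  assumes \<psi>: "test_function (U \<times> T) \<psi>" and "t \<in> T"
  shows "test_function U (\<lambda>x. \<psi> (x, t))"
proof -
  let ?K = "closure {z. \<psi> z \<noteq> 0}"
  have K: "compact ?K" "?K \<subseteq> U \<times> T" using \<psi> by (auto simp: test_function_def compactly_inside_def)
  have "compact (fst ` (?K \<inter> UNIV \<times> {t}))"
    by (intro compact_continuous_image continuous_intros compact_Int_closed K closed_Times)
  moreover have "{x. \<psi> (x, t) \<noteq> 0} \<subseteq> fst ` (?K \<inter> UNIV \<times> {t})"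
    using closure_subset[of "{z. \<psi> z \<noteq> 0}"] by force
  ultimately have cl: "closure {x. \<psi> (x, t) \<noteq> 0} \<subseteq> fst ` (?K \<inter> UNIV \<times> {t})"
    by (intro closure_minimal) (auto intro: compact_imp_closed)
  moreover have "fst ` (?K \<inter> UNIV \<times> {t}) \<subseteq> U" using K(2) by auto
  moreover have "compact (closure {x. \<psi> (x, t) \<noteq> 0})"
    using compact_Int_closed[OF \<open>compact (fst ` (?K \<inter> UNIV \<times> {t}))\<close> closed_closure, of "{x. \<psi> (x, t) \<noteq> 0}"] cl
    by (simp add: Int_absorb1)
  ultimately show ?thesis
    using Ck_function_slice[OF test_function_Ck[OF \<psi>]] by (auto simp: test_function_def compactly_inside_def)
qed

text \<open>On a set of finite measure |f| \<le> 1 + f^2 puts f in L^1, and the test function is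
  bounded.\<close>

lemma integrable_in_Lp_times_test:
  fixes f :: "'b::euclidean_space \<Rightarrow> real"
  assumes f: "in_Lp 2 S f" and \<psi>: "test_function S \<psi>" and S: "S \<in> lmeasurable"
  shows "integrable (lebesgue_on S) (\<lambda>x. f x * \<psi> x)"
proof -
  have c: "continuous_on UNIV \<psi>" using test_function_Ck[OF \<psi>, of 0] by simp
  have "compact (closure {x. \<psi> x \<noteq> 0})" using \<psi> by (simp add: test_function_def compactly_inside_def)
  then have "compact (\<psi> ` closure {x. \<psi> x \<noteq> 0})"
    by (intro compact_continuous_image continuous_on_subset[OF c]) auto
  then obtain B where B: "\<And>x. x \<in> closure {x. \<psi> x \<noteq> 0} \<Longrightarrow> \<bar>\<psi> x\<bar> \<le> B"
    using compact_imp_bounded[OF \<open>compact (\<psi> ` _)\<close>] by (auto simp: bounded_iff)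
  have B': "\<bar>\<psi> x\<bar> \<le> max B 0" for x
    using B[of x] closure_subset[of "{x. \<psi> x \<noteq> 0}"] by (cases "\<psi> x = 0") auto
  interpret finite_measure "lebesgue_on S" by (rule finite_measure_lebesgue_on[OF S])
  have int: "integrable (lebesgue_on S) (\<lambda>x. max B 0 * (1 + norm (f x) powr 2))"
    using f by (intro integrable_mult_right Bochner_Integration.integrable_add) (auto simp: in_Lp_def)
  show ?thesis
  proof (rule Bochner_Integration.integrable_bound[OF int])
    have "\<psi> \<in> borel_measurable (lebesgue_on S)"
      using borel_measurable_continuous_onI[OF c]
      by (intro measurable_restrict_space1 measurable_completion) simp
    then show "(\<lambda>x. f x * \<psi> x) \<in> borel_measurable (lebesgue_on S)"
      using f by (intro borel_measurable_times) (auto simp: in_Lp_def)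
    have "\<bar>f x * \<psi> x\<bar> \<le> \<bar>max B 0 * (1 + (f x)\<^sup>2)\<bar>" for x
    proof -
      have "0 \<le> (\<bar>f x\<bar> - 1)\<^sup>2" by simp
      then have "\<bar>f x\<bar> \<le> 1 + (f x)\<^sup>2" unfolding power2_diff by (simp add: power2_eq_square)
      then have "\<bar>f x\<bar> * \<bar>\<psi> x\<bar> \<le> (1 + (f x)\<^sup>2) * max B 0"
        using B'[of x] by (intro mult_mono) auto
      then show ?thesis by (simp add: abs_mult mult.commute)
    qed
    then show "AE x in lebesgue_on S. norm (f x * \<psi> x) \<le> norm (max B 0 * (1 + norm (f x) powr 2))"
      by (intro AE_I2) simp
  qed
qed

text \<open>The formal adjoint of \<partial>_t - \<Delta> with its sign reversed.\<close>

definition heat_adjoint :: "('a::euclidean_space \<times> real \<Rightarrow> real) \<Rightarrow> 'a \<times> real \<Rightarrow> real" where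
  "heat_adjoint \<phi> z = dderiv \<phi> (0, 1) z + (\<Sum>i\<in>Basis. dderiv (dderiv \<phi> (i, 0)) (i, 0) z)"

lemma in_Lp_inner:
  assumes "in_Lp 2 S G" shows "in_Lp 2 S (\<lambda>x. G x \<bullet> i)"
proof -
  have m: "(\<lambda>x. G x \<bullet> i) \<in> borel_measurable (lebesgue_on S)"
    using assms by (auto simp: in_Lp_def)
  have int: "integrable (lebesgue_on S) (\<lambda>x. (norm i)\<^sup>2 * norm (G x) powr 2)"
    using assms by (auto simp: in_Lp_def)
  have "integrable (lebesgue_on S) (\<lambda>x. norm (G x \<bullet> i) powr 2)"
  proof (rule Bochner_Integration.integrable_bound[OF int])
    have "(\<lambda>x. norm (G x \<bullet> i) powr 2) = (\<lambda>x. (G x \<bullet> i)\<^sup>2)" by simp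
    then show "(\<lambda>x. norm (G x \<bullet> i) powr 2) \<in> borel_measurable (lebesgue_on S)"
      using borel_measurable_power[OF m, of 2] by simp
    have "(G x \<bullet> i)\<^sup>2 \<le> (norm i)\<^sup>2 * (norm (G x))\<^sup>2" for x
      using power_mono[OF Cauchy_Schwarz_ineq2[of "G x" i], of 2] by (simp add: power_mult_distrib mult.commute)
    then show "AE x in lebesgue_on S. norm (norm (G x \<bullet> i) powr 2) \<le> norm ((norm i)\<^sup>2 * norm (G x) powr 2)"
      by (intro AE_I2) simp
  qed
  with m show ?thesis by (simp add: in_Lp_def)
qed

text \<open>The unknown weak gradient G is eliminated: for almost every t the slice of \<partial>_i
  \<phi> is a test function on U, so the definition of the weak gradient moves one more derivative
  onto \<phi>. What remains involves v only, and v = h almost everywhere.\<close>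

lemma p_parabolic_distributional:
  fixes U :: "'a::euclidean_space set"
  assumes h: "p_parabolic 2 \<Omega> h" and U: "open U" and t: "t1 < t2"
    and inside: "compactly_inside (U \<times> {t1<..<t2}) \<Omega>"
    and \<phi>: "test_function (U \<times> {t1<..<t2}) \<phi>"
  shows "(\<integral>z. h z * heat_adjoint \<phi> z \<partial>lebesgue_on (U \<times> {t1<..<t2})) = 0"
proof -
  let ?T = "{t1<..<t2}" and ?S = "U \<times> {t1<..<t2}"
  obtain v G where ae: "AE z in lebesgue_on ?S. ereal (h z) = ereal (v z)"
    and W: "in_Lp_W1p 2 U t1 t2 v G"
    and eq: "(\<integral>z. (norm (G z) powr (2 - 2)) *\<^sub>R G z \<bullet> space_gradient \<phi> z \<partial>lebesgue_on ?S)
             - (\<integral>z. v z * time_derivative \<phi> z \<partial>lebesgue_on ?S) = 0"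
    using h U t inside \<phi> unfolding p_parabolic_def weak_solution_def by blast
  have oS: "open ?S" using U by (intro open_Times) auto
  have bS: "bounded ?S"
    using inside unfolding compactly_inside_def
    using bounded_subset[OF compact_imp_bounded closure_subset] by blast
  have S: "?S \<in> lmeasurable" using oS bS by (simp add: bounded_set_imp_lmeasurable)
  have v: "in_Lp 2 ?S v" and G: "in_Lp 2 ?S G" using W by (auto simp: in_Lp_W1p_def)
  note D = test_function_dderiv[OF \<phi>]
  have parts: "(\<integral>z. (G z \<bullet> i) * dderiv \<phi> (i, 0) z \<partial>lebesgue_on ?S)
      = (\<integral>z. v z * - dderiv (dderiv \<phi> (i, 0)) (i, 0) z \<partial>lebesgue_on ?S)" if i: "i \<in> Basis" for i
  proof (rule lebesgue_integral_eq_slices[OF _ _ U])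
    show "integrable (lebesgue_on ?S) (\<lambda>z. (G z \<bullet> i) * dderiv \<phi> (i, 0) z)"
      by (intro integrable_in_Lp_times_test in_Lp_inner G D S)
    have "integrable (lebesgue_on ?S) (\<lambda>z. v z * dderiv (dderiv \<phi> (i, 0)) (i, 0) z)"
      by (intro integrable_in_Lp_times_test v test_function_dderiv D S)
    then show "integrable (lebesgue_on ?S) (\<lambda>z. v z * - dderiv (dderiv \<phi> (i, 0)) (i, 0) z)" by simp
    have "AE t in lebesgue_on ?T. t \<in> ?T" by (rule AE_I2) simp
    moreover have "AE t in lebesgue_on ?T. in_W1p 2 U (\<lambda>x. v (x, t)) (\<lambda>x. G (x, t))"
      using W by (simp add: in_Lp_W1p_def)
    ultimately show "AE t in lebesgue_on ?T. (\<integral>x. (G (x, t) \<bullet> i) * dderiv \<phi> (i, 0) (x, t) \<partial>lebesgue_on U)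
        = (\<integral>x. v (x, t) * - dderiv (dderiv \<phi> (i, 0)) (i, 0) (x, t) \<partial>lebesgue_on U)"
    proof eventually_elim
      case (elim t)
      let ?\<psi> = "\<lambda>x. dderiv \<phi> (i, 0) (x, t)"
      have "dderiv ?\<psi> i x = dderiv (dderiv \<phi> (i, 0)) (i, 0) (x, t)" for x
        using dderiv_slice[OF test_function_Ck[OF D, of "Suc 0"]] by simp
      moreover have "(\<integral>x. v (x, t) * dderiv ?\<psi> i x \<partial>lebesgue_on U) = - (\<integral>x. (G (x, t) \<bullet> i) * ?\<psi> x \<partial>lebesgue_on U)"
        using elim(2) test_function_slice[OF D elim(1), of "(i, 0)"] i
        unfolding in_W1p_def weak_gradient_on_def by blast
      ultimately show ?case by simp
    qed
  qed auto
  have "(\<integral>z. h z * heat_adjoint \<phi> z \<partial>lebesgue_on ?S) = (\<integral>z. v z * heat_adjoint \<phi> z \<partial>lebesgue_on ?S)"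
  proof (rule integral_cong_AE)
    have mv: "v \<in> borel_measurable (lebesgue_on ?S)" using v by (simp add: in_Lp_def)
    have hS: "continuous_on ?S h"
      using h inside closure_subset[of ?S] unfolding p_parabolic_def compactly_inside_def
      by (blast intro: continuous_on_subset)
    then have mh: "h \<in> borel_measurable (lebesgue_on ?S)"
      using oS by (intro continuous_imp_measurable_on_sets_lebesgue) auto
    have "continuous_on UNIV (heat_adjoint \<phi>)"
      unfolding heat_adjoint_def[abs_def]
      using test_function_Ck[OF D, of 0] test_function_Ck[OF test_function_dderiv[OF D], of 0]
      by (intro continuous_intros) auto
    then have ma: "heat_adjoint \<phi> \<in> borel_measurable (lebesgue_on ?S)"
      using borel_measurable_continuous_onI
      by (intro measurable_restrict_space1 measurable_completion) simp
    show "(\<lambda>z. h z * heat_adjoint \<phi> z) \<in> borel_measurable (lebesgue_on ?S)"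
      "(\<lambda>z. v z * heat_adjoint \<phi> z) \<in> borel_measurable (lebesgue_on ?S)"
      by (intro borel_measurable_times mv mh ma)+
    show "AE z in lebesgue_on ?S. h z * heat_adjoint \<phi> z = v z * heat_adjoint \<phi> z"
      using ae by eventually_elim simp
  qed
  have i0: "integrable (lebesgue_on ?S) (\<lambda>z. v z * dderiv \<phi> (0, 1) z)"
    and i1: "integrable (lebesgue_on ?S) (\<lambda>z. v z * dderiv (dderiv \<phi> (i, 0)) (i, 0) z)" for i
    by (intro integrable_in_Lp_times_test v test_function_dderiv \<phi> S)+
  note \<open>(\<integral>z. h z * heat_adjoint \<phi> z \<partial>lebesgue_on ?S) = (\<integral>z. v z * heat_adjoint \<phi> z \<partial>lebesgue_on ?S)\<close>
  also have "(\<integral>z. v z * heat_adjoint \<phi> z \<partial>lebesgue_on ?S)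
      = (\<integral>z. v z * dderiv \<phi> (0, 1) z + (\<Sum>i\<in>Basis. v z * dderiv (dderiv \<phi> (i, 0)) (i, 0) z) \<partial>lebesgue_on ?S)"
    by (simp add: heat_adjoint_def distrib_left sum_distrib_left)
  also have "\<dots> = (\<integral>z. v z * dderiv \<phi> (0, 1) z \<partial>lebesgue_on ?S)
      + (\<Sum>i\<in>Basis. \<integral>z. v z * dderiv (dderiv \<phi> (i, 0)) (i, 0) z \<partial>lebesgue_on ?S)"
    using i0 i1 by (simp only: Bochner_Integration.integral_add Bochner_Integration.integral_sum
        Bochner_Integration.integrable_sum)
  also have "(\<Sum>i\<in>Basis. \<integral>z. v z * dderiv (dderiv \<phi> (i, 0)) (i, 0) z \<partial>lebesgue_on ?S)
      = - (\<Sum>i\<in>Basis. \<integral>z. (G z \<bullet> i) * dderiv \<phi> (i, 0) z \<partial>lebesgue_on ?S)"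
    unfolding sum_negf[symmetric] by (intro sum.cong refl) (simp add: parts)
  also have "(\<Sum>i\<in>Basis. \<integral>z. (G z \<bullet> i) * dderiv \<phi> (i, 0) z \<partial>lebesgue_on ?S)
      = (\<integral>z. G z \<bullet> space_gradient \<phi> z \<partial>lebesgue_on ?S)"
    unfolding inner_space_gradient
    by (intro Bochner_Integration.integral_sum[symmetric] integrable_in_Lp_times_test in_Lp_inner G D S)
  finally show ?thesis using eq unfolding powr_0_scaleR time_derivative_def by simp
qed

section \<open>Mollification and comparison from above\<close>

text \<open>A correlation with kernel f. The variable z occurs in the smooth factor alone, so each
  derivative falls on f with a factor -1, and f may itself be a derivative of the bump. Fixing K
  keeps the domain of integration independent of z.\<close>

definition mollify :: "('b::euclidean_space) set \<Rightarrow> ('b \<Rightarrow> real) \<Rightarrow> ('b \<Rightarrow> real) \<Rightarrow> 'b \<Rightarrow> real" where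
  "mollify K h f z = integral K (\<lambda>y. h y * f (y - z))"

lemma mollify_has_derivative:
  fixes h :: "'b::euclidean_space \<Rightarrow> real"
  assumes h: "continuous_on (cbox p q) h" and f: "Ck_function 1 f"
  shows "((\<lambda>r. mollify (cbox p q) h f (z + r *\<^sub>R w)) has_field_derivative
     - mollify (cbox p q) h (dderiv f w) (z + r0 *\<^sub>R w)) (at r0)"
proof -
  have D: "(f has_derivative frechet_derivative f (at x)) (at x)" for x
    using f by (simp add: frechet_derivative_works)
  have cD: "continuous_on UNIV (dderiv f w)" and cf: "continuous_on UNIV f"
    using f Ck_function_lower[of 0 f] by auto
  have "((\<lambda>r. integral (cbox p q) (\<lambda>y. h y * f (y - (z + r *\<^sub>R w)))) has_field_derivative
     integral (cbox p q) (\<lambda>y. h y * - dderiv f w (y - (z + r0 *\<^sub>R w)))) (at r0 within UNIV)"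
  proof (rule leibniz_rule_field_derivative)
    fix r y
    have "((\<lambda>r. f (y - (z + r *\<^sub>R w))) has_derivative
       (\<lambda>s. frechet_derivative f (at (y - (z + r *\<^sub>R w))) (- (s *\<^sub>R w)))) (at r within UNIV)"
      by (rule has_derivative_compose[OF _ D]) (rule derivative_eq_intros refl | simp)+
    moreover have "frechet_derivative f (at x) (- (s *\<^sub>R w)) = - dderiv f w x * s" for s x
      using linear_scale[OF has_derivative_linear[OF D]] linear_neg[OF has_derivative_linear[OF D]]
      by (simp add: mult.commute)
    ultimately have "((\<lambda>r. f (y - (z + r *\<^sub>R w))) has_field_derivative - dderiv f w (y - (z + r *\<^sub>R w))) (at r within UNIV)"
      by (elim has_derivative_imp_has_field_derivative) simp
    then show "((\<lambda>r. h y * f (y - (z + r *\<^sub>R w))) has_field_derivative h y * - dderiv f w (y - (z + r *\<^sub>R w))) (at r within UNIV)"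
      by (rule DERIV_cmult)
  next
    show "(\<lambda>y. h y * f (y - (z + r *\<^sub>R w))) integrable_on cbox p q" for r
      by (intro integrable_continuous continuous_intros h continuous_on_compose2[OF cf]) auto
    show "continuous_on (UNIV \<times> cbox p q) (\<lambda>(r, y). h y * - dderiv f w (y - (z + r *\<^sub>R w)))"
      unfolding split_beta
      by (intro continuous_intros continuous_on_compose2[OF cD] continuous_on_compose2[OF h]) auto
  qed auto
  then show ?thesis by (simp add: mollify_def)
qed

text \<open>The bump centred at (x, t) is an admissible test function. Passing a time derivative to
  the kernel costs one minus sign and a second space derivative costs two, so testing h with the
  adjoint operator yields the heat equation for the mollification.\<close>

lemma mollified_caloric:
  fixes x :: "'a::euclidean_space"
  assumes h: "p_parabolic 2 C h" and K: "continuous_on (cbox p q) h" "C \<subseteq> cbox p q"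
    and e: "0 < e" "e < e'" and inside: "cball x e' \<times> {t - e'..t + e'} \<subseteq> C"
  shows "mollify (cbox p q) h (dderiv (bump e) (0, 1)) (x, t)
     + (\<Sum>i\<in>Basis. mollify (cbox p q) h (dderiv (dderiv (bump e) (i, 0)) (i, 0)) (x, t)) = 0"
proof -
  define \<phi> where "\<phi> y = bump e (y - (x, t))" for y
  \<comment> \<open>Slightly larger than the support of \<phi>: the cylinder must lie compactly
    inside C and contain that support compactly.\<close>
  let ?S = "ball x e' \<times> {t - e'<..<t + e'}"
  have cl: "closure ?S = cball x e' \<times> {t - e'..t + e'}" using e by (simp add: closure_Times)
  have "compactly_inside ?S C"
    using inside unfolding compactly_inside_def cl by (auto intro: compact_Times)
  have supp: "{y. \<phi> y \<noteq> 0} \<subseteq> cball (x, t) e"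
  proof
    fix y assume "y \<in> {y. \<phi> y \<noteq> 0}"
    then have "norm (y - (x, t)) < e" using e(1) bump_eq_0_iff[OF e(1), of "y - (x, t)"] by (simp add: \<phi>_def)
    then show "y \<in> cball (x, t) e" by (simp add: dist_norm norm_minus_commute)
  qed
  have "closure {y. \<phi> y \<noteq> 0} \<subseteq> cball (x, t) e" using supp by (rule closure_minimal) simp
  moreover have "cball (x, t) e \<subseteq> ?S"
  proof
    fix y assume "y \<in> cball (x, t) e"
    then have "dist (x, t) y < e'" using e by simp
    then have "dist x (fst y) < e'" "dist t (snd y) < e'"
      using dist_fst_le[of "(x, t)" y] dist_snd_le[of "(x, t)" y] by auto
    then show "y \<in> ?S" by (cases y) (auto simp: dist_real_def)
  qed
  ultimately have "compactly_inside {y. \<phi> y \<noteq> 0} ?S"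
    unfolding compactly_inside_def
    using compact_Int_closed[OF compact_cball closed_closure, of "(x, t)" e "{y. \<phi> y \<noteq> 0}"]
    by (auto simp: Int_absorb1)
  then have \<phi>: "test_function ?S \<phi>"
    unfolding test_function_def \<phi>_def[abs_def] by (intro conjI allI Ck_function_shift Ck_function_bump)
  have d1: "dderiv \<phi> v = (\<lambda>y. dderiv (bump e) v (y - (x, t)))" for v
    unfolding \<phi>_def[abs_def] by (intro ext dderiv_shift[of 0] Ck_function_bump)
  have d2: "dderiv (dderiv \<phi> v) v = (\<lambda>y. dderiv (dderiv (bump e) v) v (y - (x, t)))" for v
    unfolding d1 by (intro ext dderiv_shift[of 0] Ck_function_dderiv Ck_function_bump)
  have S: "?S \<subseteq> cbox p q" "?S \<in> sets lebesgue"
    using inside K(2) cl closure_subset[of ?S] by (blast, simp add: open_Times)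
  have zero: "heat_adjoint \<phi> y = 0" if "y \<notin> ?S" for y
    using that test_function_zero[OF test_function_dderiv[OF \<phi>]]
      test_function_zero[OF test_function_dderiv[OF test_function_dderiv[OF \<phi>]]]
    by (simp add: heat_adjoint_def)
  have cD: "continuous_on UNIV (dderiv (bump e) v)" "continuous_on UNIV (dderiv (dderiv (bump e) v) v)" for v :: "'a \<times> real"
  proof -
    have "Ck_function 0 (dderiv (bump e) v)" "Ck_function 0 (dderiv (dderiv (bump e) v) v)"
      by (intro Ck_function_dderiv Ck_function_bump)+
    then show "continuous_on UNIV (dderiv (bump e) v)" "continuous_on UNIV (dderiv (dderiv (bump e) v) v)"
      by simp_all
  qed
  have cont: "continuous_on (cbox p q) (\<lambda>y. h y * dderiv (bump e) v (y - (x, t)))"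
    "continuous_on (cbox p q) (\<lambda>y. h y * dderiv (dderiv (bump e) v) v (y - (x, t)))" for v
    by (intro continuous_intros K continuous_on_compose2[OF cD(1)] continuous_on_compose2[OF cD(2)]; simp)+
  have adj: "h y * heat_adjoint \<phi> y = h y * dderiv (bump e) (0, 1) (y - (x, t))
      + (\<Sum>i\<in>Basis. h y * dderiv (dderiv (bump e) (i, 0)) (i, 0) (y - (x, t)))" for y
    unfolding heat_adjoint_def distrib_left sum_distrib_left
    by (intro arg_cong2[where f = "(+)"] sum.cong refl arg_cong[where f = "(*) (h y)"]
        fun_cong[OF d1] fun_cong[OF d2])
  have ha: "continuous_on (cbox p q) (\<lambda>y. h y * heat_adjoint \<phi> y)"
    unfolding adj by (intro continuous_on_add continuous_on_sum cont)
  have "0 = (\<integral>z. h z * heat_adjoint \<phi> z \<partial>lebesgue_on ?S)"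
    using p_parabolic_distributional[OF h _ _ \<open>compactly_inside ?S C\<close> \<phi>] e by simp
  also have "\<dots> = (\<integral>z. indicator ?S z *\<^sub>R (h z * heat_adjoint \<phi> z) \<partial>lebesgue)"
    using S(2) by (simp add: integral_restrict_space)
  also have "(\<lambda>z. indicator ?S z *\<^sub>R (h z * heat_adjoint \<phi> z)) = (\<lambda>z. indicator (cbox p q) z *\<^sub>R (h z * heat_adjoint \<phi> z))"
  proof
    fix z show "indicator ?S z *\<^sub>R (h z * heat_adjoint \<phi> z) = indicator (cbox p q) z *\<^sub>R (h z * heat_adjoint \<phi> z)"
      using zero[of z] S(1) by (cases "z \<in> ?S") auto
  qed
  also have "(\<integral>z. indicator (cbox p q) z *\<^sub>R (h z * heat_adjoint \<phi> z) \<partial>lebesgue)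
      = (\<integral>z. indicator (cbox p q) z *\<^sub>R (h z * heat_adjoint \<phi> z) \<partial>lborel)"
    by (intro integral_completion borel_measurable_integrable borel_integrable_compact compact_cbox ha)
  also have "\<dots> = integral (cbox p q) (\<lambda>z. h z * heat_adjoint \<phi> z)"
    using set_borel_integral_eq_integral(2)[of "cbox p q" "\<lambda>z. h z * heat_adjoint \<phi> z"]
      borel_integrable_compact[OF compact_cbox ha]
    by (simp add: set_integrable_def set_lebesgue_integral_def)
  also have "\<dots> = integral (cbox p q) (\<lambda>y. h y * dderiv (bump e) (0, 1) (y - (x, t)))
     + (\<Sum>i\<in>Basis. integral (cbox p q) (\<lambda>y. h y * dderiv (dderiv (bump e) (i, 0)) (i, 0) (y - (x, t))))"
    unfolding adj
    using integrable_continuous[OF cont(1)] integrable_continuous[OF cont(2)]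
    by (simp only: Henstock_Kurzweil_Integration.integral_add Henstock_Kurzweil_Integration.integral_sum
        Henstock_Kurzweil_Integration.integrable_sum finite_Basis)
  finally show ?thesis by (simp add: mollify_def)
qed

text \<open>Subtracting the quadratic leaves a function with a local maximum at 0. If its second
  derivative there were positive, its first derivative would be positive just to the right of 0 and
  the function would increase.\<close>

lemma second_derivative_le:
  fixes g :: "real \<Rightarrow> real"
  assumes g: "\<And>r. (g has_field_derivative g' r) (at r)" and g': "(g' has_field_derivative g2) (at 0)"
    and le: "\<forall>\<^sub>F r in nhds 0. g r \<le> g 0 + \<alpha> * r + \<beta> * r\<^sup>2"
  shows "g2 \<le> 2 * \<beta>"
proof (rule ccontr)
  assume "\<not> ?thesis"
  then have pos: "g2 - 2 * \<beta> > 0" by simp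
  define k where "k r = g r - \<alpha> * r - \<beta> * r\<^sup>2" for r
  have k: "(k has_field_derivative g' r - \<alpha> - 2 * \<beta> * r) (at r)" for r
    unfolding k_def by (rule derivative_eq_intros g refl)+ simp
  obtain \<rho> where \<rho>: "\<rho> > 0" "\<And>r. \<bar>r\<bar> < \<rho> \<Longrightarrow> k r \<le> k 0"
    using le unfolding eventually_nhds_metric by (auto simp: k_def dist_real_def algebra_simps)
  have "g' 0 - \<alpha> - 2 * \<beta> * 0 = 0"
    by (rule DERIV_local_max[OF k \<rho>(1)]) (use \<rho>(2) in auto)
  moreover have "((\<lambda>r. g' r - \<alpha> - 2 * \<beta> * r) has_field_derivative g2 - 2 * \<beta>) (at 0)"
    by (rule derivative_eq_intros g' refl)+ simp
  ultimately obtain \<delta> where \<delta>: "\<delta> > 0" "\<And>r. r > 0 \<Longrightarrow> r < \<delta> \<Longrightarrow> g' r - \<alpha> - 2 * \<beta> * r > 0"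
    using DERIV_pos_inc_right[of "\<lambda>r. g' r - \<alpha> - 2 * \<beta> * r" _ 0] pos by force
  define r where "r = min \<rho> \<delta> / 2"
  have r: "0 < r" "r < \<rho>" "r < \<delta>" using \<rho>(1) \<delta>(1) by (auto simp: r_def)
  obtain s where "0 < s" "s < r" "k r - k 0 = (r - 0) * (g' s - \<alpha> - 2 * \<beta> * s)"
    using MVT2[OF r(1) k] by blast
  moreover have "k r \<le> k 0" using \<rho>(2)[of r] r by simp
  ultimately show False using \<delta>(2)[of s] r by (smt (verit) mult_pos_pos)
qed

text \<open>The maximum is taken over past times only, because it may sit on the last time level
  considered. A one-sided time inequality is enough: it has the direction that contradicts b
  exceeding the Laplacian of the jet.\<close>

lemma jet_at_max:
  fixes w J :: "'a::euclidean_space \<times> real \<Rightarrow> real"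
  assumes jet: "parabolic_jet w (x0, t0) a c d e b"
    and max: "\<forall>\<^sub>F z in nhds (x0, t0). snd z \<le> t0 \<longrightarrow> J z - w z \<le> J (x0, t0) - w (x0, t0)"
    and Jt: "((\<lambda>r. J (x0, t0 + r)) has_field_derivative jt) (at 0)"
    and Jx: "\<And>i r. i \<in> Basis \<Longrightarrow> ((\<lambda>r. J (x0 + r *\<^sub>R i, t0)) has_field_derivative j' i r) (at r)"
    and Jxx: "\<And>i. i \<in> Basis \<Longrightarrow> (j' i has_field_derivative j2 i) (at 0)"
  shows "b \<le> jt" and "(\<Sum>i\<in>Basis. j2 i) \<le> 2 * c * real DIM('a) + 2 * d * (e \<bullet> e)"
proof -
  have bound: "\<forall>\<^sub>F z in nhds (x0, t0). snd z \<le> t0 \<longrightarrow>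
      J z \<le> J (x0, t0) + (quad (x0, t0) 0 a c d e b z + \<eta> * ((norm (fst z - x0))\<^sup>2 + \<bar>snd z - t0\<bar>))" if "\<eta> > 0" for \<eta>
  proof -
    have "\<forall>\<^sub>F z in nhds (x0, t0). \<bar>w z - quad (x0, t0) (w (x0, t0)) a c d e b z\<bar>
        \<le> \<eta> * ((norm (fst z - x0))\<^sup>2 + \<bar>snd z - t0\<bar>)"
      using jet that by (auto simp: parabolic_jet_def)
    with max show ?thesis
      by eventually_elim (auto simp: quad_def abs_le_iff)
  qed
  \<comment> \<open>Only past times are available, so the difference quotient is formed with -r for
    r > 0; dividing by -r turns the upper bound for J into a lower bound for jt.\<close>
  have "b - \<eta> \<le> jt" if "\<eta> > 0" for \<eta>
  proof -
    have "((\<lambda>r. (x0, t0 - r)) \<longlongrightarrow> (x0, t0 - 0)) (at_right (0::real))" by (intro tendsto_intros)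
    from eventually_compose_filterlim[OF bound[OF that] this[simplified]]
    have "\<forall>\<^sub>F r in at_right 0. J (x0, t0 - r) \<le> J (x0, t0) + (- b * r + \<eta> * r)"
      using eventually_at_right_less[of "0::real"]
      by eventually_elim (simp add: quad_def)
    then have ev: "\<forall>\<^sub>F r in at_right 0. (J (x0, t0 + - r) - J (x0, t0)) / - r \<ge> b - \<eta>"
      using eventually_at_right_less[of "0::real"]
      by eventually_elim (simp add: field_simps)
    have "((\<lambda>h. (J (x0, t0 + (0 + h)) - J (x0, t0 + 0)) / h) \<longlongrightarrow> jt) (at 0)"
      using Jt by (simp add: DERIV_def)
    moreover have "filterlim (\<lambda>r::real. - r) (at 0) (at_right 0)"
      by (auto simp: filterlim_at eventually_at_filter intro!: tendsto_eq_intros)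
    ultimately have "((\<lambda>r. (J (x0, t0 + - r) - J (x0, t0)) / - r) \<longlongrightarrow> jt) (at_right 0)"
      using filterlim_compose[of "\<lambda>h. (J (x0, t0 + (0 + h)) - J (x0, t0 + 0)) / h" "nhds jt" "at 0" "\<lambda>r. - r" "at_right 0"]
      by simp
    from tendsto_lowerbound[OF this ev] show ?thesis by simp
  qed
  then show "b \<le> jt" by (metis diff_le_eq field_le_epsilon)
  \<comment> \<open>Pure second derivatives along the basis suffice, as they sum to the Laplacian
    and the squares (e \<bullet> i)^2 add up to e \<bullet> e.\<close>
  have j2: "j2 i \<le> 2 * (c + d * (e \<bullet> i)\<^sup>2 + \<eta>)" if "\<eta> > 0" "i \<in> Basis" for \<eta> i
  proof (rule second_derivative_le[OF Jx Jxx, OF that(2) that(2)])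
    have "isCont (\<lambda>r::real. (x0 + r *\<^sub>R i, t0)) 0" by (intro continuous_intros)
    then have "((\<lambda>r. (x0 + r *\<^sub>R i, t0)) \<longlongrightarrow> (x0, t0)) (nhds (0::real))"
      using tendsto_at_iff_tendsto_nhds[of "\<lambda>r::real. (x0 + r *\<^sub>R i, t0)" 0] by (simp add: isCont_def)
    then have "\<forall>\<^sub>F r in nhds 0. J (x0 + r *\<^sub>R i, t0) \<le> J (x0, t0) + (quad (x0, t0) 0 a c d e b (x0 + r *\<^sub>R i, t0) + \<eta> * (norm (r *\<^sub>R i))\<^sup>2)"
      using eventually_compose_filterlim[OF bound[OF that(1)], of "\<lambda>r. (x0 + r *\<^sub>R i, t0)"] by simp
    then show "\<forall>\<^sub>F r in nhds 0. J (x0 + r *\<^sub>R i, t0) \<le> J (x0 + 0 *\<^sub>R i, t0) + (a \<bullet> i) * r + (c + d * (e \<bullet> i)\<^sup>2 + \<eta>) * r\<^sup>2"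
      by eventually_elim (use that in \<open>simp add: quad_def algebra_simps power_mult_distrib\<close>)
  qed
  have "(\<Sum>i\<in>Basis. j2 i) \<le> 2 * c * real DIM('a) + 2 * d * (e \<bullet> e) + \<eta>" if "\<eta> > 0" for \<eta>
  proof -
    define \<eta>' where "\<eta>' = \<eta> / (2 * real DIM('a))"
    have "\<eta>' > 0" using that by (simp add: \<eta>'_def)
    then have "(\<Sum>i\<in>Basis. j2 i) \<le> (\<Sum>i\<in>Basis. 2 * (c + d * (e \<bullet> i)\<^sup>2 + \<eta>'))"
      by (intro sum_mono j2)
    also have "\<dots> = 2 * c * real DIM('a) + 2 * d * (e \<bullet> e) + 2 * \<eta>' * real DIM('a)"
    proof -
      have "(\<Sum>i\<in>Basis. (e \<bullet> i)\<^sup>2) = e \<bullet> e"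
        by (simp only: power2_eq_square sum_Basis_inner_square)
      then show ?thesis by (simp add: sum.distrib distrib_left flip: sum_distrib_left)
    qed
    also have "2 * \<eta>' * real DIM('a) = \<eta>" by (simp add: \<eta>'_def)
    finally show ?thesis .
  qed
  then show "(\<Sum>i\<in>Basis. j2 i) \<le> 2 * c * real DIM('a) + 2 * d * (e \<bullet> e)" by (rule field_le_epsilon)
qed

section \<open>Mass of the bump and uniform approximation by mollification\<close>

definition bump_mass :: "'b::euclidean_space itself \<Rightarrow> real \<Rightarrow> real" where
  "bump_mass _ e = (\<integral>x. bump e (x::'b) \<partial>lborel)"

lemma continuous_on_bump: "continuous_on S (bump e :: 'b::euclidean_space \<Rightarrow> real)"
  using Ck_function_bump[of 0 e] by (auto intro: continuous_on_subset)

lemma continuous_on_bump_shift: "continuous_on S (\<lambda>y. bump e (y - z) :: real)" for z :: "'b::euclidean_space"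
  using Ck_function_shift[OF Ck_function_bump, of 0 e z] by (auto intro: continuous_on_subset)

lemma bump_support: "e > 0 \<Longrightarrow> {y. bump e (y - z) \<noteq> 0} \<subseteq> cball z e"
proof
  fix y assume "e > 0" "y \<in> {y. bump e (y - z) \<noteq> 0}"
  then have "norm (y - z) < e" using bump_eq_0_iff[of e "y - z"] by simp
  then show "y \<in> cball z e" by (simp add: dist_norm norm_minus_commute)
qed

lemma integral_bump:
  fixes z :: "'b::euclidean_space"
  assumes "e > 0" "cball z e \<subseteq> cbox p q"
  shows "integral (cbox p q) (\<lambda>y. bump e (y - z)) = bump_mass TYPE('b) e"
proof -
  have c: "continuous_on UNIV (\<lambda>y. bump e (y - z))"
    by (rule continuous_on_bump_shift)
  have "integral (cbox p q) (\<lambda>y. bump e (y - z)) = (\<integral>y. bump e (y - z) \<partial>lborel)"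
    by (rule continuous_supported(2)[OF c, symmetric])
      (rule subset_trans[OF bump_support[OF assms(1)] assms(2)])
  also have "\<dots> = bump_mass TYPE('b) e"
    using lborel_integral_shift[OF borel_measurable_continuous_onI[OF continuous_on_bump], of e "- z"]
    by (simp add: bump_mass_def)
  finally show ?thesis .
qed

lemma bump_mass_pos:
  assumes "e > 0" shows "bump_mass TYPE('b::euclidean_space) e > 0"
proof -
  obtain p q where pq: "cball (0::'b) e \<subseteq> cbox p q" using bounded_subset_cboxE[OF bounded_cball] .
  have I: "integral (cbox p q) (bump e) = bump_mass TYPE('b) e"
    using integral_bump[OF assms pq] by simp
  have int: "(bump e :: 'b \<Rightarrow> real) integrable_on cbox p q"
    by (intro integrable_continuous continuous_on_bump)
  have "bump_mass TYPE('b) e \<ge> 0"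
    unfolding I[symmetric] by (intro Henstock_Kurzweil_Integration.integral_nonneg int bump_nonneg)
  moreover have "bump_mass TYPE('b) e \<noteq> 0"
  proof
    assume "bump_mass TYPE('b) e = 0"
    then have "((bump e :: 'b \<Rightarrow> real) has_integral 0) (cbox p q)"
      using I int by (metis integrable_integral)
    moreover have "ball (0::'b) e \<subseteq> interior (cbox p q)"
      using pq by (intro interior_maximal) (auto intro: subset_trans[OF ball_subset_cball])
    then have "box p q \<noteq> {}" using assms by (auto simp: interior_cbox)
    moreover have "(0::'b) \<in> cbox p q" using pq assms by auto
    ultimately have "bump e (0::'b) = 0"
      by (intro has_integral_0_cbox_imp_0[of p q "bump e"] continuous_on_bump bump_nonneg)
    then show False using assms bump_eq_0_iff[of e "0::'b"] by simp
  qed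
  ultimately show ?thesis by simp
qed

text \<open>After division by the mass the mollification is a weighted mean of h over the ball, so
  it misses h(z) by at most the oscillation there.\<close>

lemma mollify_approx:
  fixes h :: "'b::euclidean_space \<Rightarrow> real"
  assumes h: "continuous_on (cbox p q) h" and e: "e > 0" "cball z e \<subseteq> cbox p q"
    and osc: "\<And>y. y \<in> cball z e \<Longrightarrow> \<bar>h y - h z\<bar> \<le> \<kappa>"
  shows "\<bar>mollify (cbox p q) h (bump e) z / bump_mass TYPE('b) e - h z\<bar> \<le> \<kappa>"
proof -
  have c: "continuous_on (cbox p q) (\<lambda>y. bump e (y - z))"
    by (rule continuous_on_bump_shift)
  note N = bump_mass_pos[OF e(1), where ?'b = 'b]
  have "mollify (cbox p q) h (bump e) z - h z * bump_mass TYPE('b) e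
      = integral (cbox p q) (\<lambda>y. h y * bump e (y - z)) - integral (cbox p q) (\<lambda>y. h z * bump e (y - z))"
    by (simp add: mollify_def integral_bump[OF e])
  also have "\<dots> = integral (cbox p q) (\<lambda>y. h y * bump e (y - z) - h z * bump e (y - z))"
    by (intro Henstock_Kurzweil_Integration.integral_diff[symmetric] integrable_continuous continuous_intros h c)
  finally have "\<bar>mollify (cbox p q) h (bump e) z - h z * bump_mass TYPE('b) e\<bar>
      = norm (integral (cbox p q) (\<lambda>y. h y * bump e (y - z) - h z * bump e (y - z)))" by simp
  also have "\<dots> \<le> integral (cbox p q) (\<lambda>y. \<kappa> * bump e (y - z))"
  proof (rule Henstock_Kurzweil_Integration.integral_norm_bound_integral)
    fix y
    show "norm (h y * bump e (y - z) - h z * bump e (y - z)) \<le> \<kappa> * bump e (y - z)"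
    proof (cases "bump e (y - z) = 0")
      case False
      then have "\<bar>h y - h z\<bar> \<le> \<kappa>" using bump_support[OF e(1), of z] by (intro osc) auto
      then have "\<bar>h y - h z\<bar> * bump e (y - z) \<le> \<kappa> * bump e (y - z)"
        using bump_nonneg by (rule mult_right_mono)
      then show ?thesis
        using bump_nonneg[of e "y - z"] by (simp add: abs_mult flip: left_diff_distrib)
    qed simp
  qed (intro integrable_continuous continuous_intros h c)+
  also have "\<dots> = \<kappa> * bump_mass TYPE('b) e" by (simp add: integral_bump[OF e])
  finally have *: "\<bar>mollify (cbox p q) h (bump e) z - h z * bump_mass TYPE('b) e\<bar> \<le> \<kappa> * bump_mass TYPE('b) e" .
  have "mollify (cbox p q) h (bump e) z / bump_mass TYPE('b) e - h z
     = (mollify (cbox p q) h (bump e) z - h z * bump_mass TYPE('b) e) / bump_mass TYPE('b) e"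
    using N by (simp add: field_simps)
  then show ?thesis using * N by (simp add: abs_divide pos_divide_le_eq)
qed

lemma continuous_on_mollify:
  assumes "continuous_on (cbox p q) h"
  shows "continuous_on S (mollify (cbox p q) h (bump e))"
  unfolding mollify_def[abs_def]
proof (rule integral_continuous_on_param)
  show "continuous_on (S \<times> cbox p q) (\<lambda>(z, y). h y * bump e (y - z))"
    unfolding split_beta
    by (intro continuous_intros continuous_on_compose2[OF continuous_on_bump[of UNIV]]
        continuous_on_compose2[OF assms]) auto
qed

lemma strict_supersolution_continuous:
  "strict_supersolution_at w z \<Longrightarrow> isCont w z"
  unfolding strict_supersolution_at_def using parabolic_jet_continuous by blast

text \<open>With no classical derivatives of h at hand, the maximum has to be taken of J - w, with J
  the mollification of h. The work lies in forcing this maximum to a point near which J is defined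
  by interior values and is caloric.\<close>

lemma parabolic_le_supersolution:
  fixes A B :: "'a::euclidean_space" and t1 t2 :: real
  defines "C \<equiv> box A B \<times> {t1<..<t2}"
  assumes t: "t1 < t2" and inside: "compactly_inside C \<Omega>" and h: "p_parabolic 2 C h"
    and hc: "continuous_on (closure C) h"
    and le: "\<And>z. z \<in> parabolic_boundary (box A B) t1 t2 \<Longrightarrow> h z \<le> w z"
    and w: "\<And>z. z \<in> \<Omega> \<Longrightarrow> strict_supersolution_at w z" and z1: "z1 \<in> C"
  shows "h z1 \<le> w z1"
proof (rule ccontr)
  assume "\<not> ?thesis"
  define \<mu> where "\<mu> = h z1 - w z1"
  have \<mu>: "\<mu> > 0" using \<open>\<not> h z1 \<le> w z1\<close> by (simp add: \<mu>_def)
  define K where "K = cbox (A, t1) (B, t2)"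
  have ne: "box A B \<noteq> {}" using z1 by (auto simp: C_def)
  have Keq: "K = cbox A B \<times> {t1..t2}" unfolding K_def by (simp add: cbox_Pair_eq)
  have clC: "closure C = K"
    unfolding C_def Keq using closure_box[OF ne] t by (simp add: closure_Times)
  have CK: "C \<subseteq> K" using closure_subset[of C] clC by simp
  have oC: "open C" unfolding C_def by (intro open_Times) auto
  have hK: "continuous_on K h" using hc clC by simp
  have K\<Omega>: "K \<subseteq> \<Omega>" using inside clC by (simp add: compactly_inside_def)
  have wK: "continuous_on K w"
    using K\<Omega> w by (auto intro!: continuous_at_imp_continuous_on strict_supersolution_continuous)
  \<comment> \<open>Times after that of z1 are cut off: nothing is known about h - w on the top
    face, which is not part of the parabolic boundary. As s1 < t2, the set \<open>M\<close> avoids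
    that face.\<close>
  define s1 where "s1 = snd z1"
  \<comment> \<open>\<open>M\<close> stays away from the parabolic boundary, so \<open>h\<close> can be mollified near \<open>M\<close>.\<close>
  define M where "M = {z \<in> K \<inter> UNIV \<times> {..s1}. \<mu> / 2 \<le> h z - w z}"
  have cl: "closed (K \<inter> (UNIV \<times> {..s1}))" unfolding K_def by (intro closed_Int closed_Times) auto
  have "closed M" unfolding M_def
    by (intro continuous_on_closed_Collect_le cl continuous_on_const continuous_on_diff
        continuous_on_subset[OF hK] continuous_on_subset[OF wK] Int_lower1)
  then have cM: "compact M"
    using compact_Int_closed[OF compact_cbox, of M "(A, t1)" "(B, t2)"]
    by (simp add: K_def[symmetric] Int_absorb1 M_def subset_iff)
  have z1M: "z1 \<in> M" using z1 CK \<mu> by (auto simp: M_def s1_def \<mu>_def mem_Times_iff)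
  have "M \<subseteq> C"
  proof
    fix z assume z: "z \<in> M"
    obtain x t where xt: "z = (x, t)" by (cases z)
    have zz: "x \<in> cbox A B" "t1 \<le> t" "t \<le> s1" "h z > w z"
      using z \<mu> unfolding M_def Keq xt by auto
    have "s1 < t2" using z1 by (auto simp: s1_def C_def)
    have np: "z \<notin> parabolic_boundary (box A B) t1 t2" using le[of z] zz(4) by auto
    have "t \<noteq> t1" using np zz(1) closure_box[OF ne] by (auto simp: parabolic_boundary_def xt)
    then have "t1 < t" using zz(2) by simp
    moreover have "x \<in> box A B"
      using np zz \<open>t1 < t\<close> \<open>s1 < t2\<close> ne by (auto simp: parabolic_boundary_def xt frontier_box)
    ultimately show "z \<in> C" using zz(3) \<open>s1 < t2\<close> by (simp add: C_def xt)
  qed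
  obtain e1 where e1: "e1 > 0" "(\<Union>z\<in>M. cball z e1) \<subseteq> C"
    using compact_subset_open_imp_cball_epsilon_subset[OF cM oC \<open>M \<subseteq> C\<close>] .
  have "uniformly_continuous_on K h"
    using hK unfolding K_def by (intro compact_uniformly_continuous) auto
  then obtain \<delta> where \<delta>: "\<delta> > 0" "\<And>y z. y \<in> K \<Longrightarrow> z \<in> K \<Longrightarrow> dist y z < \<delta> \<Longrightarrow> dist (h y) (h z) < \<mu> / 8"
    unfolding uniformly_continuous_on_def using \<mu> by (metis divide_pos_pos zero_less_numeral)
  \<comment> \<open>Small enough for three uses: h varies by less than \<mu>/8 from the centre of a
    ball of radius e, such balls about points within e1/2 of \<open>M\<close> stay in
    \<open>K\<close>, and e < e1/4 leaves the room that \<open>mollified_caloric\<close>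
    requires.\<close>
  define e where "e = min \<delta> e1 / 8"
  have e: "e > 0" "e < \<delta>" "e \<le> e1 / 8" using \<delta>(1) e1(1) by (auto simp: e_def)
  define N where "N = bump_mass TYPE('a \<times> real) e"
  have N: "N > 0" unfolding N_def using e(1) by (rule bump_mass_pos)
  define J where "J z = mollify K h (bump e) z / N" for z
  have approx: "\<bar>J z - h z\<bar> \<le> \<mu> / 8" if "z0 \<in> M" "dist z0 z < e1 / 2" for z z0
  proof -
    have sub: "cball z e \<subseteq> K"
    proof
      fix y assume "y \<in> cball z e"
      then have "dist z0 y \<le> e1"
        using dist_triangle[of z0 y z] that(2) e(1,3) e1(1) by (simp add: dist_commute)
      then have "y \<in> cball z0 e1" by simp
      then show "y \<in> K" using e1(2) that(1) CK by blast
    qed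
    moreover have "\<bar>h y - h z\<bar> \<le> \<mu> / 8" if "y \<in> cball z e" for y
    proof -
      have "y \<in> K" "z \<in> K" using sub that e(1) by auto
      moreover have "dist y z < \<delta>" using that e(2) by (simp add: dist_commute)
      ultimately show ?thesis using \<delta>(2)[of y z] by (simp add: dist_real_def)
    qed
    ultimately show ?thesis
      unfolding J_def N_def K_def by (intro mollify_approx hK[unfolded K_def] e(1)) auto
  qed
  have "continuous_on M (\<lambda>z. J z - w z)"
    unfolding J_def K_def using N \<open>M \<subseteq> C\<close> CK
    by (intro continuous_intros continuous_on_mollify hK[unfolded K_def] continuous_on_subset[OF wK]) auto
  then obtain z0 where z0: "z0 \<in> M" "\<And>z. z \<in> M \<Longrightarrow> J z - w z \<le> J z0 - w z0"
    using continuous_attains_sup[OF cM, of "\<lambda>z. J z - w z"] z1M by blast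
  obtain x0 t0 where xt0: "z0 = (x0, t0)" by (cases z0)
  obtain a c d v b where jet: "parabolic_jet w z0 a c d v b" and b: "b > 2 * c * real DIM('a) + 2 * d * (v \<bullet> v)"
    using w[of z0] z0(1) \<open>M \<subseteq> C\<close> CK K\<Omega> unfolding strict_supersolution_at_def by blast
  \<comment> \<open>A nearby past point outside \<open>M\<close> has h - w < \<mu>/2, hence J - w <
    5\<mu>/8. At z1 one has J - w \<ge> 7\<mu>/8, and z0 is at least as good. So the maximum over
    \<open>M\<close> is a local maximum among all past points.\<close>
  have "J z - w z \<le> J z0 - w z0" if z: "dist z z0 < e1 / 2" "snd z \<le> t0" for z
  proof (cases "z \<in> M")
    case False
    have "z \<in> cball z0 e1" using e1(1) z(1) by (simp add: dist_commute)
    then have "z \<in> K" using e1(2) z0(1) CK by blast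
    moreover have "t0 \<le> s1" using z0(1) by (simp add: M_def xt0)
    ultimately have "h z - w z < \<mu> / 2" using False z(2) by (cases z) (auto simp: M_def)
    moreover have "\<bar>J z - h z\<bar> \<le> \<mu> / 8" using approx[OF z0(1)] z(1) by (simp add: dist_commute)
    moreover have "\<bar>J z1 - h z1\<bar> \<le> \<mu> / 8" using approx[OF z1M, of z1] e1(1) by simp
    moreover have "J z1 - w z1 \<le> J z0 - w z0" by (rule z0(2)[OF z1M])
    ultimately show ?thesis using \<mu> unfolding \<mu>_def abs_le_iff by argo
  qed (rule z0(2))
  then have max: "\<forall>\<^sub>F z in nhds (x0, t0). snd z \<le> t0 \<longrightarrow> J z - w z \<le> J (x0, t0) - w (x0, t0)"
    unfolding eventually_nhds_metric xt0 using e1(1) by (intro exI[of _ "e1 / 2"]) auto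
  have Ck1: "Ck_function 1 (dderiv (bump e) v)" "Ck_function 1 (bump e)" for v :: "'a \<times> real"
    using Ck_function_dderiv[OF Ck_function_bump, of 1 e v] Ck_function_bump[of 1 e] by auto
  define jt where "jt = - mollify K h (dderiv (bump e) (0, 1)) z0 / N"
  define j' where "j' i r = - mollify K h (dderiv (bump e) (i, 0)) (z0 + r *\<^sub>R (i, 0)) / N" for i :: 'a and r
  define j2 where "j2 i = mollify K h (dderiv (dderiv (bump e) (i, 0)) (i, 0)) z0 / N" for i :: 'a
  have Jt: "((\<lambda>r. J (x0, t0 + r)) has_field_derivative jt) (at 0)"
    using DERIV_cdivide[OF mollify_has_derivative[OF hK[unfolded K_def] Ck1(2), of z0 "(0, 1)" 0], of N]
    by (simp add: J_def jt_def xt0 K_def)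
  have Jx: "((\<lambda>r. J (x0 + r *\<^sub>R i, t0)) has_field_derivative j' i r) (at r)" for i r
    using DERIV_cdivide[OF mollify_has_derivative[OF hK[unfolded K_def] Ck1(2), of z0 "(i, 0)" r], of N]
    by (simp add: J_def j'_def xt0 K_def)
  have Jxx: "(j' i has_field_derivative j2 i) (at 0)" for i
    using DERIV_cdivide[OF DERIV_minus[OF mollify_has_derivative[OF hK[unfolded K_def] Ck1(1)[of "(i, 0)"], of z0 "(i, 0)" 0]], of N]
    by (simp add: j'_def[abs_def] j2_def K_def xt0)
  note m = jet_at_max[OF jet[unfolded xt0] max Jt Jx Jxx]
  have "cball x0 (e1 / 4) \<times> {t0 - e1 / 4..t0 + e1 / 4} \<subseteq> C"
  proof
    fix y assume "y \<in> cball x0 (e1 / 4) \<times> {t0 - e1 / 4..t0 + e1 / 4}"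
    then have "fst y \<in> cball x0 (e1 / 4)" "t0 - e1 / 4 \<le> snd y" "snd y \<le> t0 + e1 / 4"
      by (simp_all add: mem_Times_iff)
    then have "norm (fst y - x0) \<le> e1 / 4" "norm (snd y - t0) \<le> e1 / 4"
      unfolding mem_cball dist_norm real_norm_def by (simp add: norm_minus_commute, linarith)
    moreover have "norm (y - z0) \<le> norm (fst y - x0) + norm (snd y - t0)"
      using norm_Pair_le[of "fst y - x0" "snd y - t0"] by (cases y) (simp add: xt0)
    ultimately have "y \<in> cball z0 e1" using e1(1) by (simp add: dist_norm norm_minus_commute)
    then show "y \<in> C" using e1(2) z0(1) by blast
  qed
  moreover have "e < e1 / 4" using e(1,3) e1(1) by linarith
  ultimately have "mollify K h (dderiv (bump e) (0, 1)) z0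
     + (\<Sum>i\<in>Basis. mollify K h (dderiv (dderiv (bump e) (i, 0)) (i, 0)) z0) = 0"
    unfolding K_def xt0 using mollified_caloric[OF h hK[unfolded K_def] CK[unfolded K_def] e(1)] by blast
  then have "jt = (\<Sum>i\<in>Basis. j2 i)"
    unfolding jt_def j2_def sum_divide_distrib[symmetric]
    by (intro arg_cong[where f = "\<lambda>x. x / N"]) linarith
  then show False using m b by linarith
qed

lemma supersolution_superparabolic:
  fixes \<Omega> :: "('a::euclidean_space \<times> real) set"
  assumes w: "\<And>z. z \<in> \<Omega> \<Longrightarrow> strict_supersolution_at w z"
  shows "p_superparabolic 2 \<Omega> (\<lambda>z. ereal (w z))"
  unfolding p_superparabolic_def
proof (intro conjI allI impI ballI)
  show "lower_semicontinuous_on \<Omega> (\<lambda>z. ereal (w z))"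
    unfolding lower_semicontinuous_on_def
  proof
    fix z assume "z \<in> \<Omega>"
    then have "(w \<longlongrightarrow> w z) (at z within \<Omega>)"
      using strict_supersolution_continuous[OF w, of z] unfolding isCont_def
      by (blast intro: tendsto_within_subset)
    then have lim: "((\<lambda>z. ereal (w z)) \<longlongrightarrow> ereal (w z)) (at z within \<Omega>)" by simp
    show "ereal (w z) \<le> Liminf (at z within \<Omega>) (\<lambda>z. ereal (w z))"
    proof (cases "at z within \<Omega> = bot")
      case False
      from lim_imp_Liminf[OF this lim] show ?thesis by simp
    qed simp
  qed
  show "\<Omega> \<subseteq> closure {z \<in> \<Omega>. ereal (w z) \<noteq> \<infinity>}" using closure_subset by simp
next
  fix A B t1 t2 h z
  assume "t1 < t2 \<and> compactly_inside (box A B \<times> {t1<..<t2}) \<Omega> \<and>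
        p_parabolic 2 (box A B \<times> {t1<..<t2}) h \<and> continuous_on (closure (box A B \<times> {t1<..<t2})) h \<and>
        (\<forall>z\<in>parabolic_boundary (box A B) t1 t2. ereal (h z) \<le> ereal (w z))"
    and "z \<in> box A B \<times> {t1<..<t2}"
  then show "ereal (h z) \<le> ereal (w z)"
    using parabolic_le_supersolution[of t1 t2 A B \<Omega> h w z] w by simp
qed simp

section \<open>Barriers and criteria for regularity\<close>

text \<open>The Perron solution is trapped: f(z0) + \<epsilon> + k w belongs to the upper class, and
  every member of that class lies above f(z0) - \<epsilon> - k w by comparison from below. Nothing
  else about the Perron solution has to be known.\<close>

lemma regular_point_if_barrier:
  fixes \<Omega> :: "('a::euclidean_space \<times> real) set"
  assumes \<Omega>: "open \<Omega>" "bounded \<Omega>" and z0: "z0 \<in> frontier \<Omega>"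
    and w: "\<And>z. z \<in> \<Omega> \<Longrightarrow> strict_supersolution_at w z"
    and pos: "\<And>z. z \<in> \<Omega> \<Longrightarrow> w z > 0"
    and lim: "(w \<longlongrightarrow> 0) (at z0 within \<Omega>)"
    and away: "\<And>\<delta>. \<delta> > 0 \<Longrightarrow> \<exists>m>0. \<forall>z\<in>\<Omega>. dist z z0 \<ge> \<delta> \<longrightarrow> w z \<ge> m"
  shows "regular_point 2 \<Omega> z0"
  unfolding regular_point_def
proof (intro conjI z0 allI impI)
  fix f :: "'a \<times> real \<Rightarrow> real" assume f: "continuous_on (frontier \<Omega>) f"
  have "bounded (f ` frontier \<Omega>)"
    by (intro compact_imp_bounded compact_continuous_image f compact_frontier_bounded[OF \<Omega>(2)])
  then obtain B where B: "\<And>\<xi>. \<xi> \<in> frontier \<Omega> \<Longrightarrow> \<bar>f \<xi>\<bar> \<le> B" by (auto simp: bounded_iff)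
  have B0: "B \<ge> 0" using B[OF z0] by linarith
  have main: "\<exists>k>0. \<forall>z\<in>\<Omega>. ereal (f z0 - \<epsilon> - k * w z) \<le> upper_Perron 2 \<Omega> f z
      \<and> upper_Perron 2 \<Omega> f z \<le> ereal (f z0 + \<epsilon> + k * w z)" if \<epsilon>: "\<epsilon> > 0" for \<epsilon>
  proof -
    obtain \<delta> where \<delta>: "\<delta> > 0" "\<And>\<xi>. \<xi> \<in> frontier \<Omega> \<Longrightarrow> dist \<xi> z0 < \<delta> \<Longrightarrow> \<bar>f \<xi> - f z0\<bar> < \<epsilon>"
      using f[unfolded continuous_on_iff dist_real_def, rule_format, OF z0 \<epsilon>] by blast
    obtain m where m: "m > 0" "\<And>z. z \<in> \<Omega> \<Longrightarrow> dist z z0 \<ge> \<delta> / 2 \<Longrightarrow> w z \<ge> m"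
      using away[of "\<delta> / 2"] \<delta>(1) by auto
    \<comment> \<open>Away from z0 the barrier is at least m, so k w exceeds 2 B, which bounds the
      oscillation of f.\<close>
    define k where "k = (2 * B + 1) / m"
    have k: "k > 0" using m(1) B0 by (simp add: k_def)
    have near: "\<forall>\<^sub>F z in at \<xi> within \<Omega>. f \<xi> \<le> f z0 + \<epsilon> + k * w z \<and> f z0 - \<epsilon> - k * w z \<le> f \<xi>"
      if \<xi>: "\<xi> \<in> frontier \<Omega>" for \<xi>
    proof (cases "dist \<xi> z0 < \<delta>")
      case True
      have "\<forall>\<^sub>F z in at \<xi> within \<Omega>. z \<in> \<Omega>" by (simp add: eventually_at_filter)
      then show ?thesis
      proof eventually_elim
        case (elim z)
        have "k * w z > 0" using k pos[OF elim] by simp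
        then show ?case using \<delta>(2)[OF \<xi> True] by (auto simp: abs_less_iff)
      qed
    next
      case False
      have "\<forall>\<^sub>F z in at \<xi> within \<Omega>. z \<in> \<Omega>" by (simp add: eventually_at_filter)
      moreover have "\<forall>\<^sub>F z in at \<xi> within \<Omega>. dist z \<xi> < \<delta> / 2"
        unfolding eventually_at using \<delta>(1) by (intro exI[of _ "\<delta> / 2"]) auto
      ultimately show ?thesis
      proof eventually_elim
        case (elim z)
        then have "dist z z0 \<ge> \<delta> / 2" using dist_triangle[of \<xi> z0 z] False by (simp add: dist_commute)
        then have "w z \<ge> m" using m(2) elim(1) by simp
        then have "k * m \<le> k * w z" using k by (intro mult_left_mono) auto
        moreover have "k * m = 2 * B + 1" using m(1) by (simp add: k_def)
        ultimately show ?case using B[OF \<xi>] B[OF z0] \<epsilon> by (auto simp: abs_le_iff)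
      qed
    qed
    have "upper_Perron 2 \<Omega> f z \<le> ereal (k * w z + (f z0 + \<epsilon>))" if "z \<in> \<Omega>" for z
      unfolding upper_Perron_def
    proof (rule INF_lower)
      have "ereal (f \<xi>) \<le> Liminf (at \<xi> within \<Omega>) (\<lambda>z. ereal (k * w z + (f z0 + \<epsilon>)))" if "\<xi> \<in> frontier \<Omega>" for \<xi>
        by (rule Liminf_bounded, use near[OF that] in eventually_elim) simp
      then show "(\<lambda>z. ereal (k * w z + (f z0 + \<epsilon>))) \<in> upper_class 2 \<Omega> f"
        unfolding upper_class_def
        using supersolution_superparabolic[OF strict_supersolution_at_affine[OF w k]] by blast
    qed
    moreover have "ereal (- (k * w z + (- (f z0 - \<epsilon>)))) \<le> upper_Perron 2 \<Omega> f z" if "z \<in> \<Omega>" for z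
      unfolding upper_Perron_def
    proof (rule INF_greatest)
      fix u assume u: "u \<in> upper_class 2 \<Omega> f"
      show "ereal (- (k * w z + (- (f z0 - \<epsilon>)))) \<le> u z"
      proof (rule superparabolic_ge_subsolution[OF _ \<Omega> strict_supersolution_at_affine[OF w k] _ \<open>z \<in> \<Omega>\<close>])
        show "p_superparabolic 2 \<Omega> u" using u by (simp add: upper_class_def)
        fix \<xi> \<kappa> :: "'a \<times> real" and \<kappa>' :: real
        assume \<xi>: "\<xi> \<in> frontier \<Omega>" and "\<kappa>' > 0"
        then have "ereal (f \<xi> - \<kappa>') < Liminf (at \<xi> within \<Omega>) u"
          using u by (auto simp: upper_class_def intro: less_le_trans[of _ "ereal (f \<xi>)"])
        from less_LiminfD[OF this] near[OF \<xi>]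
        show "\<forall>\<^sub>F z in at \<xi> within \<Omega>. ereal (- (k * w z + (- (f z0 - \<epsilon>))) - \<kappa>') \<le> u z"
        proof eventually_elim
          case (elim z)
          then have "ereal (- (k * w z + (- (f z0 - \<epsilon>))) - \<kappa>') \<le> ereal (f \<xi> - \<kappa>')" by simp
          with elim(1) show ?case by (meson less_imp_le order_trans)
        qed
      qed
    qed
    ultimately show ?thesis using k by (intro exI[of _ k]) (simp add: algebra_simps)
  qed
  show "(upper_Perron 2 \<Omega> f \<longlongrightarrow> ereal (f z0)) (at z0 within \<Omega>)"
  proof (rule order_tendstoI)
    fix a assume a: "a < ereal (f z0)"
    then obtain a' where a': "a < ereal a'" "a' < f z0" using ereal_dense2[OF a] by auto
    define \<epsilon> where "\<epsilon> = (f z0 - a') / 2"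
    have \<epsilon>: "\<epsilon> > 0" using a'(2) by (simp add: \<epsilon>_def)
    obtain k where k: "k > 0" "\<And>z. z \<in> \<Omega> \<Longrightarrow> ereal (f z0 - \<epsilon> - k * w z) \<le> upper_Perron 2 \<Omega> f z"
      using main[OF \<epsilon>] by blast
    have "\<forall>\<^sub>F z in at z0 within \<Omega>. w z < \<epsilon> / k" using lim k(1) \<epsilon> by (intro order_tendstoD) auto
    moreover have "\<forall>\<^sub>F z in at z0 within \<Omega>. z \<in> \<Omega>" by (simp add: eventually_at_filter)
    ultimately show "\<forall>\<^sub>F z in at z0 within \<Omega>. a < upper_Perron 2 \<Omega> f z"
    proof eventually_elim
      case (elim z)
      have "k * w z < \<epsilon>" using elim(1) k(1) by (simp add: pos_less_divide_eq mult.commute)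
      then have "a' \<le> f z0 - \<epsilon> - k * w z" by (simp add: \<epsilon>_def field_simps)
      then have "ereal a' \<le> upper_Perron 2 \<Omega> f z" using k(2)[OF elim(2)] by (meson ereal_less_eq(3) order_trans)
      with a'(1) show ?case by (rule less_le_trans)
    qed
  next
    fix a assume a: "a > ereal (f z0)"
    then obtain a' where a': "a > ereal a'" "a' > f z0" using ereal_dense2[OF a] by auto
    define \<epsilon> where "\<epsilon> = (a' - f z0) / 2"
    have \<epsilon>: "\<epsilon> > 0" using a'(2) by (simp add: \<epsilon>_def)
    obtain k where k: "k > 0" "\<And>z. z \<in> \<Omega> \<Longrightarrow> upper_Perron 2 \<Omega> f z \<le> ereal (f z0 + \<epsilon> + k * w z)"
      using main[OF \<epsilon>] by blast
    have "\<forall>\<^sub>F z in at z0 within \<Omega>. w z < \<epsilon> / k" using lim k(1) \<epsilon> by (intro order_tendstoD) auto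
    moreover have "\<forall>\<^sub>F z in at z0 within \<Omega>. z \<in> \<Omega>" by (simp add: eventually_at_filter)
    ultimately show "\<forall>\<^sub>F z in at z0 within \<Omega>. upper_Perron 2 \<Omega> f z < a"
    proof eventually_elim
      case (elim z)
      have "k * w z < \<epsilon>" using elim(1) k(1) by (simp add: pos_less_divide_eq mult.commute)
      then have "f z0 + \<epsilon> + k * w z \<le> a'" by (simp add: \<epsilon>_def field_simps)
      then have "upper_Perron 2 \<Omega> f z \<le> ereal a'" using k(2)[OF elim(2)] by (meson ereal_less_eq(3) order_trans)
      with a'(1) show ?case by (rule le_less_trans[rotated])
    qed
  qed
qed

text \<open>For each \<epsilon> the function g + \<epsilon> s lies in the upper class, and letting
  \<epsilon> tend to 0 at one fixed point bounds the Perron solution by g there. Hence s may blow up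
  at the boundary; its task is to repair g at boundary points where g alone is too small.\<close>

lemma not_regular_point_if_supersolutions:
  fixes \<Omega> :: "('a::euclidean_space \<times> real) set"
  assumes f: "continuous_on (frontier \<Omega>) f"
    and w: "\<And>\<epsilon> z. \<epsilon> > 0 \<Longrightarrow> z \<in> \<Omega> \<Longrightarrow> strict_supersolution_at (\<lambda>z. g z + \<epsilon> * s z) z"
    and bdry: "\<And>\<epsilon> \<xi> \<kappa>. \<epsilon> > 0 \<Longrightarrow> \<xi> \<in> frontier \<Omega> \<Longrightarrow> \<kappa> > 0 \<Longrightarrow>
      \<forall>\<^sub>F z in at \<xi> within \<Omega>. f \<xi> - \<kappa> \<le> g z + \<epsilon> * s z"
    and freq: "\<exists>\<^sub>F z in at z0 within \<Omega>. g z \<le> L" and L: "L < f z0"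
  shows "\<not> regular_point 2 \<Omega> z0"
proof
  assume "regular_point 2 \<Omega> z0"
  then have "(upper_Perron 2 \<Omega> f \<longlongrightarrow> ereal (f z0)) (at z0 within \<Omega>)"
    using f by (simp add: regular_point_def)
  then have "\<forall>\<^sub>F z in at z0 within \<Omega>. ereal L < upper_Perron 2 \<Omega> f z"
    by (rule order_tendstoD) (simp add: L)
  moreover have "\<forall>\<^sub>F z in at z0 within \<Omega>. z \<in> \<Omega>" by (simp add: eventually_at_filter)
  ultimately have ev: "\<forall>\<^sub>F z in at z0 within \<Omega>. ereal L < upper_Perron 2 \<Omega> f z \<and> z \<in> \<Omega>"
    by (rule eventually_conj)
  have "\<exists>z. g z \<le> L \<and> ereal L < upper_Perron 2 \<Omega> f z \<and> z \<in> \<Omega>"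
  proof (rule ccontr)
    assume "\<not> ?thesis"
    with ev have "\<forall>\<^sub>F z in at z0 within \<Omega>. \<not> g z \<le> L" by (auto elim: eventually_mono)
    with freq show False by (simp add: frequently_def)
  qed
  then obtain z where z: "g z \<le> L" "ereal L < upper_Perron 2 \<Omega> f z" "z \<in> \<Omega>" by blast
  have upper: "upper_Perron 2 \<Omega> f z \<le> ereal (g z + \<epsilon> * s z)" if \<epsilon>: "\<epsilon> > 0" for \<epsilon>
    unfolding upper_Perron_def
  proof (rule INF_lower)
    have "ereal (f \<xi>) \<le> Liminf (at \<xi> within \<Omega>) (\<lambda>z. ereal (g z + \<epsilon> * s z))" if \<xi>: "\<xi> \<in> frontier \<Omega>" for \<xi>
    proof (rule ereal_le_epsilon2)
      fix \<kappa> :: real assume "\<kappa> > 0"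
      have "ereal (f \<xi> - \<kappa>) \<le> Liminf (at \<xi> within \<Omega>) (\<lambda>z. ereal (g z + \<epsilon> * s z))"
        by (rule Liminf_bounded, use bdry[OF \<epsilon> \<xi> \<open>\<kappa> > 0\<close>] in eventually_elim) simp
      then have "ereal (f \<xi> - \<kappa>) + ereal \<kappa> \<le> Liminf (at \<xi> within \<Omega>) (\<lambda>z. ereal (g z + \<epsilon> * s z)) + ereal \<kappa>"
        by (rule add_right_mono)
      then show "ereal (f \<xi>) \<le> Liminf (at \<xi> within \<Omega>) (\<lambda>z. ereal (g z + \<epsilon> * s z)) + ereal \<kappa>" by simp
    qed
    then show "(\<lambda>z. ereal (g z + \<epsilon> * s z)) \<in> upper_class 2 \<Omega> f"
      unfolding upper_class_def
      using supersolution_superparabolic[OF w[OF \<epsilon>]] by blast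
  qed
  obtain p where p: "ereal L < ereal p" "ereal p < upper_Perron 2 \<Omega> f z" using ereal_dense2[OF z(2)] by blast
  \<comment> \<open>Gives \<epsilon> s(z) \<le> p - L however large s(z) is; the point z is already
    fixed.\<close>
  define \<epsilon> where "\<epsilon> = (p - L) / (\<bar>s z\<bar> + 1)"
  have \<epsilon>: "\<epsilon> > 0" using p(1) by (simp add: \<epsilon>_def)
  have "\<epsilon> * s z \<le> \<epsilon> * (\<bar>s z\<bar> + 1)" using \<epsilon> by (intro mult_left_mono) auto
  also have "\<dots> = p - L" by (simp add: \<epsilon>_def)
  finally have "ereal (g z + \<epsilon> * s z) \<le> ereal p" using z(1) by simp
  then show False using upper[OF \<epsilon>] p(2) by (meson leD order_trans)
qed

text \<open>With y = x - x0 one has s - s0 = 2 (x0 \<bullet> y) + |y|^2, so Fs contributes to the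
  gradient and to the identity part, while (Fss/2) (s - s0)^2 is 2 Fss (x0 \<bullet> y)^2 up to
  third order. This gives c = Fs, d = 2 Fss and e = x0. The time increment is estimated at the
  moving s, which is why Ft has to be jointly continuous.\<close>

lemma radial_jet:
  fixes F Ft :: "real \<Rightarrow> real \<Rightarrow> real" and x0 :: "'a::euclidean_space"
  assumes W: "open W" "((norm x0)\<^sup>2, t0) \<in> W"
    and Ft: "\<And>s t. (s, t) \<in> W \<Longrightarrow> ((\<lambda>t. F s t) has_field_derivative Ft s t) (at t)"
    and Fs: "\<And>s t. (s, t) \<in> W \<Longrightarrow> ((\<lambda>s. F s t) has_field_derivative Fs s t) (at s)"
    and Fss: "\<And>s t. (s, t) \<in> W \<Longrightarrow> ((\<lambda>s. Fs s t) has_field_derivative Fss s t) (at s)"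
    and cont: "continuous_on W (\<lambda>(s, t). Ft s t)"
  shows "parabolic_jet (\<lambda>z. F ((norm (fst z))\<^sup>2) (snd z)) (x0, t0)
    ((2 * Fs ((norm x0)\<^sup>2) t0) *\<^sub>R x0) (Fs ((norm x0)\<^sup>2) t0) (2 * Fss ((norm x0)\<^sup>2) t0) x0 (Ft ((norm x0)\<^sup>2) t0)"
  unfolding parabolic_jet_def
proof (intro allI impI)
  fix \<eta> :: real assume \<eta>: "\<eta> > 0"
  define s0 where "s0 = (norm x0)\<^sup>2"
  have W0: "(s0, t0) \<in> W" using W(2) by (simp add: s0_def)
  define p where "p = Fs s0 t0"
  define q where "q = Fss s0 t0"
  define b where "b = Ft s0 t0"
  \<comment> \<open>A Lipschitz constant: |s - s0| \<le> R |y| for |y| \<le> 1. Accordingly \<eta>1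
    turns an error \<eta>1 (s - s0)^2 into at most (\<eta>/2) |y|^2.\<close>
  define R where "R = 2 * norm x0 + 1"
  have R: "R > 0" by (simp add: R_def add_nonneg_pos)
  define \<eta>1 where "\<eta>1 = \<eta> / (2 * R\<^sup>2)"
  have \<eta>1: "\<eta>1 > 0" using \<eta> R by (simp add: \<eta>1_def)
  have "continuous (at (s0, t0)) (\<lambda>(s, t). Ft s t)"
    by (rule continuous_on_interior[OF cont]) (use W(1) W0 in \<open>simp add: interior_open\<close>)
  then obtain \<delta>0 where \<delta>0: "\<delta>0 > 0" "\<And>s t. dist (s, t) (s0, t0) < \<delta>0 \<Longrightarrow> \<bar>Ft s t - b\<bar> < \<eta>"
    using \<eta> unfolding continuous_at_eps_delta b_def by (force simp: dist_real_def)
  obtain \<delta>W where \<delta>W: "\<delta>W > 0" "\<And>z. dist z (s0, t0) < \<delta>W \<Longrightarrow> z \<in> W"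
    using W(1) W0 unfolding open_dist by blast
  define \<delta>1 where "\<delta>1 = min \<delta>0 \<delta>W"
  have \<delta>1: "\<delta>1 > 0" "\<And>s t. dist (s, t) (s0, t0) < \<delta>1 \<Longrightarrow> \<bar>Ft s t - b\<bar> < \<eta>"
    "\<And>s t. dist (s, t) (s0, t0) < \<delta>1 \<Longrightarrow> (s, t) \<in> W"
    using \<delta>0 \<delta>W by (auto simp: \<delta>1_def)
  have distW: "dist (s, t0) (s0, t0) = \<bar>s - s0\<bar>" for s
    by (simp add: dist_Pair_Pair dist_real_def)
  have "((\<lambda>s. (Fs s t0 - p) / (s - s0)) \<longlongrightarrow> q) (at s0)"
    using Fss[OF W0] unfolding has_field_derivative_iff p_def q_def .
  then have "\<forall>\<^sub>F s in at s0. dist ((Fs s t0 - p) / (s - s0)) q < \<eta>1" using \<eta>1 by (rule tendstoD)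
  then obtain \<delta>2 where \<delta>2: "\<delta>2 > 0"
    "\<And>s. s \<noteq> s0 \<Longrightarrow> dist s s0 < \<delta>2 \<Longrightarrow> dist ((Fs s t0 - p) / (s - s0)) q < \<eta>1"
    unfolding eventually_at by blast
  have lin: "\<bar>Fs s t0 - p - q * (s - s0)\<bar> \<le> \<eta>1 * \<bar>s - s0\<bar>" if "\<bar>s - s0\<bar> < \<delta>2" for s
  proof (cases "s = s0")
    case False
    then have "\<bar>(Fs s t0 - p) / (s - s0) - q\<bar> * \<bar>s - s0\<bar> \<le> \<eta>1 * \<bar>s - s0\<bar>"
      using \<delta>2(2)[OF False] that by (intro mult_right_mono) (auto simp: dist_real_def)
    moreover have "\<bar>(Fs s t0 - p) / (s - s0) - q\<bar> * \<bar>s - s0\<bar> = \<bar>Fs s t0 - p - q * (s - s0)\<bar>"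
    proof -
      have "(Fs s t0 - p) / (s - s0) - q = (Fs s t0 - p - q * (s - s0)) / (s - s0)"
        using False by (simp add: diff_divide_distrib)
      then show ?thesis using False by simp
    qed
    ultimately show ?thesis by simp
  qed (simp add: p_def)
  \<comment> \<open>The second-order Taylor remainder up to a constant. Its derivative is o(|s -
    s0|) because Fs is differentiable at s0, so the mean value inequality does the rest without
    continuity of Fss.\<close>
  define G where "G s = F s t0 - p * (s - s0) - q / 2 * (s - s0)\<^sup>2" for s
  have G: "\<bar>F s t0 - F s0 t0 - p * (s - s0) - q / 2 * (s - s0)\<^sup>2\<bar> \<le> \<eta>1 * (s - s0)\<^sup>2"
    if s: "\<bar>s - s0\<bar> < \<delta>2" "\<bar>s - s0\<bar> < \<delta>1" for s
  proof -
    have DG: "(G has_field_derivative (Fs r t0 - p - q * (r - s0))) (at r)" if "(r, t0) \<in> W" for r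
      unfolding G_def by (rule derivative_eq_intros Fs[OF that] refl | simp)+
    have "norm (G s - G s0) \<le> (\<eta>1 * \<bar>s - s0\<bar>) * norm (s - s0)"
    proof (rule field_differentiable_bound[of "closed_segment s0 s"])
      fix r assume "r \<in> closed_segment s0 s"
      then have r: "\<bar>r - s0\<bar> \<le> \<bar>s - s0\<bar>" by (auto simp: closed_segment_eq_real_ivl split: if_splits)
      then have "(r, t0) \<in> W" using s(2) by (intro \<delta>1(3)) (simp add: distW)
      then show "(G has_field_derivative (Fs r t0 - p - q * (r - s0))) (at r within closed_segment s0 s)"
        using DG has_field_derivative_at_within by blast
      have "\<bar>Fs r t0 - p - q * (r - s0)\<bar> \<le> \<eta>1 * \<bar>r - s0\<bar>" using r s(1) by (intro lin) linarith
      also have "\<dots> \<le> \<eta>1 * \<bar>s - s0\<bar>" using r \<eta>1 by (intro mult_left_mono) auto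
      finally show "norm (Fs r t0 - p - q * (r - s0)) \<le> \<eta>1 * \<bar>s - s0\<bar>" by simp
    qed auto
    note bound = this
    have sq: "(\<eta>1 * \<bar>s - s0\<bar>) * \<bar>s - s0\<bar> = \<eta>1 * (s - s0)\<^sup>2"
      by (simp add: power2_eq_square mult.assoc)
    have diff: "G s - G s0 = F s t0 - F s0 t0 - p * (s - s0) - q / 2 * (s - s0)\<^sup>2"
      by (simp add: G_def)
    show ?thesis using bound unfolding real_norm_def sq diff .
  qed
  \<comment> \<open>The entries keep |s - s0| and |t - t0| in the range where the estimates for F
    hold; the last entry makes the third-order terms small.\<close>
  define \<rho> where "\<rho> = Min {1, \<delta>1 / (2 * R), \<delta>2 / R, \<delta>1 / 2, \<eta> / (2 * (\<bar>q\<bar> + 1) * R)}"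
  have \<rho>: "\<rho> > 0" "\<rho> \<le> 1" "\<rho> * R \<le> \<delta>1 / 2" "\<rho> * R \<le> \<delta>2" "\<rho> \<le> \<delta>1 / 2"
    "\<rho> * R * (\<bar>q\<bar> + 1) \<le> \<eta> / 2"
  proof -
    have "\<rho> \<le> \<delta>1 / (2 * R)" "\<rho> \<le> \<delta>2 / R" "\<rho> \<le> \<eta> / (2 * (\<bar>q\<bar> + 1) * R)"
      unfolding \<rho>_def by (intro Min_le; simp)+
    moreover have pR: "2 * (\<bar>q\<bar> + 1) * R > 0" using R by (intro mult_pos_pos add_nonneg_pos) auto
    ultimately have "\<rho> * R \<le> \<delta>1 / 2" "\<rho> * R \<le> \<delta>2" "\<rho> * (2 * (\<bar>q\<bar> + 1) * R) \<le> \<eta>"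
      using R by (simp_all only: pos_le_divide_eq)
    then show "\<rho> * R \<le> \<delta>1 / 2" "\<rho> * R \<le> \<delta>2" "\<rho> * R * (\<bar>q\<bar> + 1) \<le> \<eta> / 2"
      by (simp_all add: algebra_simps)
    have "\<forall>a\<in>{1, \<delta>1 / (2 * R), \<delta>2 / R, \<delta>1 / 2, \<eta> / (2 * (\<bar>q\<bar> + 1) * R)}. 0 < a"
      using R \<delta>1(1) \<delta>2(1) divide_pos_pos[OF \<eta> pR] by simp
    then show "\<rho> > 0" unfolding \<rho>_def by (intro Min_gr_iff[THEN iffD2]) auto
  qed (unfold \<rho>_def, (intro Min_le; simp)+)
  show "\<forall>\<^sub>F z in nhds (x0, t0). \<bar>F ((norm (fst z))\<^sup>2) (snd z)
      - quad (x0, t0) (F ((norm (fst (x0, t0)))\<^sup>2) (snd (x0, t0))) ((2 * Fs ((norm x0)\<^sup>2) t0) *\<^sub>R x0) (Fs ((norm x0)\<^sup>2) t0)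
          (2 * Fss ((norm x0)\<^sup>2) t0) x0 (Ft ((norm x0)\<^sup>2) t0) z\<bar>
      \<le> \<eta> * ((norm (fst z - fst (x0, t0)))\<^sup>2 + \<bar>snd z - snd (x0, t0)\<bar>)"
    unfolding eventually_nhds_metric
  proof (intro exI[of _ \<rho>] conjI \<rho>(1) allI impI)
    fix z :: "'a \<times> real" assume "dist z (x0, t0) < \<rho>"
    moreover obtain x t where z: "z = (x, t)" by (cases z)
    ultimately have y: "norm (x - x0) < \<rho>" and t: "\<bar>t - t0\<bar> < \<rho>"
      using dist_fst_le[of z "(x0, t0)"] dist_snd_le[of z "(x0, t0)"] by (auto simp: dist_norm)
    define N where "N = norm (x - x0)"
    define I where "I = x0 \<bullet> (x - x0)"
    define s where "s = (norm x)\<^sup>2"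
    have N: "0 \<le> N" "N < \<rho>" using y by (auto simp: N_def)
    have "s = s0 + 2 * I + N\<^sup>2"
      unfolding s_def s0_def I_def N_def power2_norm_eq_inner
      by (simp add: inner_diff_left inner_diff_right inner_commute)
    then have ds: "s - s0 = 2 * I + N\<^sup>2" by simp
    have I: "\<bar>I\<bar> \<le> norm x0 * N" unfolding I_def N_def by (rule Cauchy_Schwarz_ineq2)
    have "N\<^sup>2 \<le> N" using N \<rho>(2) by (simp add: power2_eq_square mult_left_le)
    moreover have RN: "R * N = 2 * (norm x0 * N) + N" by (simp add: R_def algebra_simps)
    ultimately have dsR: "\<bar>s - s0\<bar> \<le> R * N" using I zero_le_power2[of N] N(1) unfolding ds by linarith
    have "R * N < R * \<rho>" using N R by simp
    then have small: "\<bar>s - s0\<bar> < \<delta>2" "\<bar>s - s0\<bar> < \<delta>1 / 2"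
      using dsR \<rho> by (simp_all add: mult.commute)
    have timebound: "\<bar>F s t - F s t0 - b * (t - t0)\<bar> \<le> \<eta> * \<bar>t - t0\<bar>"
    proof -
      have "norm ((F s t - b * t) - (F s t0 - b * t0)) \<le> \<eta> * norm (t - t0)"
      proof (rule field_differentiable_bound[of "closed_segment t0 t" "\<lambda>t. F s t - b * t" "\<lambda>t. Ft s t - b"])
        fix r assume "r \<in> closed_segment t0 t"
        then have r: "\<bar>r - t0\<bar> \<le> \<bar>t - t0\<bar>" by (auto simp: closed_segment_eq_real_ivl split: if_splits)
        have "dist (s, r) (s0, t0) \<le> \<bar>s - s0\<bar> + \<bar>r - t0\<bar>"
          using norm_Pair_le[of "s - s0" "r - t0"] by (simp add: dist_norm)
        also have "\<dots> < \<delta>1" using small(2) r t \<rho>(5) by linarith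
        finally have d: "dist (s, r) (s0, t0) < \<delta>1" .
        have "((\<lambda>t. F s t - b * t) has_field_derivative (Ft s r - b)) (at r)"
          by (intro DERIV_cong[OF DERIV_diff[OF Ft[OF \<delta>1(3)[OF d]] DERIV_cmult[OF DERIV_ident]]]) simp_all
        then show "((\<lambda>t. F s t - b * t) has_field_derivative (Ft s r - b)) (at r within closed_segment t0 t)"
          by (rule has_field_derivative_at_within)
        show "norm (Ft s r - b) \<le> \<eta>" using \<delta>1(2)[OF d] by (simp add: less_imp_le)
      qed auto
      then show ?thesis by (simp add: algebra_simps)
    qed
    have "\<eta>1 * (s - s0)\<^sup>2 \<le> \<eta>1 * (R * N)\<^sup>2"
      using dsR \<eta>1 R N by (intro mult_left_mono) (auto simp: abs_le_square_iff[symmetric])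
    also have "\<dots> = \<eta> / 2 * N\<^sup>2" using R by (simp add: \<eta>1_def power_mult_distrib)
    finally have G': "\<bar>F s t0 - F s0 t0 - p * (s - s0) - q / 2 * (s - s0)\<^sup>2\<bar> \<le> \<eta> / 2 * N\<^sup>2"
      using G[OF small(1)] small(2) by linarith
    \<comment> \<open>The quadratic term of the expansion in s and that of the jet differ by
      third-order terms in |y| only.\<close>
    have "(s - s0)\<^sup>2 / 2 - 2 * I\<^sup>2 = N\<^sup>2 * (2 * I + N\<^sup>2 / 2)"
      unfolding ds by (simp add: power2_eq_square algebra_simps)
    moreover have "\<bar>2 * I + N\<^sup>2 / 2\<bar> \<le> R * N"
      using I \<open>N\<^sup>2 \<le> N\<close> zero_le_power2[of N] N(1) unfolding RN by linarith
    ultimately have "\<bar>(s - s0)\<^sup>2 / 2 - 2 * I\<^sup>2\<bar> \<le> N\<^sup>2 * (R * N)"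
      by (simp add: abs_mult mult_left_mono)
    then have "\<bar>q\<bar> * \<bar>(s - s0)\<^sup>2 / 2 - 2 * I\<^sup>2\<bar> \<le> \<bar>q\<bar> * (N\<^sup>2 * (R * N))"
      by (rule mult_left_mono) simp
    also have "\<dots> = N\<^sup>2 * (N * R * \<bar>q\<bar>)" by simp
    also have "\<dots> \<le> N\<^sup>2 * (\<rho> * R * (\<bar>q\<bar> + 1))"
      using N R by (intro mult_left_mono mult_mono) auto
    also have "\<dots> \<le> N\<^sup>2 * (\<eta> / 2)" using \<rho>(6) by (intro mult_left_mono) auto
    finally have Q: "\<bar>q * ((s - s0)\<^sup>2 / 2 - 2 * I\<^sup>2)\<bar> \<le> N\<^sup>2 * (\<eta> / 2)" by (simp add: abs_mult)
    have quad: "quad (x0, t0) (F s0 t0) ((2 * p) *\<^sub>R x0) p (2 * q) x0 b z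
       = F s0 t0 + 2 * p * I + p * N\<^sup>2 + 2 * q * I\<^sup>2 + b * (t - t0)"
      by (simp add: quad_def z I_def N_def)
    have "F s t - quad (x0, t0) (F s0 t0) ((2 * p) *\<^sub>R x0) p (2 * q) x0 b z
       = (F s t - F s t0 - b * (t - t0)) + (F s t0 - F s0 t0 - p * (s - s0) - q / 2 * (s - s0)\<^sup>2)
        + q * ((s - s0)\<^sup>2 / 2 - 2 * I\<^sup>2)"
      unfolding quad ds by (simp add: algebra_simps)
    also have "\<bar>\<dots>\<bar> \<le> \<eta> * \<bar>t - t0\<bar> + \<eta> / 2 * N\<^sup>2 + N\<^sup>2 * (\<eta> / 2)"
      using timebound G' Q by linarith
    also have "\<dots> = \<eta> * (N\<^sup>2 + \<bar>t - t0\<bar>)" by (simp add: algebra_simps)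
    finally show "\<bar>F ((norm (fst z))\<^sup>2) (snd z)
      - quad (x0, t0) (F ((norm (fst (x0, t0)))\<^sup>2) (snd (x0, t0))) ((2 * Fs ((norm x0)\<^sup>2) t0) *\<^sub>R x0) (Fs ((norm x0)\<^sup>2) t0)
          (2 * Fss ((norm x0)\<^sup>2) t0) x0 (Ft ((norm x0)\<^sup>2) t0) z\<bar>
      \<le> \<eta> * ((norm (fst z - fst (x0, t0)))\<^sup>2 + \<bar>snd z - snd (x0, t0)\<bar>)"
      by (simp add: z s_def s0_def p_def q_def b_def N_def)
  qed
qed

text \<open>The right-hand side of the assumed inequality is the Laplacian of F(|x|^2, t). The
  variable |x|^2 avoids differentiating the norm.\<close>

lemma radial_strict_supersolution:
  fixes F Ft :: "real \<Rightarrow> real \<Rightarrow> real" and x :: "'a::euclidean_space"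
  assumes W: "open W" "((norm x)\<^sup>2, t) \<in> W"
    and "\<And>s t. (s, t) \<in> W \<Longrightarrow> ((\<lambda>t. F s t) has_field_derivative Ft s t) (at t)"
    and "\<And>s t. (s, t) \<in> W \<Longrightarrow> ((\<lambda>s. F s t) has_field_derivative Fs s t) (at s)"
    and "\<And>s t. (s, t) \<in> W \<Longrightarrow> ((\<lambda>s. Fs s t) has_field_derivative Fss s t) (at s)"
    and "continuous_on W (\<lambda>(s, t). Ft s t)"
    and ineq: "\<And>s t. (s, t) \<in> W \<Longrightarrow> Ft s t > 2 * real DIM('a) * Fs s t + 4 * s * Fss s t"
  shows "strict_supersolution_at (\<lambda>z. F ((norm (fst z))\<^sup>2) (snd z)) (x, t)"
proof -
  have "parabolic_jet (\<lambda>z. F ((norm (fst z))\<^sup>2) (snd z)) (x, t)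
    ((2 * Fs ((norm x)\<^sup>2) t) *\<^sub>R x) (Fs ((norm x)\<^sup>2) t) (2 * Fss ((norm x)\<^sup>2) t) x (Ft ((norm x)\<^sup>2) t)"
    by (rule radial_jet[of W x t F Ft Fs Fss]) (fact assms)+
  moreover have "2 * Fs ((norm x)\<^sup>2) t * real DIM('a) + 2 * (2 * Fss ((norm x)\<^sup>2) t) * (x \<bullet> x) < Ft ((norm x)\<^sup>2) t"
    using ineq[OF W(2)] unfolding power2_norm_eq_inner by (simp add: mult_ac)
  ultimately show ?thesis unfolding strict_supersolution_at_def by blast
qed

section \<open>Power domains containing a parabolic hole\<close>

lemma in_power_domain:
  assumes "(x, t) \<in> power_domain l \<theta>" "\<theta> > 0" "l > 0"
  shows "x \<noteq> 0" "norm x < 1" "t < 0" "- t < \<theta> * norm x powr l" "- t < \<theta>"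
proof -
  have *: "0 < - t" "- t < \<theta> * norm x powr l" "\<theta> * norm x powr l < \<theta>"
    using assms(1) by (auto simp: power_domain_def)
  then show "t < 0" "- t < \<theta> * norm x powr l" "- t < \<theta>" by auto
  show "x \<noteq> 0" using * by auto
  then have "norm x > 0" by simp
  have "norm x powr l < 1 powr l" using *(3) assms(2) by simp
  then show "norm x < 1" using assms(3) \<open>norm x > 0\<close> powr_less_cancel2[of l "norm x" 1] by simp
qed

lemma open_power_domain:
  assumes "l > 0" shows "open (power_domain l \<theta>)"
proof -
  have c: "continuous_on UNIV (\<lambda>z::'a::euclidean_space \<times> real. norm (fst z) powr l)"
    using assms by (intro continuous_on_powr' continuous_intros) auto
  have "power_domain l \<theta> = {z::'a \<times> real. 0 < - snd z} \<inter> {z. - snd z < \<theta> * norm (fst z) powr l}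
      \<inter> {z. \<theta> * norm (fst z) powr l < \<theta>}"
    by (auto simp: power_domain_def)
  also have "open \<dots>"
    by (intro open_Int open_Collect_less continuous_intros c)
  finally show ?thesis .
qed

lemma bounded_power_domain:
  assumes "\<theta> > 0" "l > 0" shows "bounded (power_domain l \<theta> :: ('a::euclidean_space \<times> real) set)"
proof -
  have "power_domain l \<theta> \<subseteq> (ball 0 1 :: 'a set) \<times> {- \<theta>..0}"
    using in_power_domain[OF _ assms] by (auto; fastforce)
  then show ?thesis by (rule bounded_subset[rotated]) (intro bounded_Times; simp)
qed

lemma zero_frontier_power_domain:
  assumes "\<theta> > 0" "l > 0"
  shows "(0, 0) \<in> frontier (power_domain l \<theta> :: ('a::euclidean_space \<times> real) set)"
proof -
  let ?D = "power_domain l \<theta> :: ('a \<times> real) set"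
  obtain u :: 'a where u: "norm u = 1" using vector_choose_size[of 1] by auto
  have in_D: "(r *\<^sub>R u, - (\<theta> / 2 * r powr l)) \<in> ?D" if "0 < r" "r < 1" for r
  proof -
    have "r powr l > 0" "r powr l < 1" using that assms(2) powr_less_mono2[of l r 1] by auto
    then show ?thesis using u that assms(1) by (simp add: power_domain_def)
  qed
  have "((\<lambda>r. (r *\<^sub>R u, - (\<theta> / 2 * r powr l))) \<longlongrightarrow> (0 *\<^sub>R u, - (\<theta> / 2 * 0))) (at_right 0)"
    using assms(2) by (intro tendsto_intros tendsto_eq_intros) (auto intro!: tendsto_eq_intros simp: eventually_at_filter)
  moreover have "\<forall>\<^sub>F r in at_right 0. (r *\<^sub>R u, - (\<theta> / 2 * r powr l)) \<in> closure ?D"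
    unfolding eventually_at_right_field
    by (intro exI[of _ 1]) (use in_D closure_subset in \<open>auto; blast\<close>)
  ultimately have "(0 *\<^sub>R u, - (\<theta> / 2 * 0)) \<in> closure ?D"
    by (intro Lim_in_closed_set[of _ _ "at_right (0::real)"]) auto
  then show ?thesis
    using interior_subset in_power_domain(1)[of 0 0 l \<theta>] assms by (auto simp: frontier_def)
qed

definition hole_barrier :: "real \<Rightarrow> real \<Rightarrow> real \<Rightarrow> real \<Rightarrow> real" where
  "hole_barrier k \<beta> s t = exp (\<beta> * (ln s / 2 - exp (k * (- t) / s)))"

text \<open>Write Y = ln r - exp(k q) with q = |t|/r^2. The time derivative k exp(k q)/r^2 of Y has
  the order of the Laplacian (n - 2)/r^2 of ln r, and the inner exponential makes it win for every
  q. Passing to exp(\<beta> Y) adds \<beta> |\<nabla>Y|^2, and since q < \<theta> the condition on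
  \<beta> keeps this below 1/r^2.\<close>

lemma hole_barrier_supersolution:
  fixes x :: "'a::euclidean_space"
  assumes n: "n = real DIM('a)" and k: "k = n\<^sup>2" and \<theta>: "\<theta> > 0"
    and \<beta>: "\<beta> > 0" "\<beta> * (1 + 2 * k * \<theta> * exp (k * \<theta>))\<^sup>2 \<le> 1"
    and "x \<noteq> 0" "t < 0" "- t < \<theta> * (norm x)\<^sup>2"
  shows "strict_supersolution_at (\<lambda>z. hole_barrier k \<beta> ((norm (fst z))\<^sup>2) (snd z)) (x, t)"
proof -
  define W where "W = {z :: real \<times> real. 0 < fst z} \<inter> {z. snd z < 0} \<inter> {z. - snd z < \<theta> * fst z}"
  define E where "E s t = exp (k * (- t) / s)" for s t :: real
  define Ys where "Ys s t = 1 / (2 * s) - E s t * (k * t / s\<^sup>2)" for s t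
  define Yss where "Yss s t = - 1 / (2 * s\<^sup>2) - E s t * (k * t / s\<^sup>2)\<^sup>2 + 2 * k * t * E s t / s ^ 3" for s t
  let ?F = "hole_barrier k \<beta>"
  have n1: "n \<ge> 1" by (simp add: n)
  have Es: "((\<lambda>s. E s t) has_field_derivative E s t * (k * t / s\<^sup>2)) (at s)" if "s > 0" for s t
    unfolding E_def using that
    by (auto intro!: derivative_eq_intros simp: power2_eq_square)
  have Et: "((\<lambda>t. E s t) has_field_derivative E s t * (- k / s)) (at t)" if "s > 0" for s t
    unfolding E_def using that by (auto intro!: derivative_eq_intros)
  have F: "?F s t = exp (\<beta> * (ln s / 2 - E s t))" for s t by (simp add: hole_barrier_def E_def)
  have Fs: "((\<lambda>s. ?F s t) has_field_derivative ?F s t * (\<beta> * Ys s t)) (at s)" if "s > 0" for s t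
    unfolding F using that
    by (auto intro!: derivative_eq_intros Es[OF that] simp: Ys_def)
  have Ft: "((\<lambda>t. ?F s t) has_field_derivative ?F s t * (\<beta> * (E s t * (k / s)))) (at t)" if "s > 0" for s t
    unfolding F using that by (auto intro!: derivative_eq_intros Et[OF that])
  have Yss': "((\<lambda>s. Ys s t) has_field_derivative Yss s t) (at s)" if "s > 0" for s t
  proof -
    have 1: "((\<lambda>s. k * t / s\<^sup>2) has_field_derivative - 2 * k * t / s ^ 3) (at s)"
      using that by (auto intro!: derivative_eq_intros simp: power2_eq_square power3_eq_cube field_simps)
    have 2: "((\<lambda>s. 1 / (2 * s)) has_field_derivative - 1 / (2 * s\<^sup>2)) (at s)"
      using that by (auto intro!: derivative_eq_intros simp: power2_eq_square field_simps)
    show ?thesis unfolding Ys_def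
      by (rule DERIV_cong[OF DERIV_diff[OF 2 DERIV_mult[OF Es[OF that] 1]]])
        (simp add: Yss_def power2_eq_square)
  qed
  have Fss: "((\<lambda>s. ?F s t * (\<beta> * Ys s t)) has_field_derivative
      ?F s t * (\<beta> * Ys s t) * (\<beta> * Ys s t) + ?F s t * (\<beta> * Yss s t)) (at s)" if "s > 0" for s t
    by (rule DERIV_cong[OF DERIV_mult[OF Fs[OF that] DERIV_cmult[OF Yss'[OF that]]]]) (simp add: algebra_simps)
  show ?thesis
  proof (rule radial_strict_supersolution[of W x t ?F "\<lambda>s t. ?F s t * (\<beta> * (E s t * (k / s)))"
        "\<lambda>s t. ?F s t * (\<beta> * Ys s t)" "\<lambda>s t. ?F s t * (\<beta> * Ys s t) * (\<beta> * Ys s t) + ?F s t * (\<beta> * Yss s t)"])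
    show "open W" unfolding W_def by (intro open_Int open_Collect_less continuous_intros)
    show "((norm x)\<^sup>2, t) \<in> W" using assms by (simp add: W_def)
    show "continuous_on W (\<lambda>(s, t). ?F s t * (\<beta> * (E s t * (k / s))))"
      unfolding F E_def split_beta W_def by (intro continuous_intros) auto
  next
    fix s t assume "(s, t) \<in> W"
    then have s: "s > 0" and t: "t < 0" and st: "- t < \<theta> * s" by (auto simp: W_def)
    define q where "q = - t / s"
    define e where "e = E s t"
    have q: "q > 0" and tq: "t = - q * s" using s t by (auto simp: q_def divide_neg_pos)
    have q\<theta>: "q < \<theta>" unfolding q_def by (subst pos_divide_less_eq) (use s st in auto)
    have e_eq: "e = exp (k * q)" by (simp add: e_def E_def q_def)
    have k0: "k > 0" using n1 by (simp add: k)
    have e1: "1 \<le> e" "e \<le> exp (k * \<theta>)" using k0 q q\<theta> by (auto simp: e_eq)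
    have Ysq: "s * Ys s t = 1 / 2 + k * q * e"
    proof -
      have "Ys s t = 1 / (2 * s) - e * (k * (- q * s) / s\<^sup>2)" unfolding Ys_def e_def using tq by simp
      then show ?thesis using s by (simp add: field_simps power2_eq_square)
    qed
    have Yssq: "s\<^sup>2 * Yss s t = - 1 / 2 - e * (k * q)\<^sup>2 - 2 * k * q * e"
    proof -
      have "Yss s t = - 1 / (2 * s\<^sup>2) - e * (k * (- q * s) / s\<^sup>2)\<^sup>2 + 2 * k * (- q * s) * e / s ^ 3"
        unfolding Yss_def e_def using tq by simp
      also have "k * (- q * s) / s\<^sup>2 = - (k * q) / s" using s by (simp add: power2_eq_square)
      also have "2 * k * (- q * s) * e / s ^ 3 = - (2 * k * q * e) / s\<^sup>2"
        using s by (simp add: power2_eq_square power3_eq_cube)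
      finally have "s\<^sup>2 * Yss s t = s\<^sup>2 * (- 1 / (2 * s\<^sup>2)) - e * (s\<^sup>2 * (- (k * q) / s)\<^sup>2)
          + s\<^sup>2 * (- (2 * k * q * e) / s\<^sup>2)" by (simp only: distrib_left right_diff_distrib mult.left_commute)
      then show ?thesis using s by (simp add: power_divide)
    qed
    have "k * q * e \<le> k * \<theta> * exp (k * \<theta>)"
      using k0 q q\<theta> e1 by (intro mult_mono) auto
    then have "(1 + 2 * (k * q * e))\<^sup>2 \<le> (1 + 2 * k * \<theta> * exp (k * \<theta>))\<^sup>2"
      using k0 q e1 by (intro power_mono) auto
    then have "\<beta> * (1 + 2 * (k * q * e))\<^sup>2 \<le> 1"
      using \<beta> mult_left_mono[of _ _ \<beta>] by (meson less_imp_le order_trans)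
    then have b: "4 * \<beta> * (s * Ys s t)\<^sup>2 \<le> 1"
      unfolding Ysq by (simp add: power2_eq_square algebra_simps)
    \<comment> \<open>This is where k = n^2 comes from: it completes the square in 4 k q^2 - 2 n q
      and leaves 3/4 of the factor, which suffices because 3 n^2/4 > n - 1.\<close>
    have "0 \<le> (2 * n * q - 1 / 2)\<^sup>2" by simp
    then have "3 / 4 \<le> 1 - 2 * n * q + 4 * k * q\<^sup>2"
      by (simp add: k power2_eq_square algebra_simps)
    then have "3 / 4 \<le> 1 - 2 * n * q + 8 * q + 4 * k * q\<^sup>2" using q by linarith
    then have "k * e * (3 / 4) \<le> k * e * (1 - 2 * n * q + 8 * q + 4 * k * q\<^sup>2)"
      using k0 e1 by (intro mult_left_mono) auto
    moreover have "k * 1 \<le> k * e" using k0 e1 by (intro mult_left_mono) auto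
    moreover have "n - 1 < k * (3 / 4)"
    proof -
      have "0 \<le> (3 / 2 * n - 1)\<^sup>2" by simp
      then show ?thesis by (simp add: k power2_eq_square algebra_simps)
    qed
    ultimately have "n - 2 + 1 < k * e * (1 - 2 * n * q + 8 * q + 4 * k * q\<^sup>2)" by linarith
    with b have "n - 2 + 4 * \<beta> * (s * Ys s t)\<^sup>2 < k * e * (1 - 2 * n * q + 8 * q + 4 * k * q\<^sup>2)" by linarith
    then have "2 * n * (s * Ys s t) + 4 * (s\<^sup>2 * Yss s t) + 4 * \<beta> * (s * Ys s t)\<^sup>2 < k * e"
      unfolding Yssq by (simp only: Ysq) (simp add: power2_eq_square algebra_simps)
    then have "?F s t * \<beta> / s * (2 * n * (s * Ys s t) + 4 * (s\<^sup>2 * Yss s t) + 4 * \<beta> * (s * Ys s t)\<^sup>2) < ?F s t * \<beta> / s * (k * e)"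
      using s \<beta>(1) by (intro mult_strict_left_mono) (auto simp: F)
    moreover have "?F s t * \<beta> / s * (2 * n * (s * Ys s t) + 4 * (s\<^sup>2 * Yss s t) + 4 * \<beta> * (s * Ys s t)\<^sup>2)
        = 2 * n * (?F s t * (\<beta> * Ys s t)) + 4 * s * (?F s t * (\<beta> * Ys s t) * (\<beta> * Ys s t) + ?F s t * (\<beta> * Yss s t))"
      using s by (simp add: field_simps power2_eq_square)
    moreover have "?F s t * \<beta> / s * (k * e) = ?F s t * (\<beta> * (E s t * (k / s)))"
      by (simp add: e_def)
    ultimately show "?F s t * (\<beta> * (E s t * (k / s))) > 2 * real DIM('a) * (?F s t * (\<beta> * Ys s t))
        + 4 * s * (?F s t * (\<beta> * Ys s t) * (\<beta> * Ys s t) + ?F s t * (\<beta> * Yss s t))"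
      unfolding n[symmetric] by (simp only:)
  qed (use Fs Ft Fss in \<open>auto simp: W_def\<close>)
qed

lemma dist_zero_ge_cases:
  fixes x :: "'a::euclidean_space"
  assumes "dist (x, t) (0, 0 :: real) \<ge> \<delta>"
  shows "norm x \<ge> \<delta> / 2 \<or> \<bar>t\<bar> \<ge> \<delta> / 2"
proof -
  have "dist (x, t) (0, 0 :: real) \<le> norm x + \<bar>t\<bar>"
    using norm_Pair_le[of x t] by (simp add: dist_norm)
  with assms show ?thesis by linarith
qed

text \<open>As |x| < 1, the condition l \<ge> 2 puts the domain inside |t| < \<theta> |x|^2. There
  the inner exponential of the barrier is bounded, and the barrier is comparable with |x| powr
  \<beta>.\<close>

lemma power_domain_regular_parabolic:
  assumes "\<theta> > 0" "l \<ge> 2"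
  shows "regular_point 2 (power_domain l \<theta> :: ('a::euclidean_space \<times> real) set) (0, 0)"
proof -
  have l: "l > 0" using assms(2) by simp
  define k where "k = (real DIM('a))\<^sup>2"
  define \<beta> where "\<beta> = 1 / (1 + 2 * k * \<theta> * exp (k * \<theta>))\<^sup>2"
  have k0: "k > 0" by (simp add: k_def)
  have "1 + 2 * k * \<theta> * exp (k * \<theta>) > 0" using k0 assms(1) by (simp add: add_pos_pos)
  then have \<beta>: "\<beta> > 0" "\<beta> * (1 + 2 * k * \<theta> * exp (k * \<theta>))\<^sup>2 \<le> 1" by (auto simp: \<beta>_def)
  let ?D = "power_domain l \<theta> :: ('a \<times> real) set"
  let ?w = "\<lambda>z::'a \<times> real. hole_barrier k \<beta> ((norm (fst z))\<^sup>2) (snd z)"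
  have D: "x \<noteq> 0" "norm x < 1" "t < 0" "- t < \<theta> * (norm x)\<^sup>2" if "(x, t) \<in> ?D" for x t
  proof -
    note P = in_power_domain[OF that assms(1) l]
    show "x \<noteq> 0" "norm x < 1" "t < 0" using P by auto
    have "norm x powr l \<le> norm x powr 2" using P assms(2) by (intro powr_mono') auto
    then have "\<theta> * norm x powr l \<le> \<theta> * (norm x)\<^sup>2" using assms(1) by simp
    with P(4) show "- t < \<theta> * (norm x)\<^sup>2" by linarith
  qed
  have val: "?w (x, t) = exp (\<beta> * (ln (norm x) - exp (k * (- t) / (norm x)\<^sup>2)))" if "x \<noteq> 0" for x t
    using that by (simp add: hole_barrier_def ln_realpow)
  have w_le: "?w (x, t) \<le> norm x powr \<beta>" if "x \<noteq> 0" for x t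
    unfolding val[OF that] powr_def using that \<beta>(1) by simp
  have w_ge: "?w (x, t) \<ge> norm x powr \<beta> * exp (- \<beta> * exp (k * \<theta>))" if "(x, t) \<in> ?D" for x t
  proof -
    have "- t / (norm x)\<^sup>2 \<le> \<theta>"
      by (subst pos_divide_le_eq) (use D[OF that] in auto)
    then have "exp (k * (- t) / (norm x)\<^sup>2) \<le> exp (k * \<theta>)"
      using k0 mult_left_mono[of "- t / (norm x)\<^sup>2" \<theta> k] by simp
    then have "\<beta> * (ln (norm x) - exp (k * \<theta>)) \<le> \<beta> * (ln (norm x) - exp (k * (- t) / (norm x)\<^sup>2))"
      using \<beta>(1) by simp
    moreover have "norm x powr \<beta> * exp (- \<beta> * exp (k * \<theta>)) = exp (\<beta> * (ln (norm x) - exp (k * \<theta>)))"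
      using D(1)[OF that] by (simp add: powr_def exp_add[symmetric] algebra_simps)
    ultimately show ?thesis unfolding val[OF D(1)[OF that]] by simp
  qed
  show ?thesis
  proof (rule regular_point_if_barrier[where w = ?w])
    show "strict_supersolution_at ?w z" if "z \<in> ?D" for z
      using D[of "fst z" "snd z"] that \<beta> assms(1)
        hole_barrier_supersolution[where x = "fst z" and t = "snd z" and k = k and \<beta> = \<beta> and \<theta> = \<theta>, OF refl k_def]
      by simp
    show "?w z > 0" for z by (simp add: hole_barrier_def)
    show "(?w \<longlongrightarrow> 0) (at (0, 0) within ?D)"
    proof (rule tendsto_sandwich[OF _ _ tendsto_const])
      show "\<forall>\<^sub>F z in at (0, 0) within ?D. 0 \<le> ?w z" by (simp add: hole_barrier_def)
      show "\<forall>\<^sub>F z in at (0, 0) within ?D. ?w z \<le> norm (fst z) powr \<beta>"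
        unfolding eventually_at_filter
        by (rule always_eventually) (use w_le D(1) in force)
      have "continuous_on UNIV (\<lambda>z::'a \<times> real. norm (fst z) powr \<beta>)"
        using \<beta>(1) by (intro continuous_on_powr' continuous_intros) auto
      then have "isCont (\<lambda>z::'a \<times> real. norm (fst z) powr \<beta>) (0, 0)"
        by (simp add: continuous_on_eq_continuous_at)
      then show "((\<lambda>z::'a \<times> real. norm (fst z) powr \<beta>) \<longlongrightarrow> 0) (at (0, 0) within ?D)"
        using \<beta>(1) by (auto simp: isCont_def intro: tendsto_within_subset)
    qed
    show "\<exists>m>0. \<forall>z\<in>?D. dist z (0, 0) \<ge> \<delta> \<longrightarrow> ?w z \<ge> m" if "\<delta> > 0" for \<delta>
    proof -
      \<comment> \<open>Distance from the origin has to bound |x| from below: either |x| is large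
        itself or |t| is, and then |t| < \<theta> |x|^2 gives the square root.\<close>
      define \<mu> where "\<mu> = min (\<delta> / 2) (sqrt (\<delta> / (2 * \<theta>)))"
      have \<mu>: "\<mu> > 0" using \<open>\<delta> > 0\<close> assms(1) by (simp add: \<mu>_def)
      have "?w z \<ge> \<mu> powr \<beta> * exp (- \<beta> * exp (k * \<theta>))" if z: "z \<in> ?D" "dist z (0, 0) \<ge> \<delta>" for z
      proof -
        obtain x t where xt: "z = (x, t)" by (cases z)
        have "norm x \<ge> \<mu>"
        proof (cases "norm x \<ge> \<delta> / 2")
          case False
          then have "- t \<ge> \<delta> / 2" using dist_zero_ge_cases[of \<delta> x t] z D(3)[of x t] by (simp add: xt)
          then have "\<delta> / 2 < \<theta> * (norm x)\<^sup>2" using D(4)[of x t] z(1) by (simp add: xt)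
          then have "\<delta> / (2 * \<theta>) \<le> (norm x)\<^sup>2" using assms(1) by (simp add: field_simps)
          then have "sqrt (\<delta> / (2 * \<theta>)) \<le> norm x" by (rule real_le_lsqrt[rotated]) (use assms \<open>\<delta> > 0\<close> in auto)
          then show ?thesis by (simp add: \<mu>_def)
        qed (simp add: \<mu>_def)
        then have "\<mu> powr \<beta> \<le> norm x powr \<beta>" using \<mu> \<beta>(1) by (intro powr_mono2) auto
        then have "\<mu> powr \<beta> * exp (- \<beta> * exp (k * \<theta>)) \<le> norm x powr \<beta> * exp (- \<beta> * exp (k * \<theta>))"
          by (intro mult_right_mono) auto
        also have "\<dots> \<le> ?w z" using w_ge z(1) by (simp add: xt)
        finally show ?thesis .
      qed
      then show ?thesis using \<mu> by (intro exI[of _ "\<mu> powr \<beta> * exp (- \<beta> * exp (k * \<theta>))"]) auto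
    qed
  qed (use open_power_domain[OF l] bounded_power_domain[OF assms(1) l] zero_frontier_power_domain[OF assms(1) l] in auto)
qed

section \<open>The planar punctured cylinder\<close>

text \<open>In the plane -ln r is harmonic, so the strict inequality is due to 1/(-t) alone, whose
  time derivative is positive.\<close>

lemma punctured_supersolution:
  fixes x :: "'a::euclidean_space"
  assumes "DIM('a) = 2" "\<epsilon> > 0" "x \<noteq> 0" "t < 0"
  shows "strict_supersolution_at (\<lambda>z::'a \<times> real. \<epsilon> * (R - ln ((norm (fst z))\<^sup>2) / 2 + 1 / (- snd z))) (x, t)"
proof (rule radial_strict_supersolution[of "{z. 0 < fst z} \<inter> {z. snd z < 0}" x t
      "\<lambda>s t. \<epsilon> * (R - ln s / 2 + 1 / (- t))" "\<lambda>s t. \<epsilon> / t\<^sup>2" "\<lambda>s t. - \<epsilon> / (2 * s)" "\<lambda>s t. \<epsilon> / (2 * s\<^sup>2)"])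
  show "open ({z :: real \<times> real. 0 < fst z} \<inter> {z. snd z < 0})"
    by (intro open_Int open_Collect_less continuous_intros)
  show "continuous_on ({z :: real \<times> real. 0 < fst z} \<inter> {z. snd z < 0}) (\<lambda>(s, t). \<epsilon> / t\<^sup>2)"
    unfolding split_beta by (intro continuous_intros) auto
  fix s t :: real assume "(s, t) \<in> {z. 0 < fst z} \<inter> {z. snd z < 0}"
  then have s: "s > 0" and t: "t < 0" by auto
  show "((\<lambda>t. \<epsilon> * (R - ln s / 2 + 1 / (- t))) has_field_derivative \<epsilon> / t\<^sup>2) (at t)"
    using t by (auto intro!: derivative_eq_intros simp: power2_eq_square)
  show "((\<lambda>s. \<epsilon> * (R - ln s / 2 + 1 / (- t))) has_field_derivative - \<epsilon> / (2 * s)) (at s)"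
    using s by (auto intro!: derivative_eq_intros)
  show "((\<lambda>s. - \<epsilon> / (2 * s)) has_field_derivative \<epsilon> / (2 * s\<^sup>2)) (at s)"
    using s by (auto intro!: derivative_eq_intros simp: power2_eq_square field_simps)
  have "2 * real DIM('a) * (- \<epsilon> / (2 * s)) + 4 * s * (\<epsilon> / (2 * s\<^sup>2)) = 0"
    using s assms(1) by (simp add: field_simps power2_eq_square)
  moreover have "\<epsilon> / t\<^sup>2 > 0" using t assms(2) by simp
  ultimately show "\<epsilon> / t\<^sup>2 > 2 * real DIM('a) * (- \<epsilon> / (2 * s)) + 4 * s * (\<epsilon> / (2 * s\<^sup>2))" by simp
qed (use assms in auto)

text \<open>A point has zero capacity in the plane: S tends to \<infinity> at the removed axis, and
  also at time 0, so arbitrarily small multiples of it dominate all data there, including the value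
  1 at the origin. The bound g = 0 then holds at every point of the cylinder.\<close>

lemma punctured_cylinder_irregular:
  assumes "DIM('a::euclidean_space) = 2" "r > 0"
  shows "irregular_point 2 ((ball (0::'a) r - {0}) \<times> {-1<..<0}) (0, 0)"
proof -
  let ?C = "(ball (0::'a) r - {0}) \<times> {-1<..<0::real}"
  have oC: "open ?C" by (intro open_Times open_Diff) auto
  have clC: "closure ?C \<subseteq> cball 0 r \<times> {-1..0}"
    by (intro closure_minimal closed_Times) auto
  obtain u :: 'a where u: "norm u = 1" using vector_choose_size[of 1] by auto
  have "((\<lambda>h. (h *\<^sub>R u, - h)) \<longlongrightarrow> (0 *\<^sub>R u, - 0)) (at_right (0::real))" by (intro tendsto_intros)
  moreover have "\<forall>\<^sub>F h in at_right 0. (h *\<^sub>R u, - h) \<in> closure ?C"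
    unfolding eventually_at_right_field
    by (intro exI[of _ "min 1 r"]) (use closure_subset[of ?C] u assms(2) in \<open>auto intro!: subsetD[OF closure_subset]\<close>)
  ultimately have "(0 *\<^sub>R u, - 0) \<in> closure ?C"
    by (intro Lim_in_closed_set[of _ _ "at_right (0::real)"]) auto
  then have fr: "(0, 0) \<in> frontier ?C" and lim: "(0, 0) islimpt ?C"
    using oC by (auto simp: frontier_def interior_open closure_def)
  \<comment> \<open>Zero on the outer wall and at the bottom, where S is only known to be
    nonnegative, and 1 at the origin.\<close>
  define f where "f z = (1 + snd z) * (1 - norm (fst z) / r)" for z :: "'a \<times> real"
  define S where "S z = ln r - ln ((norm (fst z))\<^sup>2) / 2 + 1 / (- snd z)" for z :: "'a \<times> real"
  have S: "S (x, t) = ln (r / norm x) + 1 / (- t)" if "x \<noteq> 0" for x t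
    using that assms(2) by (simp add: S_def ln_realpow ln_div)
  have S_ge: "S (x, t) \<ge> ln (r / norm x)" "S (x, t) \<ge> 1 / (- t)" "S (x, t) \<ge> 0" if "(x, t) \<in> ?C" for x t
  proof -
    have "x \<noteq> 0" "r / norm x \<ge> 1" "1 / (- t) \<ge> 0" using that by auto
    then show "S (x, t) \<ge> ln (r / norm x)" "S (x, t) \<ge> 1 / (- t)" "S (x, t) \<ge> 0"
      using ln_ge_zero[of "r / norm x"] unfolding S[OF \<open>x \<noteq> 0\<close>] by linarith+
  qed
  have "\<not> regular_point 2 ?C (0, 0)"
  proof (rule not_regular_point_if_supersolutions[where f = f and g = "\<lambda>z. 0" and s = S and L = 0])
    show "continuous_on (frontier ?C) f" unfolding f_def using assms(2) by (intro continuous_intros) auto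
    show "strict_supersolution_at (\<lambda>z. 0 + \<epsilon> * S z) z" if "\<epsilon> > 0" "z \<in> ?C" for \<epsilon> z
    proof -
      obtain x t where xt: "z = (x, t)" by (cases z)
      with that(2) have "x \<noteq> 0" "t < 0" by auto
      from punctured_supersolution[OF assms(1) that(1) this, of "ln r"] show ?thesis
        by (simp only: S_def xt add_0)
    qed
    show "\<exists>\<^sub>F z in at (0, 0) within ?C. (0::real) \<le> 0"
      using lim by (simp add: trivial_limit_within frequently_def)
    show "0 < f (0, 0)" by (simp add: f_def)
    fix \<epsilon> \<kappa> :: real and \<xi> :: "'a \<times> real"
    assume \<epsilon>: "\<epsilon> > 0" and \<xi>: "\<xi> \<in> frontier ?C" and \<kappa>: "\<kappa> > 0"
    obtain x t where xt: "\<xi> = (x, t)" by (cases \<xi>)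
    have cl: "norm x \<le> r" "-1 \<le> t" "t \<le> 0"
      using \<xi> clC by (auto simp: frontier_def xt)
    have inC: "\<forall>\<^sub>F z in at \<xi> within ?C. z \<in> ?C" by (simp add: eventually_at_filter)
    have tends: "(fst \<longlongrightarrow> x) (at \<xi> within ?C)" "(snd \<longlongrightarrow> t) (at \<xi> within ?C)"
      using tendsto_fst[OF tendsto_ident_at, of \<xi> ?C] tendsto_snd[OF tendsto_ident_at, of \<xi> ?C] by (simp_all add: xt)
    have f1: "f \<xi> \<le> 1"
    proof -
      have "f \<xi> \<le> 1 * 1" unfolding f_def xt using cl assms(2) by (intro mult_mono) auto
      then show ?thesis by simp
    qed
    have zero: "\<forall>\<^sub>F z in at \<xi> within ?C. f \<xi> - \<kappa> \<le> 0 + \<epsilon> * S z" if "f \<xi> = 0"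
      using inC
    proof eventually_elim
      case (elim z)
      then have "0 \<le> \<epsilon> * S z" using S_ge(3)[of "fst z" "snd z"] \<epsilon> by simp
      then show ?case using that \<kappa> by simp
    qed
    consider "norm x = r" | "t = -1" | "x = 0" | "t = 0" | "(x, t) \<in> ?C" using cl by fastforce
    then show "\<forall>\<^sub>F z in at \<xi> within ?C. f \<xi> - \<kappa> \<le> 0 + \<epsilon> * S z"
    proof cases
      case 1
      then have "f \<xi> = 0" using assms(2) by (simp add: f_def xt)
      then show ?thesis by (rule zero)
    next
      case 2
      then have "f \<xi> = 0" by (simp add: f_def xt)
      then show ?thesis by (rule zero)
    next
      case 3
      have "((\<lambda>z. norm (fst z)) \<longlongrightarrow> 0) (at \<xi> within ?C)" using tendsto_norm[OF tends(1)] 3 by simp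
      then have "\<forall>\<^sub>F z in at \<xi> within ?C. norm (fst z) < r * exp (- 1 / \<epsilon>)"
        by (rule order_tendstoD) (use assms(2) in simp)
      with inC show ?thesis
      proof eventually_elim
        case (elim z)
        then have pos: "norm (fst z) > 0" by auto
        have "norm (fst z) * exp (1 / \<epsilon>) < r" using elim(2) by (simp add: field_simps exp_minus)
        then have "r / norm (fst z) > exp (1 / \<epsilon>)" using pos by (simp add: pos_less_divide_eq mult.commute)
        then have "1 / \<epsilon> \<le> ln (r / norm (fst z))"
          using pos assms(2) by (subst ln_ge_iff) auto
        then have "1 / \<epsilon> \<le> S z" using S_ge(1)[of "fst z" "snd z"] elim(1) by simp
        then have "1 \<le> \<epsilon> * S z" using \<epsilon> by (simp add: pos_divide_le_eq mult.commute)
        then show ?case using f1 \<kappa> by simp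
      qed
    next
      case 4
      have "\<forall>\<^sub>F z in at \<xi> within ?C. snd z > - \<epsilon>" using tends(2) \<epsilon> 4 by (intro order_tendstoD) auto
      with inC show ?thesis
      proof eventually_elim
        case (elim z)
        then have "0 < - snd z" "- snd z \<le> \<epsilon>" by auto
        then have "1 / \<epsilon> \<le> 1 / (- snd z)" by (intro frac_le) auto
        then have "1 / \<epsilon> \<le> S z" using S_ge(2)[of "fst z" "snd z"] elim(1) by simp
        then have "1 \<le> \<epsilon> * S z" using \<epsilon> by (simp add: pos_divide_le_eq mult.commute)
        then show ?case using f1 \<kappa> by simp
      qed
    next
      case 5
      then show ?thesis using \<xi> oC by (simp add: frontier_def interior_open xt)
    qed
  qed
  with fr show ?thesis by (simp add: irregular_point_def)
qed

section \<open>Power domains in the plane\<close>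

lemma has_derivative_powr_compose:
  fixes f :: "real \<Rightarrow> real"
  assumes "(f has_field_derivative f') (at x)" "f x > 0"
  shows "((\<lambda>x. f x powr r) has_field_derivative r * f x powr (r - 1) * f') (at x)"
  using DERIV_chain2[OF has_real_derivative_powr[OF assms(2)] assms(1)] .

definition log_barrier :: "real \<Rightarrow> real \<Rightarrow> real \<Rightarrow> real \<Rightarrow> real \<Rightarrow> real" where
  "log_barrier \<Lambda> c \<alpha> s t = c * (\<Lambda> - ln (s - t)) powr (- \<alpha>)
     - (\<Lambda> - ln s) / 2 * (\<Lambda> - ln (s - t)) powr (- \<alpha> - 1)"

text \<open>The time derivative is A/U with U = |x|^2 + |t|. Since L \<ge> S/2, the choice \<alpha>
  c = 1/4 gives A \<ge> (S/4) S powr (-\<alpha>-2). The positive spatial terms lack the factor S, so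
  they lose once S > 40.\<close>

lemma log_barrier_supersolution:
  fixes x :: "'a::euclidean_space"
  assumes dim: "DIM('a) = 2" and c: "c > 0" and \<alpha>: "\<alpha> = 1 / (4 * c)" "\<alpha> \<le> 1"
    and x: "x \<noteq> 0" "t < 0" "\<Lambda> - ln ((norm x)\<^sup>2 - t) > 40"
  shows "strict_supersolution_at (\<lambda>z. log_barrier \<Lambda> c \<alpha> ((norm (fst z))\<^sup>2) (snd z)) (x, t)"
proof -
  define W where "W = {z :: real \<times> real. 0 < fst z} \<inter> {z. snd z < 0} \<inter> {z. fst z - snd z < exp (\<Lambda> - 40)}"
  define S where "S s t = \<Lambda> - ln (s - t)" for s t :: real
  define L where "L s = (\<Lambda> - ln s) / 2" for s :: real
  \<comment> \<open>\<open>A\<close> and \<open>AS\<close> are the first and second derivatives of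
    the barrier with respect to S at fixed L. The others follow by the chain rule from dS/dt = 1/(s
    - t) and dS/ds = -1/(s - t).\<close>
  define A where "A s t = - \<alpha> * c * S s t powr (- \<alpha> - 1) + (1 + \<alpha>) * L s * S s t powr (- \<alpha> - 1 - 1)" for s t
  define AS where "AS s t = \<alpha> * (1 + \<alpha>) * c * S s t powr (- \<alpha> - 1 - 1)
    - (1 + \<alpha>) * (2 + \<alpha>) * L s * S s t powr (- \<alpha> - 1 - 1 - 1)" for s t
  define Fs where "Fs s t = - (A s t / (s - t)) + S s t powr (- \<alpha> - 1) / (2 * s)" for s t
  define As where "As s t = - (AS s t / (s - t)) - (1 + \<alpha>) * S s t powr (- \<alpha> - 1 - 1) / (2 * s)" for s t
  define Fss where "Fss s t = A s t / (s - t)\<^sup>2 - As s t / (s - t)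
    + (1 + \<alpha>) * S s t powr (- \<alpha> - 1 - 1) / (2 * s * (s - t)) - S s t powr (- \<alpha> - 1) / (2 * s\<^sup>2)" for s t
  have F: "log_barrier \<Lambda> c \<alpha> s t = c * S s t powr (- \<alpha>) - L s * S s t powr (- \<alpha> - 1)" for s t
    by (simp add: log_barrier_def S_def L_def)
  have \<alpha>0: "\<alpha> > 0" using c \<alpha> by simp
  have W: "s > 0" "t < 0" "s - t > 0" "S s t > 40" if "(s, t) \<in> W" for s t
  proof -
    show "s > 0" "t < 0" "s - t > 0" using that by (auto simp: W_def)
    then have "ln (s - t) < ln (exp (\<Lambda> - 40))"
      using that by (subst ln_less_cancel_iff) (auto simp: W_def)
    then show "S s t > 40" by (simp add: S_def)
  qed
  have S0: "S s t > 0" if "(s, t) \<in> W" for s t using W(4)[OF that] by simp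
  have Ss: "((\<lambda>s. S s t) has_field_derivative - 1 / (s - t)) (at s)"
    and St: "((\<lambda>t. S s t) has_field_derivative 1 / (s - t)) (at t)" if "(s, t) \<in> W" for s t
    using W[OF that] unfolding S_def by (auto intro!: derivative_eq_intros)
  have Ls: "(L has_field_derivative - 1 / (2 * s)) (at s)" if "s > 0" for s
    using that unfolding L_def[abs_def] by (auto intro!: derivative_eq_intros)
  note PS = has_derivative_powr_compose[OF Ss S0]
  note PT = has_derivative_powr_compose[OF St S0]
  show ?thesis
  proof (rule radial_strict_supersolution[of W x t "log_barrier \<Lambda> c \<alpha>" "\<lambda>s t. A s t / (s - t)" Fs Fss])
    show "open W" unfolding W_def by (intro open_Int open_Collect_less continuous_intros)
    have "(norm x)\<^sup>2 - t > 0" using x by (simp add: less_le_trans[of t 0])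
    then have "(norm x)\<^sup>2 - t < exp (\<Lambda> - 40)" using x(3) by (subst ln_less_cancel_iff[symmetric]) auto
    then show "((norm x)\<^sup>2, t) \<in> W" using x by (simp add: W_def)
    show "continuous_on W (\<lambda>(s, t). A s t / (s - t))"
    proof -
      have "continuous_on W (\<lambda>z. S (fst z) (snd z))"
        unfolding S_def using W(3) by (intro continuous_intros) force
      moreover have "continuous_on W (\<lambda>z. L (fst z))"
        unfolding L_def using W(1) by (intro continuous_intros) force+
      ultimately show ?thesis
        unfolding A_def split_beta using S0 W(3)
        by (intro continuous_intros) (force+)
    qed
  next
    fix s t assume st: "(s, t) \<in> W"
    note W' = W[OF st]
    define U where "U = s - t"
    have U: "U > 0" "s \<le> U" using W' by (auto simp: U_def)
    then have nz: "U \<noteq> 0" "s \<noteq> 0" using W' by auto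
    show "((\<lambda>t. log_barrier \<Lambda> c \<alpha> s t) has_field_derivative A s t / (s - t)) (at t)"
      unfolding F
      by (rule DERIV_cong[OF DERIV_diff[OF DERIV_cmult[OF PT[OF st st]] DERIV_cmult[OF PT[OF st st]]]])
        (unfold A_def U_def[symmetric], use nz in \<open>simp add: field_simps\<close>)
    show "((\<lambda>s. log_barrier \<Lambda> c \<alpha> s t) has_field_derivative Fs s t) (at s)"
      unfolding F
      by (rule DERIV_cong[OF DERIV_diff[OF DERIV_cmult[OF PS[OF st st]] DERIV_mult[OF Ls[OF W'(1)] PS[OF st st]]]])
        (unfold A_def Fs_def U_def[symmetric], use nz in \<open>simp add: field_simps\<close>)
    have As: "((\<lambda>s. A s t) has_field_derivative As s t) (at s)"
      unfolding A_def
      by (rule DERIV_cong[OF DERIV_add[OF DERIV_cmult[OF PS[OF st st]] DERIV_mult[OF DERIV_cmult[OF Ls[OF W'(1)]] PS[OF st st]]]])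
        (unfold As_def AS_def U_def[symmetric], use nz in \<open>simp add: field_simps\<close>)
    have Us: "((\<lambda>s. s - t) has_field_derivative 1) (at s)" and s2: "((\<lambda>s. 2 * s) has_field_derivative 2) (at s)"
      by (auto intro!: derivative_eq_intros)
    have ne: "s - t \<noteq> 0" "2 * s \<noteq> 0" using W' by auto
    show "((\<lambda>s. Fs s t) has_field_derivative Fss s t) (at s)"
      unfolding Fs_def
      by (rule DERIV_cong[OF DERIV_add[OF DERIV_minus[OF DERIV_divide[OF As Us ne(1)]] DERIV_divide[OF PS[OF st st] s2 ne(2)]]])
        (unfold Fss_def U_def[symmetric], use nz in \<open>simp add: field_simps power2_eq_square\<close>)
    define P1 where "P1 = S s t powr (- \<alpha> - 1)"
    define P2 where "P2 = S s t powr (- \<alpha> - 1 - 1)"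
    have expo: "1 + (- \<alpha> - 1 - 1) = - \<alpha> - 1" by simp
    have "S s t \<ge> 0" using W'(4) by simp
    from powr_mult_base[OF this, of "- \<alpha> - 1 - 1", unfolded expo]
    have P: "P2 > 0" "P1 = S s t * P2" using W'(4) by (auto simp only: P1_def P2_def powr_gt_zero)
    have L: "L s \<ge> S s t / 2"
      using W' by (simp add: L_def S_def)
    have ac: "\<alpha> * c = 1 / 4" using c \<alpha> by simp
    have A: "A s t = P2 * (- (S s t / 4) + (1 + \<alpha>) * L s)"
      unfolding A_def P1_def[symmetric] P2_def[symmetric] P(2) using ac by (simp add: algebra_simps)
    have "(1 + \<alpha>) * L s \<ge> 1 * L s" using L W'(4) \<alpha>0 by (intro mult_right_mono) auto
    then have "- (S s t / 4) + (1 + \<alpha>) * L s \<ge> S s t / 4" using L by linarith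
    then have A_ge: "A s t \<ge> P2 * (S s t / 4)" unfolding A using P(1) by (intro mult_left_mono) auto
    have AS_le: "AS s t \<le> (1 + \<alpha>) / 4 * P2"
    proof -
      have "AS s t \<le> \<alpha> * (1 + \<alpha>) * c * P2"
        unfolding AS_def P2_def using \<alpha>0 L W'(4) by (simp add: mult_nonneg_nonneg)
      also have "\<dots> = (1 + \<alpha>) / 4 * P2" using ac by (simp add: algebra_simps)
      finally show ?thesis .
    qed
    \<comment> \<open>The terms with P1 cancel: they come from differentiating L alone, and ln s is
      harmonic in the plane.\<close>
    have id: "2 * real DIM('a) * Fs s t + 4 * s * Fss s t
      = - 4 * A s t * (U - s) / U\<^sup>2 + 4 * s * AS s t / U\<^sup>2 + 4 * (1 + \<alpha>) * P2 / U"
      unfolding Fs_def Fss_def As_def P2_def[symmetric] P1_def[symmetric] U_def[symmetric] dim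
      using U(1) W'(1) by (simp add: field_simps power2_eq_square)
    have "- 4 * A s t * (U - s) / U\<^sup>2 \<le> 0"
    proof -
      have "A s t \<ge> 0" using A_ge P(1) W'(4) by (meson less_imp_le mult_nonneg_nonneg order_trans divide_nonneg_pos zero_less_numeral)
      then show ?thesis using U by (simp add: mult_nonneg_nonneg)
    qed
    moreover have "4 * s * AS s t / U\<^sup>2 \<le> (1 + \<alpha>) * P2 / U"
    proof -
      have "4 * s * AS s t \<le> 4 * s * ((1 + \<alpha>) / 4 * P2)" using AS_le W'(1) by (intro mult_left_mono) auto
      also have "\<dots> = s * ((1 + \<alpha>) * P2)" by simp
      also have "\<dots> \<le> U * ((1 + \<alpha>) * P2)" using U P \<alpha>0 by (intro mult_right_mono) auto
      finally have "4 * s * AS s t / U\<^sup>2 \<le> U * ((1 + \<alpha>) * P2) / U\<^sup>2" by (rule divide_right_mono) simp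
      also have "\<dots> = (1 + \<alpha>) * P2 / U" using U(1) by (simp add: power2_eq_square)
      finally show ?thesis .
    qed
    moreover have "(1 + \<alpha>) * P2 / U + 4 * (1 + \<alpha>) * P2 / U < A s t / U"
    proof -
      \<comment> \<open>The threshold 40 originates here: 5 (1 + \<alpha>) \<le> 10 because \<alpha>
        \<le> 1.\<close>
      have "5 * (1 + \<alpha>) < S s t / 4" using W'(4) \<alpha>(2) by simp
      then have "5 * (1 + \<alpha>) * P2 < S s t / 4 * P2" using P(1) by (rule mult_strict_right_mono)
      also have "\<dots> \<le> A s t" using A_ge by (simp add: mult.commute)
      finally have "5 * (1 + \<alpha>) * P2 / U < A s t / U" using U(1) by (rule divide_strict_right_mono)
      then show ?thesis by (simp add: algebra_simps add_divide_distrib)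
    qed
    ultimately show "A s t / (s - t) > 2 * real DIM('a) * Fs s t + 4 * s * Fss s t"
      unfolding id U_def[symmetric] by linarith
  qed
qed

text \<open>A logarithm turns the exponent into a mere factor: in the domain |x|^2 + |t| is at most
  (1 + \<theta>) |x| powr m, so L is bounded by S/m plus a constant for every l > 0. The barrier is
  therefore comparable with S powr (-\<alpha>), which tends to 0 at the origin only.\<close>

lemma power_domain_regular_planar:
  assumes dim: "DIM('a::euclidean_space) = 2" and \<theta>: "\<theta> > 0" and l: "l > 0"
  shows "regular_point 2 (power_domain l \<theta> :: ('a \<times> real) set) (0, 0)"
proof -
  define m where "m = min l 2"
  have m: "m > 0" "m \<le> 2" "m \<le> l" using l by (auto simp: m_def)
  define C where "C = ln (1 + \<theta>)"
  have C: "C > 0" using \<theta> by (simp add: C_def)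
  \<comment> \<open>The part 1/m pays for L \<le> S/m + C/m and the part 1 leaves S - C/m \<ge> S/2.
    The constant \<Lambda> below is large enough for S > 40 and S \<ge> 2 C/m.\<close>
  define c where "c = 1 / m + 1"
  define \<alpha> where "\<alpha> = 1 / (4 * c)"
  define \<Lambda> where "\<Lambda> = C + 41 + 2 * (C / m)"
  have c: "c > 0" "c \<ge> 1" using m by (auto simp: c_def add_pos_pos)
  then have \<alpha>: "\<alpha> > 0" "\<alpha> \<le> 1" by (auto simp: \<alpha>_def field_simps)
  have Cm: "C / m > 0" using C m by simp
  have \<Lambda>: "\<Lambda> > 0" using C Cm by (simp add: \<Lambda>_def)
  let ?D = "power_domain l \<theta> :: ('a \<times> real) set"
  let ?w = "\<lambda>z::'a \<times> real. log_barrier \<Lambda> c \<alpha> ((norm (fst z))\<^sup>2) (snd z)"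
  define S where "S z = \<Lambda> - ln ((norm (fst z))\<^sup>2 - snd z)" for z :: "'a \<times> real"
  have pos: "(norm x)\<^sup>2 - t > 0" if "(x, t) \<in> ?D" for x t
    using in_power_domain(1,3)[OF that \<theta> l] by (simp add: less_le_trans[of t 0])
  have S40: "S (x, t) > 40" "S (x, t) \<ge> 2 * (C / m)" and L: "(\<Lambda> - ln ((norm x)\<^sup>2)) / 2 \<le> S (x, t) / m + C / m"
    "(\<Lambda> - ln ((norm x)\<^sup>2)) / 2 \<ge> 0" if D: "(x, t) \<in> ?D" for x t
  proof -
    note P = in_power_domain[OF D \<theta> l]
    have nx: "norm x > 0" using P(1) by simp
    have "norm x powr l \<le> norm x powr m" "norm x powr 2 \<le> norm x powr m"
      using P m by (intro powr_mono'; simp)+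
    moreover from this(1) have "\<theta> * norm x powr l \<le> \<theta> * norm x powr m"
      using \<theta> by (intro mult_left_mono) auto
    ultimately have "- t \<le> \<theta> * norm x powr m" "(norm x)\<^sup>2 \<le> norm x powr m"
      using P(4) nx by auto
    then have "(norm x)\<^sup>2 - t \<le> (1 + \<theta>) * norm x powr m" by (simp add: algebra_simps)
    then have "ln ((norm x)\<^sup>2 - t) \<le> ln ((1 + \<theta>) * norm x powr m)"
      using pos[OF D] nx \<theta> by (subst ln_le_cancel_iff) auto
    also have "\<dots> = C + m * ln (norm x)" using nx \<theta> by (simp add: ln_mult ln_powr C_def)
    finally have S_ge: "S (x, t) \<ge> \<Lambda> - C - m * ln (norm x)" by (simp add: S_def)
    have lnneg: "ln (norm x) < 0" using nx P(2) by simp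
    then have "m * ln (norm x) < 0" using m(1) by (simp add: mult_pos_neg)
    then show "S (x, t) > 40" "S (x, t) \<ge> 2 * (C / m)" using S_ge C Cm by (auto simp: \<Lambda>_def)
    have ln2: "ln ((norm x)\<^sup>2) = 2 * ln (norm x)" using nx by (simp add: ln_realpow)
    show "(\<Lambda> - ln ((norm x)\<^sup>2)) / 2 \<ge> 0" using lnneg \<Lambda> by (simp add: ln2)
    have "- ln (norm x) \<le> (S (x, t) - \<Lambda> + C) / m"
      using S_ge m(1) by (simp add: pos_le_divide_eq algebra_simps)
    moreover have "\<Lambda> / 2 \<le> \<Lambda> / m" using m \<Lambda> by (intro divide_left_mono) auto
    ultimately show "(\<Lambda> - ln ((norm x)\<^sup>2)) / 2 \<le> S (x, t) / m + C / m"
      by (simp add: ln2 add_divide_distrib diff_divide_distrib)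
  qed
  have w: "?w (x, t) = S (x, t) powr (- \<alpha> - 1) * (c * S (x, t) - (\<Lambda> - ln ((norm x)\<^sup>2)) / 2)"
    and Spow: "S (x, t) powr (- \<alpha>) = S (x, t) * S (x, t) powr (- \<alpha> - 1)" if "(x, t) \<in> ?D" for x t
  proof -
    have "1 + (- \<alpha> - 1) = - \<alpha>" by simp
    moreover have "S (x, t) \<ge> 0" using S40(1)[OF that] by simp
    ultimately show *: "S (x, t) powr (- \<alpha>) = S (x, t) * S (x, t) powr (- \<alpha> - 1)"
      using powr_mult_base[of "S (x, t)" "- \<alpha> - 1"] by (simp only:)
    have "?w (x, t) = c * S (x, t) powr (- \<alpha>) - (\<Lambda> - ln ((norm x)\<^sup>2)) / 2 * S (x, t) powr (- \<alpha> - 1)"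
      by (simp add: log_barrier_def S_def)
    then show "?w (x, t) = S (x, t) powr (- \<alpha> - 1) * (c * S (x, t) - (\<Lambda> - ln ((norm x)\<^sup>2)) / 2)"
      unfolding * by (simp only: algebra_simps)
  qed
  have w_ge: "?w (x, t) \<ge> S (x, t) powr (- \<alpha>) / 2" and w_le: "?w (x, t) \<le> c * S (x, t) powr (- \<alpha>)"
    if D: "(x, t) \<in> ?D" for x t
  proof -
    have cS: "c * S (x, t) = S (x, t) / m + S (x, t)" by (simp add: c_def algebra_simps)
    have "S (x, t) / 2 \<le> c * S (x, t) - (\<Lambda> - ln ((norm x)\<^sup>2)) / 2"
      using L(1)[OF D] S40(2)[OF D] unfolding cS by linarith
    then have "S (x, t) powr (- \<alpha> - 1) * (S (x, t) / 2) \<le> ?w (x, t)"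
      unfolding w[OF D] by (intro mult_left_mono) auto
    then show "?w (x, t) \<ge> S (x, t) powr (- \<alpha>) / 2" unfolding Spow[OF D] by (simp add: mult.commute)
    have "?w (x, t) \<le> S (x, t) powr (- \<alpha> - 1) * (c * S (x, t))"
      unfolding w[OF D] using L(2)[OF D] by (intro mult_left_mono) auto
    then show "?w (x, t) \<le> c * S (x, t) powr (- \<alpha>)" unfolding Spow[OF D] by (simp add: mult_ac)
  qed
  have inD: "\<forall>\<^sub>F z in at (0, 0) within ?D. z \<in> ?D" by (simp add: eventually_at_filter)
  show ?thesis
  proof (rule regular_point_if_barrier[where w = ?w])
    show "strict_supersolution_at ?w z" if "z \<in> ?D" for z
    proof -
      obtain x t where xt: "z = (x, t)" by (cases z)
      with that have D: "(x, t) \<in> ?D" by simp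
      show ?thesis unfolding xt
        by (rule log_barrier_supersolution[OF dim c(1) \<alpha>_def \<alpha>(2)])
          (use in_power_domain[OF D \<theta> l] S40(1)[OF D] in \<open>auto simp: S_def\<close>)
    qed
    show "?w z > 0" if "z \<in> ?D" for z
    proof -
      obtain x t where xt: "z = (x, t)" by (cases z)
      with that have D: "(x, t) \<in> ?D" by simp
      have "S (x, t) powr (- \<alpha>) > 0" using S40(1)[OF D] by simp
      then show ?thesis using w_ge[OF D] unfolding xt by linarith
    qed
    show "(?w \<longlongrightarrow> 0) (at (0, 0) within ?D)"
    proof (rule tendsto_sandwich[OF _ _ tendsto_const])
      show "\<forall>\<^sub>F z in at (0, 0) within ?D. 0 \<le> ?w z"
        using inD
      proof eventually_elim
        case (elim z)
        have "0 \<le> S z powr (- \<alpha>) / 2" by simp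
        also have "\<dots> \<le> ?w z" using w_ge[of "fst z" "snd z"] elim by simp
        finally show ?case .
      qed
      show "\<forall>\<^sub>F z in at (0, 0) within ?D. ?w z \<le> c * S z powr (- \<alpha>)"
        using inD by eventually_elim (use w_le in \<open>metis prod.collapse\<close>)
      have "isCont (\<lambda>z::'a \<times> real. (norm (fst z))\<^sup>2 - snd z) (0, 0)" by (intro continuous_intros)
      then have "((\<lambda>z::'a \<times> real. (norm (fst z))\<^sup>2 - snd z) \<longlongrightarrow> 0) (at (0, 0) within ?D)"
        by (auto simp: isCont_def intro: tendsto_within_subset)
      moreover have "\<forall>\<^sub>F z in at (0, 0) within ?D. (norm (fst z))\<^sup>2 - snd z \<in> {0<..}"
        using inD
      proof eventually_elim
        case (elim z)
        then show ?case using pos[of "fst z" "snd z"] by simp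
      qed
      ultimately have "filterlim (\<lambda>z::'a \<times> real. (norm (fst z))\<^sup>2 - snd z) (at_right 0) (at (0, 0) within ?D)"
        by (auto simp: filterlim_at elim: eventually_mono)
      from filterlim_compose[OF ln_at_0 this]
      have "filterlim (\<lambda>z::'a \<times> real. - ln ((norm (fst z))\<^sup>2 - snd z)) at_top (at (0, 0) within ?D)"
        by (simp add: filterlim_uminus_at_top)
      from filterlim_tendsto_add_at_top[OF tendsto_const[of \<Lambda>] this]
      have "filterlim S at_top (at (0, 0) within ?D)" unfolding S_def[abs_def] by simp
      then have "((\<lambda>z. S z powr (- \<alpha>)) \<longlongrightarrow> 0) (at (0, 0) within ?D)"
        using \<alpha>(1) by (intro tendsto_neg_powr) auto
      from tendsto_mult_left[OF this, of c]
      show "((\<lambda>z. c * S z powr (- \<alpha>)) \<longlongrightarrow> 0) (at (0, 0) within ?D)" by simp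
    qed
    show "\<exists>m>0. \<forall>z\<in>?D. dist z (0, 0) \<ge> \<delta> \<longrightarrow> ?w z \<ge> m" if "\<delta> > 0" for \<delta>
    proof -
      define \<kappa> where "\<kappa> = min ((\<delta> / 2)\<^sup>2) (\<delta> / 2)"
      define B where "B = max (\<Lambda> - ln \<kappa>) 1"
      have \<kappa>: "\<kappa> > 0" using that by (simp add: \<kappa>_def)
      have "?w z \<ge> B powr (- \<alpha>) / 2" if z: "z \<in> ?D" "dist z (0, 0) \<ge> \<delta>" for z
      proof -
        obtain x t where xt: "z = (x, t)" by (cases z)
        with z(1) have D: "(x, t) \<in> ?D" by simp
        have "(norm x)\<^sup>2 - t \<ge> \<kappa>"
        proof (cases "norm x \<ge> \<delta> / 2")
          case True
          then have "(norm x)\<^sup>2 \<ge> (\<delta> / 2)\<^sup>2" using \<open>\<delta> > 0\<close> by (intro power_mono) auto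
          then show ?thesis using in_power_domain(3)[OF D \<theta> l] by (simp add: \<kappa>_def)
        next
          case False
          then have "\<bar>t\<bar> \<ge> \<delta> / 2" using dist_zero_ge_cases[of \<delta> x t] z(2) by (simp add: xt)
          then have "- t \<ge> \<kappa>" using in_power_domain(3)[OF D \<theta> l] by (simp add: \<kappa>_def)
          then show ?thesis using zero_le_power2[of "norm x"] by linarith
        qed
        then have "ln \<kappa> \<le> ln ((norm x)\<^sup>2 - t)" using \<kappa> by (subst ln_le_cancel_iff) auto
        then have "S (x, t) \<le> B" by (simp add: S_def B_def)
        then have "B powr (- \<alpha>) \<le> S (x, t) powr (- \<alpha>)"
          using S40(1)[OF D] \<alpha>(1) by (intro powr_mono2') auto
        then show ?thesis using w_ge[OF D] by (simp add: xt)
      qed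
      moreover have "B powr (- \<alpha>) / 2 > 0" by (simp add: B_def)
      ultimately show ?thesis by blast
    qed
  qed (use open_power_domain[OF l] bounded_power_domain[OF \<theta> l] zero_frontier_power_domain[OF \<theta> l] in auto)
qed

section \<open>Thin holes in dimension at least three\<close>

text \<open>The exponent \<gamma> - \<kappa> + 1 is the largest of the three as \<kappa> < 1, so
  beyond some Q its term outweighs both negative ones, and up to Q the constant B does. The bound
  \<kappa> \<le> 1/2 allows q powr \<kappa> to be replaced by the square root, which makes Q
  explicit.\<close>

lemma monomial_bound:
  fixes a b \<kappa> \<gamma> :: real
  assumes "0 < \<kappa>" "\<kappa> \<le> 1 / 2" "\<kappa> < \<gamma>" "a > 0" "b > 0" "d > 0"
  obtains B where "B > 0" "\<And>q. q > 0 \<Longrightarrow> 0 \<le> B - a * q powr (\<gamma> - \<kappa>) + d * q powr (\<gamma> - \<kappa> + 1) - b * q powr \<gamma>"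
proof -
  define Q where "Q = max 1 (((a + b) / d)\<^sup>2)"
  define B where "B = a * Q powr (\<gamma> - \<kappa>) + b * Q powr \<gamma>"
  have Q: "Q \<ge> 1" by (simp add: Q_def)
  have "B > 0" using assms Q by (simp add: B_def add_pos_pos)
  moreover have "0 \<le> B - a * q powr (\<gamma> - \<kappa>) + d * q powr (\<gamma> - \<kappa> + 1) - b * q powr \<gamma>" if q: "q > 0" for q
  proof (cases "q \<le> Q")
    case True
    have "a * q powr (\<gamma> - \<kappa>) \<le> a * Q powr (\<gamma> - \<kappa>)" "b * q powr \<gamma> \<le> b * Q powr \<gamma>"
      using True q assms by (auto intro!: powr_mono2)
    moreover have "d * q powr (\<gamma> - \<kappa> + 1) \<ge> 0" using assms by simp
    ultimately show ?thesis by (simp add: B_def)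
  next
    case False
    then have q1: "q \<ge> 1" "q \<ge> ((a + b) / d)\<^sup>2" by (auto simp: Q_def)
    then have sq: "(a + b) / d \<le> sqrt q" by (intro real_le_rsqrt)
    have half: "q powr (1 / 2) = sqrt q" using q by (simp add: powr_half_sqrt)
    have "q powr \<kappa> \<le> sqrt q" unfolding half[symmetric] using q1 assms by (intro powr_mono) auto
    moreover have "1 \<le> sqrt q" using q1 by simp
    ultimately have "a * 1 + b * q powr \<kappa> \<le> a * sqrt q + b * sqrt q"
      using assms by (intro add_mono mult_left_mono) auto
    also have "\<dots> = (a + b) * sqrt q" by (simp add: algebra_simps)
    also have "\<dots> \<le> (d * sqrt q) * sqrt q"
      using sq assms q by (intro mult_right_mono) (auto simp: pos_divide_le_eq mult.commute)
    also have "\<dots> = d * q" using q by simp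
    finally have "a + b * q powr \<kappa> \<le> d * q" by simp
    then have "q powr (\<gamma> - \<kappa>) * (a + b * q powr \<kappa>) \<le> q powr (\<gamma> - \<kappa>) * (d * q)"
      by (intro mult_left_mono) auto
    moreover have "q powr (\<gamma> - \<kappa>) * q powr \<kappa> = q powr \<gamma>" by (simp add: powr_add[symmetric])
    moreover have "q powr (\<gamma> - \<kappa>) * q = q powr (\<gamma> - \<kappa> + 1)" using q by (simp add: powr_add)
    ultimately show ?thesis using \<open>B > 0\<close> by (simp add: algebra_simps)
  qed
  ultimately show thesis by (rule that)
qed

section \<open>Monomials in |x|^2 and -t, and the potential of a thin hole\<close>

definition monomial :: "real \<Rightarrow> real \<Rightarrow> real \<Rightarrow> real \<Rightarrow> real" where
  "monomial \<mu> \<nu> s t = s powr \<mu> * (- t) powr \<nu>"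

lemma monomial_deriv_s:
  assumes "s > 0"
  shows "((\<lambda>s. monomial \<mu> \<nu> s t) has_field_derivative \<mu> * monomial (\<mu> - 1) \<nu> s t) (at s)"
  using DERIV_cmult_right[OF has_real_derivative_powr[OF assms, of \<mu>], of "(- t) powr \<nu>"]
  unfolding monomial_def by (simp add: mult.assoc)

lemma monomial_deriv_t:
  assumes "t < 0"
  shows "((\<lambda>t. monomial \<mu> \<nu> s t) has_field_derivative - (\<nu> * monomial \<mu> (\<nu> - 1) s t)) (at t)"
proof -
  have "((\<lambda>t. - t) has_field_derivative - 1) (at t)" by (auto intro!: derivative_eq_intros)
  from has_derivative_powr_compose[OF this, of \<nu>] assms
  have "((\<lambda>t. (- t) powr \<nu>) has_field_derivative \<nu> * (- t) powr (\<nu> - 1) * - 1) (at t)" by simp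
  from DERIV_cmult[OF this] show ?thesis unfolding monomial_def by (rule DERIV_cong) simp
qed

lemma monomial_nonneg: "monomial \<mu> \<nu> s t \<ge> 0"
  by (simp add: monomial_def)

lemma monomial_pos: "s > 0 \<Longrightarrow> t < 0 \<Longrightarrow> monomial \<mu> \<nu> s t > 0"
  by (simp add: monomial_def)

lemma continuous_on_monomial:
  "continuous_on ({z. 0 < fst z} \<inter> {z. snd z < 0}) (\<lambda>z. monomial \<mu> \<nu> (fst z) (snd z))"
  unfolding monomial_def by (intro continuous_intros) auto

lemma monomial_times_s:
  assumes "s > 0" shows "s * monomial (\<mu> - 1) \<nu> s t = monomial \<mu> \<nu> s t"
proof -
  have "s * s powr (\<mu> - 1) = s powr \<mu>" using powr_mult_base[of s "\<mu> - 1"] assms by simp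
  then show ?thesis by (simp add: monomial_def mult.assoc[symmetric])
qed

text \<open>Parabolic scaling: up to a power of |t| a monomial is a function of q = -t/s alone, so
  the supersolution inequality becomes one in a single variable.\<close>

lemma monomial_ratio:
  assumes "s > 0" "t < 0"
  shows "monomial (- a) (b + a) s t = monomial 0 b s t * (- t / s) powr a"
proof -
  have "(- t / s) powr a = (- t) powr a / s powr a" by (rule powr_divide)
  then show ?thesis using assms by (simp add: monomial_def powr_add powr_minus divide_inverse)
qed

text \<open>The main term \<open>s powr (-\<gamma>) (-t) powr (\<beta>+\<gamma>)\<close> is harmonic in space but decreases in time. The
  first term compensates this where \<open>-t\<close> is large compared with \<open>s\<close>, the last one elsewhere.\<close>

definition potential :: "real \<Rightarrow> real \<Rightarrow> real \<Rightarrow> real \<Rightarrow> real \<Rightarrow> real \<Rightarrow> real" where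
  "potential B \<gamma> \<kappa> \<beta> s t = monomial (- (\<gamma> - \<kappa>)) (\<beta> + (\<gamma> - \<kappa>)) s t + monomial (- \<gamma>) (\<beta> + \<gamma>) s t
     - B * monomial 0 \<beta> s t"

text \<open>As n = 2 \<gamma> + 2, the Laplacian of s powr (-a) is -4 a (\<gamma> - a) s powr
  (-a-1): zero for a = \<gamma> and negative for 0 < a < \<gamma>. Dividing by |t| powr (\<beta>-1)
  leaves the assumed inequality in q, and the term with \<epsilon> makes it strict.\<close>

lemma potential_supersolution:
  fixes x :: "'a::euclidean_space"
  assumes dim: "real DIM('a) = 2 * \<gamma> + 2" and B: "B > 0"
    and ineq: "\<And>q. q > 0 \<Longrightarrow> 0 \<le> B * \<beta> - (\<beta> + (\<gamma> - \<kappa>)) * q powr (\<gamma> - \<kappa>)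
        + 4 * \<kappa> * (\<gamma> - \<kappa>) * q powr (\<gamma> - \<kappa> + 1) - (\<beta> + \<gamma>) * q powr \<gamma>"
    and "\<epsilon> > 0" "x \<noteq> 0" "t < 0"
  shows "strict_supersolution_at (\<lambda>z. potential B \<gamma> \<kappa> \<beta> ((norm (fst z))\<^sup>2) (snd z) + \<epsilon> * (1 / (- snd z))) (x, t)"
proof -
  define a where "a = \<gamma> - \<kappa>"
  let ?W = "{z :: real \<times> real. 0 < fst z} \<inter> {z. snd z < 0}"
  define F where "F s t = monomial (- a) (\<beta> + a) s t + monomial (- \<gamma>) (\<beta> + \<gamma>) s t - B * monomial 0 \<beta> s t + \<epsilon> * monomial 0 (- 1) s t" for s t
  define Ft where "Ft s t = - ((\<beta> + a) * monomial (- a) (\<beta> + a - 1) s t) + - ((\<beta> + \<gamma>) * monomial (- \<gamma>) (\<beta> + \<gamma> - 1) s t)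
     - B * - (\<beta> * monomial 0 (\<beta> - 1) s t) + \<epsilon> * - (- 1 * monomial 0 (- 1 - 1) s t)" for s t
  define Fs where "Fs s t = - a * monomial (- a - 1) (\<beta> + a) s t + - \<gamma> * monomial (- \<gamma> - 1) (\<beta> + \<gamma>) s t" for s t
  define Fss where "Fss s t = - a * ((- a - 1) * monomial (- a - 1 - 1) (\<beta> + a) s t)
     + - \<gamma> * ((- \<gamma> - 1) * monomial (- \<gamma> - 1 - 1) (\<beta> + \<gamma>) s t)" for s t
  have "strict_supersolution_at (\<lambda>z. F ((norm (fst z))\<^sup>2) (snd z)) (x, t)"
  proof (rule radial_strict_supersolution[of ?W x t F Ft Fs Fss])
    show "open ?W" by (intro open_Int open_Collect_less continuous_intros)
    show "((norm x)\<^sup>2, t) \<in> ?W" using assms by simp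
    show "continuous_on ?W (\<lambda>(s, t). Ft s t)"
      unfolding split_beta Ft_def by (intro continuous_intros continuous_on_monomial)
  next
    fix s t assume "(s, t) \<in> ?W"
    then have s: "s > 0" and t: "t < 0" by auto
    note ds = monomial_deriv_s[OF s, of _ _ t] and dt = monomial_deriv_t[OF t, of _ _ s]
    show "((\<lambda>t. F s t) has_field_derivative Ft s t) (at t)"
      unfolding F_def Ft_def by (intro DERIV_add DERIV_diff DERIV_cmult dt)
    show "((\<lambda>s. F s t) has_field_derivative Fs s t) (at s)"
      unfolding F_def Fs_def
      by (rule DERIV_cong[OF DERIV_add[OF DERIV_diff[OF DERIV_add[OF ds ds] DERIV_cmult[OF ds]] DERIV_cmult[OF ds]]]) simp
    show "((\<lambda>s. Fs s t) has_field_derivative Fss s t) (at s)"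
      unfolding Fs_def Fss_def by (intro DERIV_add DERIV_cmult ds)
    define T where "T = monomial 0 (\<beta> - 1) s t"
    define q where "q = - t / s"
    have T: "T > 0" unfolding T_def by (rule monomial_pos[OF s t])
    have q: "q > 0" using s t by (simp add: q_def divide_neg_pos)
    have r: "monomial (- a) (\<beta> + a - 1) s t = T * q powr a" "monomial (- \<gamma>) (\<beta> + \<gamma> - 1) s t = T * q powr \<gamma>"
      "monomial (- a - 1) (\<beta> + a) s t = T * q powr (a + 1)"
    proof -
      have e: "\<beta> - 1 + a = \<beta> + a - 1" "\<beta> - 1 + \<gamma> = \<beta> + \<gamma> - 1" "\<beta> - 1 + (a + 1) = \<beta> + a"
        "- (a + 1) = - a - 1" by auto
      show "monomial (- a) (\<beta> + a - 1) s t = T * q powr a"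
        using monomial_ratio[OF s t, of a "\<beta> - 1"] unfolding e T_def q_def .
      show "monomial (- \<gamma>) (\<beta> + \<gamma> - 1) s t = T * q powr \<gamma>"
        using monomial_ratio[OF s t, of \<gamma> "\<beta> - 1"] unfolding e T_def q_def .
      show "monomial (- a - 1) (\<beta> + a) s t = T * q powr (a + 1)"
        using monomial_ratio[OF s t, of "a + 1" "\<beta> - 1"] unfolding e T_def q_def .
    qed
    have sm: "s * monomial (- a - 1 - 1) (\<beta> + a) s t = monomial (- a - 1) (\<beta> + a) s t"
      "s * monomial (- \<gamma> - 1 - 1) (\<beta> + \<gamma>) s t = monomial (- \<gamma> - 1) (\<beta> + \<gamma>) s t"
      by (rule monomial_times_s[OF s])+
    have "4 * s * Fss s t = 4 * (a * (a + 1)) * (s * monomial (- a - 1 - 1) (\<beta> + a) s t)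
        + 4 * (\<gamma> * (\<gamma> + 1)) * (s * monomial (- \<gamma> - 1 - 1) (\<beta> + \<gamma>) s t)"
      unfolding Fss_def by (simp add: algebra_simps)
    then have "2 * real DIM('a) * Fs s t + 4 * s * Fss s t = - (4 * \<kappa> * a) * monomial (- a - 1) (\<beta> + a) s t"
      unfolding sm Fs_def dim by (simp add: a_def algebra_simps)
    then have lap: "2 * real DIM('a) * Fs s t + 4 * s * Fss s t = T * (- (4 * \<kappa> * a * q powr (a + 1)))"
      unfolding r by simp
    have "Ft s t = T * (B * \<beta> - (\<beta> + a) * q powr a - (\<beta> + \<gamma>) * q powr \<gamma>) + \<epsilon> * monomial 0 (- 1 - 1) s t"
      unfolding Ft_def r T_def[symmetric] by (simp add: algebra_simps)
    moreover have "\<epsilon> * monomial 0 (- 1 - 1) s t > 0" using monomial_pos[OF s t] \<open>\<epsilon> > 0\<close> by simp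
    moreover have "0 \<le> T * (B * \<beta> - (\<beta> + a) * q powr a + 4 * \<kappa> * a * q powr (a + 1) - (\<beta> + \<gamma>) * q powr \<gamma>)"
      using ineq[OF q] T unfolding a_def by (intro mult_nonneg_nonneg) auto
    moreover have "T * (B * \<beta> - (\<beta> + a) * q powr a + 4 * \<kappa> * a * q powr (a + 1) - (\<beta> + \<gamma>) * q powr \<gamma>)
       = T * (B * \<beta> - (\<beta> + a) * q powr a - (\<beta> + \<gamma>) * q powr \<gamma>) - T * (- (4 * \<kappa> * a * q powr (a + 1)))"
      by (simp add: algebra_simps)
    ultimately show "Ft s t > 2 * real DIM('a) * Fs s t + 4 * s * Fss s t"
      unfolding lap by linarith
  qed
  \<comment> \<open>\<open>F\<close> expresses 1/(-t) as a monomial with factor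
    \<open>s powr 0\<close>, which is 1 off the axis but 0 on it; hence the agreement is asserted
    only near a point with x \<noteq> 0 and t < 0.\<close>
  moreover have "\<forall>\<^sub>F z in nhds (x, t). F ((norm (fst z))\<^sup>2) (snd z)
     = potential B \<gamma> \<kappa> \<beta> ((norm (fst z))\<^sup>2) (snd z) + \<epsilon> * (1 / (- snd z))"
  proof -
    have "open {z :: 'a \<times> real. fst z \<noteq> 0 \<and> snd z < 0}"
      by (intro open_Collect_conj open_Collect_neq open_Collect_less continuous_intros)
    then have "\<forall>\<^sub>F z in nhds (x, t). z \<in> {z. fst z \<noteq> 0 \<and> snd z < 0}"
      using assms by (intro eventually_nhds_in_open) auto
    then show ?thesis
      by eventually_elim (auto simp: F_def potential_def a_def monomial_def powr_minus_divide powr_neg_one)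
  qed
  ultimately show ?thesis by (rule strict_supersolution_at_cong)
qed

text \<open>The walls are located for t < 0 only; at t = 0, the origin included, the term
  \<epsilon>/(-t) takes over.\<close>

lemma frontier_power_domain:
  assumes \<theta>: "\<theta> > 0" and l: "l > 0"
    and \<xi>: "(x, t) \<in> frontier (power_domain l \<theta> :: ('a::euclidean_space \<times> real) set)"
  shows "t \<le> 0" "norm x \<le> 1" "t < 0 \<Longrightarrow> x \<noteq> 0"
    "t < 0 \<Longrightarrow> norm x = 1 \<or> - t = \<theta> * norm x powr l"
proof -
  let ?D = "power_domain l \<theta> :: ('a \<times> real) set"
  have c: "continuous_on UNIV (\<lambda>z::'a \<times> real. norm (fst z) powr l)"
    using l by (intro continuous_on_powr' continuous_intros) auto
  let ?E = "{z::'a \<times> real. snd z \<le> 0} \<inter> {z. - snd z \<le> \<theta> * norm (fst z) powr l} \<inter> {z. norm (fst z) \<le> 1}"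
  have "closed ?E" by (intro closed_Int closed_Collect_le continuous_intros c)
  moreover have "?D \<subseteq> ?E" using in_power_domain[OF _ \<theta> l] by (fastforce intro: less_imp_le)
  ultimately have "closure ?D \<subseteq> ?E" by (rule closure_minimal[rotated])
  moreover have mem: "(x, t) \<in> closure ?D" "(x, t) \<notin> ?D"
    using \<xi> open_power_domain[OF l, of \<theta>, where ?'a = 'a] by (auto simp: frontier_def interior_open)
  ultimately have E: "t \<le> 0" "- t \<le> \<theta> * norm x powr l" "norm x \<le> 1" by auto
  then show "t \<le> 0" "norm x \<le> 1" by auto
  show "x \<noteq> 0" if "t < 0" using E that by auto
  show "norm x = 1 \<or> - t = \<theta> * norm x powr l" if "t < 0"
  proof (rule ccontr)
    assume "\<not> ?thesis"
    then have "norm x < 1" "- t < \<theta> * norm x powr l" using E by auto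
    moreover have "norm x powr l < 1 powr l" using \<open>norm x < 1\<close> l by (intro powr_less_mono2) auto
    ultimately have "(x, t) \<in> ?D" using that \<theta> by (simp add: power_domain_def)
    with mem show False by simp
  qed
qed

text \<open>The main term of the potential equals d on the wall of the hole, but is |t| powr \<beta>
  times q powr \<gamma> in general and so tends to 0 along the parabola q = \<theta>/2. The Perron
  solution thus stays below d/2 arbitrarily close to the origin, where f equals d.\<close>

lemma power_domain_irregular:
  assumes dim: "DIM('a::euclidean_space) \<ge> 3" and \<theta>: "\<theta> > 0" and l: "0 < l" "l < 2"
  shows "\<not> regular_point 2 (power_domain l \<theta> :: ('a \<times> real) set) (0, 0)"
proof -
  let ?D = "power_domain l \<theta> :: ('a \<times> real) set"
  define \<gamma> where "\<gamma> = (real DIM('a) - 2) / 2"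
  \<comment> \<open>Any \<kappa> \<le> 1/2 with 0 < \<kappa> < \<gamma> would do; 1/4 is admissible
    in all these dimensions because \<gamma> \<ge> 1/2.\<close>
  define \<kappa> :: real where "\<kappa> = 1 / 4"
  \<comment> \<open>Solves l (\<beta> + \<gamma>) = 2 \<gamma>, the condition for |x| powr
    (-2\<gamma>) times |t| powr (\<beta>+\<gamma>) to be constant on |t| = \<theta> |x| powr l. It
    is positive exactly when l < 2.\<close>
  define \<beta> where "\<beta> = (2 / l - 1) * \<gamma>"
  have \<gamma>: "\<gamma> \<ge> 1 / 2" "real DIM('a) = 2 * \<gamma> + 2" using dim by (simp_all add: \<gamma>_def field_simps)
  have \<kappa>: "0 < \<kappa>" "\<kappa> \<le> 1 / 2" "\<kappa> < \<gamma>" using \<gamma> by (auto simp: \<kappa>_def)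
  have "2 / l > 1" using l by simp
  then have \<beta>: "\<beta> > 0" using \<gamma> by (simp add: \<beta>_def)
  have l\<beta>: "l * (\<beta> + \<gamma>) = 2 * \<gamma>" using l by (simp add: \<beta>_def field_simps)
  obtain B0 where B0: "B0 > 0" "\<And>q. q > 0 \<Longrightarrow> 0 \<le> B0 - (\<beta> + (\<gamma> - \<kappa>)) * q powr (\<gamma> - \<kappa>)
      + 4 * \<kappa> * (\<gamma> - \<kappa>) * q powr (\<gamma> - \<kappa> + 1) - (\<beta> + \<gamma>) * q powr \<gamma>"
    using monomial_bound[OF \<kappa>, of "\<beta> + (\<gamma> - \<kappa>)" "\<beta> + \<gamma>" "4 * \<kappa> * (\<gamma> - \<kappa>)"] \<beta> \<kappa> \<gamma>(1) by auto
  define B where "B = B0 / \<beta>"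
  have B: "B > 0" "B * \<beta> = B0" using B0(1) \<beta> by (auto simp: B_def)
  define d where "d = \<theta> powr (\<beta> + \<gamma>)"
  have d: "d > 0" using \<theta> by (simp add: d_def)
  \<comment> \<open>Made to lie below the potential on both walls: on the hole d - B |t| powr
    \<beta> is available, on |x| = 1 only -B |t| powr \<beta>, whence the factor 1 - |x|.\<close>
  define f where "f z = d * (1 - norm (fst z)) - B * \<bar>snd z\<bar> powr \<beta>" for z :: "'a \<times> real"
  let ?g = "\<lambda>z::'a \<times> real. potential B \<gamma> \<kappa> \<beta> ((norm (fst z))\<^sup>2) (snd z)"
  let ?s = "\<lambda>z::'a \<times> real. 1 / (- snd z)"
  have super: "strict_supersolution_at (\<lambda>z. ?g z + \<epsilon> * ?s z) (x, t)" if "\<epsilon> > 0" "x \<noteq> 0" "t < 0" for \<epsilon> x t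
    using potential_supersolution[OF \<gamma>(2) B(1) _ that, of \<beta> \<kappa>] B0(2) unfolding B(2) by blast
  have g_ge: "?g (x, t) \<ge> monomial (- \<gamma>) (\<beta> + \<gamma>) ((norm x)\<^sup>2) t - B * (- t) powr \<beta>" if "x \<noteq> 0" for x t
    using monomial_nonneg that by (simp add: potential_def) (simp add: monomial_def)
  have hole: "monomial (- \<gamma>) (\<beta> + \<gamma>) ((norm x)\<^sup>2) t = d" if "x \<noteq> 0" "- t = \<theta> * norm x powr l" for x :: 'a and t
  proof -
    have "(norm x)\<^sup>2 = norm x powr 2" using that(1) by simp
    then have "((norm x)\<^sup>2) powr (- \<gamma>) = norm x powr (- (2 * \<gamma>))" by (simp only: powr_powr) simp
    moreover have "(\<theta> * norm x powr l) powr (\<beta> + \<gamma>) = d * norm x powr (2 * \<gamma>)"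
      using \<theta> by (simp add: powr_mult powr_powr l\<beta> d_def)
    ultimately show ?thesis using that by (simp add: monomial_def powr_minus)
  qed
  show ?thesis
  proof (rule not_regular_point_if_supersolutions[where f = f and g = ?g and s = ?s and L = "d / 2"])
    show "continuous_on (frontier ?D) f"
      unfolding f_def using \<beta> by (intro continuous_intros continuous_on_powr') auto
    show "strict_supersolution_at (\<lambda>z. ?g z + \<epsilon> * ?s z) z" if "\<epsilon> > 0" "z \<in> ?D" for \<epsilon> z
      using super[OF that(1), of "fst z" "snd z"] in_power_domain[of "fst z" "snd z", OF _ \<theta> l(1)] that(2) by simp
    show "d / 2 < f (0, 0)" using d by (simp add: f_def)
    show "\<exists>\<^sub>F z in at (0, 0) within ?D. ?g z \<le> d / 2"
    proof -
      obtain u :: 'a where u: "norm u = 1" using vector_choose_size[of 1] by auto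
      \<comment> \<open>This parabola lies in the domain for 0 < r < 1 since r^2/2 < r powr l. Along
        it q = \<theta>/2, and the potential is at most a constant times |t| powr \<beta>.\<close>
      define p where "p r = (r *\<^sub>R u, - (\<theta> / 2 * r\<^sup>2))" for r
      have lim: "(p \<longlongrightarrow> (0 *\<^sub>R u, - (\<theta> / 2 * 0\<^sup>2))) (at_right 0)" unfolding p_def by (intro tendsto_intros)
      have small: "\<forall>\<^sub>F r in at_right (0::real). 0 < r \<and> r < 1"
        unfolding eventually_at_right_field by (intro exI[of _ 1]) auto
      have pD: "p r \<in> ?D" if "0 < r" "r < 1" for r
      proof -
        have "r powr 2 \<le> r powr l" using that l by (intro powr_mono') auto
        moreover have r1: "r powr l < 1" using that l powr_less_mono2[of l r 1] by simp
        moreover have "r\<^sup>2 > 0" "r powr 2 = r\<^sup>2" using that by auto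
        ultimately have "r\<^sup>2 / 2 < r powr l" by linarith
        then have "\<theta> * (r\<^sup>2 / 2) < \<theta> * r powr l" using \<theta> by (rule mult_strict_left_mono)
        then show ?thesis using that u \<theta> r1 by (simp add: p_def power_domain_def)
      qed
      have filt: "filterlim p (at (0, 0) within ?D) (at_right 0)"
        unfolding filterlim_at
      proof
        show "\<forall>\<^sub>F r in at_right 0. p r \<in> ?D \<and> p r \<noteq> (0, 0)"
          using small
        proof eventually_elim
          case (elim r)
          then show ?case using pD[of r] u by (auto simp: p_def)
        qed
        show "(p \<longlongrightarrow> (0, 0)) (at_right 0)" using lim by simp
      qed
      define M where "M = (\<theta> / 2) powr (\<gamma> - \<kappa>) + (\<theta> / 2) powr \<gamma>"
      have gp: "?g (p r) \<le> (\<theta> / 2 * r\<^sup>2) powr \<beta> * M" if r: "0 < r" for r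
      proof -
        have n: "(norm (fst (p r)))\<^sup>2 = r\<^sup>2" "snd (p r) = - (\<theta> / 2 * r\<^sup>2)" using u by (simp_all add: p_def)
        have s: "r\<^sup>2 > 0" "- (\<theta> / 2 * r\<^sup>2) < 0" and q: "- (- (\<theta> / 2 * r\<^sup>2)) / r\<^sup>2 = \<theta> / 2" using r \<theta> by auto
        have "?g (p r) \<le> monomial (- (\<gamma> - \<kappa>)) (\<beta> + (\<gamma> - \<kappa>)) (r\<^sup>2) (- (\<theta> / 2 * r\<^sup>2)) + monomial (- \<gamma>) (\<beta> + \<gamma>) (r\<^sup>2) (- (\<theta> / 2 * r\<^sup>2))"
          unfolding potential_def n using B(1) monomial_nonneg[of 0 \<beta> "r\<^sup>2" "- (\<theta> / 2 * r\<^sup>2)"] by simp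
        also have "\<dots> = monomial 0 \<beta> (r\<^sup>2) (- (\<theta> / 2 * r\<^sup>2)) * M"
          unfolding monomial_ratio[OF s] q M_def by (simp only: distrib_left)
        also have "\<dots> = (\<theta> / 2 * r\<^sup>2) powr \<beta> * M" using r by (simp add: monomial_def)
        finally show ?thesis .
      qed
      have "continuous_on UNIV (\<lambda>r::real. (\<theta> / 2 * r\<^sup>2) powr \<beta> * M)"
        using \<beta> \<theta> by (intro continuous_intros continuous_on_powr') auto
      then have "isCont (\<lambda>r::real. (\<theta> / 2 * r\<^sup>2) powr \<beta> * M) 0" by (simp add: continuous_on_eq_continuous_at)
      then have "((\<lambda>r. (\<theta> / 2 * r\<^sup>2) powr \<beta> * M) \<longlongrightarrow> 0) (at_right 0)"
        using \<beta> by (auto simp: isCont_def intro: tendsto_within_subset)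
      then have "\<forall>\<^sub>F r in at_right 0. (\<theta> / 2 * r\<^sup>2) powr \<beta> * M < d / 2"
        using d by (intro order_tendstoD) auto
      with small have ev: "\<forall>\<^sub>F r in at_right 0. ?g (p r) \<le> d / 2"
      proof eventually_elim
        case (elim r)
        then show ?case using gp[of r] by linarith
      qed
      show ?thesis
      proof (rule ccontr)
        assume "\<not> ?thesis"
        then have "\<forall>\<^sub>F z in at (0, 0) within ?D. \<not> ?g z \<le> d / 2" by (simp add: not_frequently)
        from eventually_compose_filterlim[OF this filt] ev
        have "\<forall>\<^sub>F r in at_right (0::real). False" by eventually_elim simp
        then show False by simp
      qed
    qed
    fix \<epsilon> \<delta> :: real and \<xi> :: "'a \<times> real"
    assume \<epsilon>: "\<epsilon> > 0" and \<xi>: "\<xi> \<in> frontier ?D" and \<delta>: "\<delta> > 0"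
    obtain x t where xt: "\<xi> = (x, t)" by (cases \<xi>)
    note fr = frontier_power_domain[OF \<theta> l(1) \<xi>[unfolded xt]]
    show "\<forall>\<^sub>F z in at \<xi> within ?D. f \<xi> - \<delta> \<le> ?g z + \<epsilon> * ?s z"
    proof (cases "t < 0")
      case True
      have x: "x \<noteq> 0" using fr(3)[OF True] .
      have "f \<xi> \<le> ?g \<xi>"
        using fr(4)[OF True]
      proof
        assume "norm x = 1"
        then have "f \<xi> = - B * (- t) powr \<beta>" using True by (simp add: f_def xt)
        then show ?thesis
          using g_ge[OF x, of t] monomial_nonneg[of "- \<gamma>" "\<beta> + \<gamma>" "(norm x)\<^sup>2" t] unfolding xt by linarith
      next
        assume "- t = \<theta> * norm x powr l"
        then have "?g \<xi> \<ge> d - B * (- t) powr \<beta>" using g_ge[OF x, of t] hole[OF x, of t] by (simp add: xt)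
        moreover have "f \<xi> \<le> d - B * (- t) powr \<beta>"
          using True d by (simp add: f_def xt algebra_simps)
        ultimately show ?thesis by linarith
      qed
      moreover have "\<epsilon> * ?s \<xi> \<ge> 0" using \<epsilon> True by (simp add: xt divide_nonneg_neg mult_nonneg_nonpos)
      ultimately have lt: "f \<xi> - \<delta> < ?g \<xi> + \<epsilon> * ?s \<xi>" using \<delta> by linarith
      have "isCont (\<lambda>z. ?g z + \<epsilon> * ?s z) \<xi>"
        unfolding xt by (rule strict_supersolution_continuous[OF super[OF \<epsilon> x True]])
      then have "((\<lambda>z. ?g z + \<epsilon> * ?s z) \<longlongrightarrow> ?g \<xi> + \<epsilon> * ?s \<xi>) (at \<xi> within ?D)"
        unfolding isCont_def by (rule tendsto_within_subset) simp
      from order_tendstoD(1)[OF this lt] show ?thesis by (rule eventually_mono) simp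
    next
      case False
      then have t: "t = 0" using fr(1) by simp
      \<comment> \<open>Here d bounds f at time 0 and B \<theta> powr \<beta> the negative term of
        the potential, so it is enough that \<epsilon>/|t| \<ge> M near time 0, whatever |x|
        is.\<close>
      define M where "M = d + B * \<theta> powr \<beta>"
      have M: "M > 0" using d B(1) by (simp add: M_def add_pos_nonneg)
      have "f \<xi> \<le> d" using d \<beta> by (simp add: f_def xt t algebra_simps)
      have "(snd \<longlongrightarrow> t) (at \<xi> within ?D)" using tendsto_snd[OF tendsto_ident_at, of \<xi> ?D] by (simp add: xt)
      then have "\<forall>\<^sub>F z in at \<xi> within ?D. snd z > - (\<epsilon> / M)"
        using \<epsilon> M by (intro order_tendstoD) (auto simp: t)
      moreover have "\<forall>\<^sub>F z in at \<xi> within ?D. z \<in> ?D" by (simp add: eventually_at_filter)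
      ultimately show ?thesis
      proof eventually_elim
        case (elim z)
        obtain y \<tau> where z: "z = (y, \<tau>)" by (cases z)
        have D: "(y, \<tau>) \<in> ?D" using elim by (simp add: z)
        note P = in_power_domain[OF D \<theta> l(1)]
        have "- \<tau> < \<epsilon> / M" using elim(1) by (simp add: z)
        then have "M * - \<tau> < \<epsilon>" using M by (simp add: pos_less_divide_eq mult.commute)
        then have "M \<le> \<epsilon> * (1 / - \<tau>)" using P(3) by (simp add: field_simps)
        moreover have "(- \<tau>) powr \<beta> \<le> \<theta> powr \<beta>" using P(3,5) \<beta> by (intro powr_mono2) auto
        then have "B * (- \<tau>) powr \<beta> \<le> B * \<theta> powr \<beta>" using B(1) by simp
        ultimately show ?case
          using g_ge[OF P(1), of \<tau>] monomial_nonneg[of "- \<gamma>" "\<beta> + \<gamma>" "(norm y)\<^sup>2" \<tau>] \<open>f \<xi> \<le> d\<close> \<delta>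
          unfolding z fst_conv snd_conv M_def by linarith
      qed
    qed
  qed
qed

theorem proposition1p5:
  fixes \<theta> l :: real
  assumes "\<theta> > 0" and "l > 0" and "CARD('n::finite) \<ge> 2"
  shows "(CARD('n) = 2 \<longrightarrow>
            regular_point 2 (power_domain l \<theta> :: ((real^'n) \<times> real) set) (0, 0) \<and>
            (\<forall>r>0. irregular_point 2 ((ball (0 :: real^'n) r - {0}) \<times> {-1<..<0}) (0, 0))) \<and>
         (CARD('n) \<ge> 3 \<longrightarrow>
            (regular_point 2 (power_domain l \<theta> :: ((real^'n) \<times> real) set) (0, 0) \<longleftrightarrow> l \<ge> 2))"
proof -
  have dim: "DIM(real^'n) = CARD('n)" by simp
  show ?thesis
    using power_domain_regular_planar[where ?'a = "real^'n"] punctured_cylinder_irregular[where ?'a = "real^'n"]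
      power_domain_irregular[where ?'a = "real^'n"] power_domain_regular_parabolic[where ?'a = "real^'n"] assms
    unfolding dim by (meson not_le)
qed

end
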